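(* Let $\mathbb{B}$ be the weighted adjacency matrix of the line graph of a finite, simple, weighted directed graph with $m$ edges. Let $c_1,\dots,c_m>0$ be real numbers, $C=\mathrm{diag}(c_j)$, $\mathbb{B}^C=C^{-1}\mathbb{B}C$, and let $q=(q_j)_{j=1}^m$ with $q_j\in L^\infty([0,1])$. Then the flow problem $$\begin{cases}\frac{\partial}{\partial t}u_j(x,t)=c_j\frac{\partial}{\partial x}u_j(x,t)+q_j(x)u_j(x,t),& x\in(0,1),\ t\ge0,\\ u_j(1,t)=\sum_{k=1}^m\mathbb{B}^C_{jk}u_k(0,t),& t\ge0,\\ u_j(x,0)=f_j(x),& x\in(0,1),\end{cases}\qquad j=1,\dots,m,$$ is well-posed on $X=L^\infty([0,1],\mathbb{C}^m)$; that is, the abstract Cauchy problem on $X$ for the operator $A(f_j)=(c_jf_j'+q_jf_j)$ with domain $D(A)=\{f\in W^{1,\infty}([0,1],\mathbb{C}^m)\mid f(1)=\mathbb{B}^Cf(0)\}$ is well-posed with respect to the weak$^*$-topology.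
   Context: **Graph.** $G=(V,E)$ is a finite directed graph with edges $E=\{e_1,\dots,e_m\}\subseteq V\times V$, simple (no loops or multiple edges). For an edge $(v_i,v_k)$, $v_i$ is its tail and $v_k$ its head. It carries weights $0\le w_{ij}\le 1$ ($1\le i,j\le m$), with $w_{ij}\ne0$ only if the head of $e_j$ is the tail of $e_i$, such that $\sum_{i=1}^m w_{ij}=1$ for all $j$. The $m\times m$ matrix $\mathbb{B}$ is defined by $\mathbb{B}_{ij}=w_{ij}$ if the head of $e_j$ is the tail of $e_i$, and $\mathbb{B}_{ij}=0$ otherwise; it is column-stochastic. **Space.** $\mathbb{C}^m\cong\ell^1(\{1,\dots,m\})$ carries the $\ell^1$-norm, and $\|f\|_X=\operatorname{ess\,sup}_{s\in[0,1]}\|f(s)\|_{\ell^1}$. $X$ is identified with the dual of $L^1([0,1],\mathbb{C}^m)$ via $\langle f,g\rangle=\int_0^1\langle f(s),g(s)\rangle\,ds$; the weak$^*$-topology on $X$ is the one induced by this duality. Functions in $W^{1,\infty}$ are evaluated at points through continuous representatives. **Well-posedness.** Let $\tau$ denote the weak$^*$-topology. The abstract Cauchy problem $\dot u(t)=Au(t)$ ($t\ge0$), $u(0)=f\in D(A)$, is well-posed in $X$ if: (i) for every $f\in D(A)$ there is a solution $u(t)=u(t,f)$ with $u\in B_{loc}(\mathbb{R}_+,X)\cap C^1(\mathbb{R}_+,(X,\tau))$ and $\dot u\in B_{loc}(\mathbb{R}_+,X)$; (ii) the solution is unique; (iii) if $(f_n)\subseteq D(A)$ is norm-bounded and $\tau$-convergent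 to $0$, then the solutions $u(t,f_n)$ converge to $0$ in $\tau$ uniformly for $t$ in compact intervals $[0,t_0]$. Here $B_{loc}(\mathbb{R}_+,X)$ is the space of functions that are norm-bounded on each compact subset of $\mathbb{R}_+$, and differentiation is understood in the vector-valued sense with respect to $\tau$. *)

theory Defs
  imports "HOL-Probability.Essential_Supremum" "Graph_Theory.Digraph"
begin

section \<open>The weighted adjacency matrix of the line graph\<close>

text \<open>The edges \<open>e\<^sub>1, \<dots>, e\<^sub>m\<close> are the elements of a finite type \<open>'m\<close>; the locale \<open>digraph\<close>
  (finite, no loops, no multiple arcs) then says that \<open>e \<mapsto> (tail e, head e)\<close> embeds them
  into the set of pairs of vertices.\<close>

definition simple_weighted_digraph ::
    "('v, 'm::finite) pre_digraph \<Rightarrow> ('m \<Rightarrow> 'm \<Rightarrow> real) \<Rightarrow> bool" where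
  "simple_weighted_digraph G w \<longleftrightarrow>
     digraph G \<and> arcs G = UNIV \<and>
     (\<forall>i j. 0 \<le> w i j \<and> w i j \<le> 1) \<and>
     (\<forall>i j. w i j \<noteq> 0 \<longrightarrow> head G j = tail G i) \<and>
     (\<forall>j. (\<Sum>i\<in>UNIV. w i j) = 1)"

definition line_graph_matrix ::
    "('v, 'm::finite) pre_digraph \<Rightarrow> ('m \<Rightarrow> 'm \<Rightarrow> real) \<Rightarrow> complex^'m^'m" where
  "line_graph_matrix G w = (\<chi> i j. if head G j = tail G i then complex_of_real (w i j) else 0)"

definition diag_matrix :: "('m \<Rightarrow> real) \<Rightarrow> complex^'m^'m" where
  "diag_matrix c = (\<chi> i j. if i = j then complex_of_real (c i) else 0)"

definition conj_matrix :: "('m::finite \<Rightarrow> real) \<Rightarrow> complex^'m^'m \<Rightarrow> complex^'m^'m" where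
  "conj_matrix c B = matrix_inv (diag_matrix c) ** B ** diag_matrix c"


section \<open>The space \<open>L\<^sup>\<infinity>([0,1], \<complex>\<^sup>m)\<close> and its weak* topology\<close>

text \<open>Elements of \<open>L\<^sup>p\<close> spaces are represented by functions on \<open>\<real>\<close>. Everything below depends
  only on their classes modulo equality almost everywhere on \<open>[0,1]\<close>, and equality of elements
  is the relation \<open>ae_eq\<close>.\<close>

abbreviation I01 :: "real measure" where
  "I01 \<equiv> lebesgue_on {0..1}"

definition ae_eq :: "(real \<Rightarrow> 'a) \<Rightarrow> (real \<Rightarrow> 'a) \<Rightarrow> bool" where
  "ae_eq f g \<longleftrightarrow> (AE s in I01. f s = g s)"

text \<open>The norm \<open>N\<close> on the range is a parameter, since the type class norm of \<open>complex^'m\<close> is the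
  Euclidean one and not the \<open>\<ell>\<^sup>1\<close>-norm.\<close>

definition Linf_norm :: "('a \<Rightarrow> real) \<Rightarrow> (real \<Rightarrow> 'a::topological_space) \<Rightarrow> ereal" where
  "Linf_norm N f = esssup I01 (\<lambda>s. ereal (N (f s)))"

definition Linf :: "('a \<Rightarrow> real) \<Rightarrow> (real \<Rightarrow> 'a::topological_space) set" where
  "Linf N = {f \<in> borel_measurable I01. Linf_norm N f < \<infinity>}"

definition l1norm :: "complex^'m \<Rightarrow> real" where
  "l1norm z = (\<Sum>i\<in>UNIV. cmod (z $ i))"

abbreviation X_norm :: "(real \<Rightarrow> complex^'m) \<Rightarrow> ereal" where
  "X_norm \<equiv> Linf_norm l1norm"

abbreviation X_space :: "(real \<Rightarrow> complex^'m) set" where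
  "X_space \<equiv> Linf l1norm"

definition pairing :: "(real \<Rightarrow> complex^'m) \<Rightarrow> (real \<Rightarrow> complex^'m) \<Rightarrow> complex" where
  "pairing f g = (LINT s|I01. (\<Sum>i\<in>UNIV. f s $ i * g s $ i))"

definition weak_star :: "(real \<Rightarrow> complex^'m) topology" where
  "weak_star = topology_generated_by
     {{f \<in> X_space. pairing f g \<in> U} | g U. integrable I01 g \<and> open U}"


section \<open>The space \<open>W\<^sup>1\<^sup>,\<^sup>\<infinity>([0,1], \<complex>\<^sup>m)\<close>\<close>

definition test_function :: "(real \<Rightarrow> real) \<Rightarrow> bool" where
  "test_function \<phi> \<longleftrightarrow> \<phi> C1_differentiable_on UNIV \<and> closure {s. \<phi> s \<noteq> 0} \<subseteq> {0<..<1}"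

definition is_weak_deriv :: "(real \<Rightarrow> complex^'m) \<Rightarrow> (real \<Rightarrow> complex^'m) \<Rightarrow> bool" where
  "is_weak_deriv f g \<longleftrightarrow>
     (\<forall>\<phi>. test_function \<phi> \<longrightarrow>
       (LINT s|I01. deriv \<phi> s *\<^sub>R f s) = - (LINT s|I01. \<phi> s *\<^sub>R g s))"

definition W1inf :: "(real \<Rightarrow> complex^'m) set" where
  "W1inf = {f \<in> X_space. \<exists>g\<in>X_space. is_weak_deriv f g}"

definition weak_deriv :: "(real \<Rightarrow> complex^'m) \<Rightarrow> real \<Rightarrow> complex^'m" where
  "weak_deriv f = (SOME g. g \<in> X_space \<and> is_weak_deriv f g)"

definition cont_rep :: "(real \<Rightarrow> complex^'m) \<Rightarrow> real \<Rightarrow> complex^'m" where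
  "cont_rep f = (SOME F. continuous_on {0..1} F \<and> ae_eq F f)"


section \<open>Well-posedness of the abstract Cauchy problem\<close>

definition B_loc :: "(real \<Rightarrow> real \<Rightarrow> complex^'m) \<Rightarrow> bool" where
  "B_loc u \<longleftrightarrow>
     (\<forall>t\<ge>0. u t \<in> X_space) \<and>
     (\<forall>K. compact K \<and> K \<subseteq> {0..} \<longrightarrow> (\<exists>M::real. \<forall>t\<in>K. X_norm (u t) \<le> ereal M))"

definition has_weak_star_deriv ::
    "(real \<Rightarrow> real \<Rightarrow> complex^'m) \<Rightarrow> (real \<Rightarrow> complex^'m) \<Rightarrow> real \<Rightarrow> bool" where
  "has_weak_star_deriv u d t \<longleftrightarrow>
     limitin weak_star (\<lambda>r s. (u r s - u t s) /\<^sub>R (r - t)) d (at t within {0..})"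

text \<open>Here \<open>v\<close> is the derivative of \<open>u\<close>.\<close>

definition is_solution ::
    "(real \<Rightarrow> complex^'m) set \<Rightarrow> ((real \<Rightarrow> complex^'m) \<Rightarrow> (real \<Rightarrow> complex^'m)) \<Rightarrow>
     (real \<Rightarrow> complex^'m) \<Rightarrow> (real \<Rightarrow> real \<Rightarrow> complex^'m) \<Rightarrow> bool" where
  "is_solution D A f u \<longleftrightarrow>
     (\<forall>t\<ge>0. u t \<in> D) \<and> ae_eq (u 0) f \<and> B_loc u \<and>
     (\<exists>v. (\<forall>t\<ge>0. has_weak_star_deriv u (v t) t) \<and>
          continuous_map (top_of_set {0..}) weak_star v \<and>
          B_loc v \<and>
          (\<forall>t\<ge>0. ae_eq (v t) (A (u t))))"

text \<open>Uniform convergence to \<open>0\<close> is taken in the uniformity of the weak* topology, that is, in terms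
  of neighbourhoods of \<open>0\<close>.\<close>

definition well_posed ::
    "(real \<Rightarrow> complex^'m) set \<Rightarrow> ((real \<Rightarrow> complex^'m) \<Rightarrow> (real \<Rightarrow> complex^'m)) \<Rightarrow> bool" where
  "well_posed D A \<longleftrightarrow>
     (\<forall>f\<in>D. \<exists>u. is_solution D A f u) \<and>
     (\<forall>f\<in>D. \<forall>u v. is_solution D A f u \<and> is_solution D A f v \<longrightarrow> (\<forall>t\<ge>0. ae_eq (u t) (v t))) \<and>
     (\<forall>f u. (\<forall>n::nat. f n \<in> D) \<and>
            (\<exists>M::real. \<forall>n. X_norm (f n) \<le> ereal M) \<and>
            limitin weak_star f (\<lambda>s. 0) sequentially \<and>
            (\<forall>n. is_solution D A (f n) (u n)) \<longrightarrow>
            (\<forall>t0\<ge>0. \<forall>U. openin weak_star U \<and> (\<lambda>s. 0) \<in> U \<longrightarrow>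
               (\<forall>\<^sub>F n in sequentially. \<forall>t\<in>{0..t0}. u n t \<in> U)))"


section \<open>The operator of the flow problem\<close>

definition flow_domain :: "complex^'m^'m \<Rightarrow> (real \<Rightarrow> complex^'m::finite) set" where
  "flow_domain BC = {f \<in> W1inf. cont_rep f 1 = BC *v cont_rep f 0}"

definition flow_operator ::
    "('m \<Rightarrow> real) \<Rightarrow> ('m \<Rightarrow> real \<Rightarrow> complex) \<Rightarrow> (real \<Rightarrow> complex^'m) \<Rightarrow> real \<Rightarrow> complex^'m" where
  "flow_operator c q f =
     (\<lambda>s. \<chi> j. complex_of_real (c j) * weak_deriv f s $ j + q j s * f s $ j)"

end

theory Submission
  imports Defs
begin

text \<open>
  The problem is solved by characteristics. With \<open>Q\<^sub>j(x) = \<integral>\<^sub>0\<^sup>x q\<^sub>j/c\<^sub>j\<close>, multiplication of the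
  \<open>j\<close>-th component by \<open>exp Q\<^sub>j\<close> (the gauge transformation) removes the potentials: \<open>w\<^sub>j = exp Q\<^sub>j u\<^sub>j\<close>
  satisfies \<open>\<partial>\<^sub>t w\<^sub>j = c\<^sub>j \<partial>\<^sub>x w\<^sub>j\<close> and \<open>w(1) = M w(0)\<close>, where \<open>M\<^sub>j\<^sub>k = exp Q\<^sub>j(1) B\<^sub>j\<^sub>k\<close> for the boundary
  matrix \<open>B\<close>. As \<open>w\<^sub>j\<close> is constant along characteristics, \<open>w\<^sub>j(t,x) = W\<^sub>j(t + x/c\<^sub>j)\<close> with
  \<open>W\<^sub>j(y) = w\<^sub>j(y,0)\<close>, and \<open>W\<close> is the solution of the delay system that has
  \<open>W\<^sub>j(y) = exp Q\<^sub>j(c\<^sub>j y) f\<^sub>j(c\<^sub>j y)\<close> for \<open>y \<le> 1/c\<^sub>j\<close> and \<open>W\<^sub>j(y) = \<Sum>\<^sub>k M\<^sub>j\<^sub>k W\<^sub>k(y - 1/c\<^sub>j)\<close> for \<open>y > 1/c\<^sub>j\<close>.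
  There are finitely many delays and all are positive, so the recursion for \<open>W\<close> terminates.

  For \<open>f\<close> in the domain, the boundary condition makes \<open>W\<close> continuous at the breakpoints, hence locally
  Lipschitz with a locally bounded density \<open>\<omega>\<close> (\<open>primitive_delay_ext\<close>), and the explicit
  function is a solution with derivative \<open>exp (-Q\<^sub>j) \<omega>\<^sub>j(t + x/c\<^sub>j)\<close> (\<open>flow_solution_is_solution\<close>).

  All weak* limits are taken of norm-bounded families. By density of step functions in \<open>L\<^sup>1\<close> it
  is enough to test them against indicators of intervals (\<open>tendsto_pairing_if_intervals\<close>), and the
  integral over an interval of \<open>W\<^sub>j(t + x/c\<^sub>j)\<close> in \<open>x\<close> is a difference of values of an antiderivative of \<open>W\<^sub>j\<close>.
  In particular no pointwise differentiability of Lipschitz functions is needed.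

  Conversely every solution \<open>u\<close> in the weak* sense is the explicit one
  (\<open>solution_eq_flow_solution\<close>): paired with \<open>exp Q\<^sub>j\<close> times the indicator of \<open>[a,b]\<close>, the equation
  says that \<open>\<integral>\<^sub>a\<^sup>b w\<^sub>j\<close> has the time derivative \<open>c\<^sub>j (w\<^sub>j(t,b) - w\<^sub>j(t,a))\<close>, and \<open>w\<^sub>j\<close> is Lipschitz in
  \<open>x\<close> because \<open>\<partial>\<^sub>t u\<close> is bounded; this forces constancy along the characteristics
  (\<open>transport_along_characteristics\<close>). Thus solutions are unique. Continuous dependence only concerns the explicit solutions: if
  \<open>f\<^sub>n\<close> is bounded and tends weakly* to \<open>0\<close>, then the antiderivatives of the corresponding \<open>W\<close>
  tend to \<open>0\<close> pointwise, by the delay recursion, and locally uniformly, as they are uniformly Lipschitz.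

  The domain is described by a classical fact about \<open>W\<^sup>1\<^sup>,\<^sup>\<infinity>\<close>, proved through the lemma of du Bois-Reymond:
  its elements are, up to null sets, the antiderivatives of bounded functions (\<open>W1inf_cont_rep\<close>,
  \<open>primitive_imp_W1inf\<close>).
\<close>

section \<open>Antiderivatives of bounded functions\<close>

text \<open>\<open>F\<close> is an antiderivative on \<open>[a,b]\<close> of the bounded measurable function \<open>f\<close>. The bound on \<open>f\<close> is
  required at every point and not only almost everywhere, which costs nothing since \<open>f\<close> may be changed on a null
  set. Integrals are Henstock-Kurzweil integrals; values outside \<open>[a,b]\<close> are irrelevant.\<close>

definition is_primitive :: "real \<Rightarrow> real \<Rightarrow> (real \<Rightarrow> complex) \<Rightarrow> (real \<Rightarrow> complex) \<Rightarrow> bool" where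
  "is_primitive a b F f \<longleftrightarrow> f \<in> borel_measurable (lebesgue_on {a..b}) \<and> bounded (f ` {a..b}) \<and>
     (\<forall>x y. a \<le> x \<and> x \<le> y \<and> y \<le> b \<longrightarrow> (f has_integral (F y - F x)) {x..y})"

text \<open>The calculus of these antiderivatives avoids pointwise derivatives: a product rule, say, holds as soon
  as both sides have the same increments up to a quadratic error.\<close>

lemma constant_if_quadratic_increments:
  fixes H :: "real \<Rightarrow> 'a::real_normed_vector"
  assumes "\<And>x y. \<lbrakk>a \<le> x; x \<le> y; y \<le> b\<rbrakk> \<Longrightarrow> norm (H y - H x) \<le> K * (y - x)\<^sup>2"
    and "x \<in> {a..b}" "y \<in> {a..b}"
  shows "H x = H y"
proof -
  have sym: "norm (H y - H x) \<le> K * (y - x)\<^sup>2" if "x \<in> {a..b}" "y \<in> {a..b}" for x y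
    using assms(1)[of x y] assms(1)[of y x] that
    by (cases "x \<le> y") (auto simp: norm_minus_commute power2_commute)
  have "(H has_derivative (\<lambda>h. 0)) (at x within {a..b})" if x: "x \<in> {a..b}" for x
    unfolding has_derivative_within_alt
  proof (intro conjI allI impI)
    show "bounded_linear (\<lambda>h::real. 0::'a)" by simp
    fix e :: real assume "e > 0"
    show "\<exists>d>0. \<forall>y\<in>{a..b}. norm (y - x) < d \<longrightarrow> norm (H y - H x - 0) \<le> e * norm (y - x)"
    proof (intro exI[of _ "e / (\<bar>K\<bar> + 1)"] conjI ballI impI)
      show "e / (\<bar>K\<bar> + 1) > 0" using \<open>e > 0\<close> by simp
      fix y assume y: "y \<in> {a..b}" "norm (y - x) < e / (\<bar>K\<bar> + 1)"
      have "norm (H y - H x) \<le> K * (y - x)\<^sup>2" using sym x y by auto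
      also have "\<dots> \<le> (\<bar>K\<bar> + 1) * (y - x)\<^sup>2" by (intro mult_right_mono) auto
      also have "\<dots> = (\<bar>K\<bar> + 1) * norm (y - x) * norm (y - x)"
        by (simp add: power2_eq_square)
      also have "\<dots> \<le> e * norm (y - x)"
      proof (rule mult_right_mono)
        have "(\<bar>K\<bar> + 1) * norm (y - x) \<le> (\<bar>K\<bar> + 1) * (e / (\<bar>K\<bar> + 1))"
          using y by (intro mult_left_mono) auto
        also have "\<dots> = e" by (simp add: add_nonneg_eq_0_iff)
        finally show "(\<bar>K\<bar> + 1) * norm (y - x) \<le> e" .
      qed simp
      finally show "norm (H y - H x - 0) \<le> e * norm (y - x)" by simp
    qed
  qed
  then have "\<exists>k. \<forall>x\<in>{a..b}. H x = k"
    by (intro has_derivative_zero_constant) auto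
  with assms show ?thesis by metis
qed

lemma bounded_measurable_integrable_on:
  fixes f :: "real \<Rightarrow> complex"
  assumes "f \<in> borel_measurable (lebesgue_on {a..b})" "bounded (f ` {a..b})"
    and "a \<le> x" "y \<le> b"
  shows "f integrable_on {x..y}"
proof -
  obtain B where B: "\<And>x. x \<in> {a..b} \<Longrightarrow> norm (f x) \<le> B"
    using assms(2) unfolding bounded_iff by blast
  have "f absolutely_integrable_on {a..b}"
    by (rule measurable_bounded_by_integrable_imp_absolutely_integrable[where g = "\<lambda>_. B"])
      (use assms B in auto)
  then have "f integrable_on {a..b}" by (simp add: absolutely_integrable_on_def)
  then show ?thesis by (rule integrable_on_subinterval) (use assms in auto)
qed

lemma primitive_bound:
  assumes "is_primitive a b F f"
  obtains K where "K > 0" "\<And>x. x \<in> {a..b} \<Longrightarrow> cmod (f x) \<le> K"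
  using assms unfolding is_primitive_def bounded_pos by blast

lemma primitive_lipschitz:
  assumes "is_primitive a b F f" and K: "\<And>x. x \<in> {a..b} \<Longrightarrow> cmod (f x) \<le> K"
    and "x \<in> {a..b}" "y \<in> {a..b}"
  shows "cmod (F x - F y) \<le> K * \<bar>x - y\<bar>"
proof -
  have "0 \<le> K" using K[OF assms(3)] norm_ge_zero order_trans by blast
  have *: "cmod (F y - F x) \<le> K * (y - x)" if "a \<le> x" "x \<le> y" "y \<le> b" for x y
  proof -
    have "(f has_integral (F y - F x)) (cbox x y)" using assms(1) that by (auto simp: is_primitive_def)
    then have "norm (F y - F x) \<le> K * measure lborel (cbox x y)"
      by (rule has_integral_bound[OF \<open>0 \<le> K\<close>]) (use that K in auto)
    then show ?thesis using that by simp
  qed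
  show ?thesis
    using *[of x y] *[of y x] assms(3,4) by (cases "x \<le> y") (auto simp: norm_minus_commute)
qed

lemma primitive_continuous:
  assumes "is_primitive a b F f"
  shows "continuous_on {a..b} F"
proof -
  obtain K where K: "K > 0" "\<And>x. x \<in> {a..b} \<Longrightarrow> cmod (f x) \<le> K" by (rule primitive_bound[OF assms]) blast
  have "K-lipschitz_on {a..b} F"
    using K primitive_lipschitz[OF assms K(2)] by (intro lipschitz_onI) (auto simp: dist_norm)
  then show ?thesis by (rule lipschitz_on_continuous_on)
qed

lemma continuous_bounded_measurable:
  fixes f :: "real \<Rightarrow> complex"
  assumes "continuous_on {a..b} f"
  shows "f \<in> borel_measurable (lebesgue_on {a..b})" "bounded (f ` {a..b})"
  using assms by (auto intro!: continuous_imp_measurable_on_sets_lebesgue compact_imp_bounded compact_continuous_image)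

lemma primitiveI_quadratic:
  assumes "f \<in> borel_measurable (lebesgue_on {a..b})" "bounded (f ` {a..b})"
    and q: "\<And>x y. \<lbrakk>a \<le> x; x \<le> y; y \<le> b\<rbrakk> \<Longrightarrow> cmod (F y - F x - integral {x..y} f) \<le> K * (y - x)\<^sup>2"
  shows "is_primitive a b F f"
  unfolding is_primitive_def
proof (intro conjI allI impI)
  fix x y assume xy: "a \<le> x \<and> x \<le> y \<and> y \<le> b"
  note int = bounded_measurable_integrable_on[OF assms(1,2)]
  have "F y - integral {a..y} f = F x - integral {a..x} f"
  proof (rule constant_if_quadratic_increments[where K = K and a = a and b = b])
    fix x y assume h: "a \<le> x" "x \<le> y" "y \<le> b"
    have "integral {a..x} f + integral {x..y} f = integral {a..y} f"
      by (rule Henstock_Kurzweil_Integration.integral_combine) (use h int in auto)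
    then have "F y - integral {a..y} f - (F x - integral {a..x} f) = F y - F x - integral {x..y} f"
      by (simp add: algebra_simps)
    with q[OF h] show "norm (F y - integral {a..y} f - (F x - integral {a..x} f)) \<le> K * (y - x)\<^sup>2"
      by (simp only:)
  qed (use xy in auto)
  moreover have "integral {a..x} f + integral {x..y} f = integral {a..y} f"
    by (rule Henstock_Kurzweil_Integration.integral_combine) (use xy int in auto)
  ultimately have "integral {x..y} f = F y - F x" by algebra
  then show "(f has_integral (F y - F x)) {x..y}"
    using int[of x y] xy by (metis has_integral_integral)
qed (use assms in auto)

lemma bounded_mult_comp:
  fixes f g :: "real \<Rightarrow> complex"
  assumes "bounded (f ` S)" "bounded (g ` S)"
  shows "bounded ((\<lambda>x. f x * g x) ` S)"
proof -
  obtain A where A: "A > 0" "\<forall>x\<in>S. norm (f x) \<le> A"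
    using assms(1) by (auto simp: bounded_pos)
  obtain B where B: "B > 0" "\<forall>x\<in>S. norm (g x) \<le> B"
    using assms(2) by (auto simp: bounded_pos)
  have "norm (f x * g x) \<le> A * B" if "x \<in> S" for x
    unfolding norm_mult using that A B by (intro mult_mono) auto
  then have "\<forall>z\<in>(\<lambda>x. f x * g x) ` S. norm z \<le> A * B" by blast
  then show ?thesis unfolding bounded_iff by blast
qed

lemma primitive_mult:
  assumes F: "is_primitive a b F f" and G: "is_primitive a b G g"
  shows "is_primitive a b (\<lambda>x. F x * G x) (\<lambda>x. f x * G x + F x * g x)"
proof -
  note cF = continuous_bounded_measurable[OF primitive_continuous[OF F]]
  note cG = continuous_bounded_measurable[OF primitive_continuous[OF G]]
  have f: "f \<in> borel_measurable (lebesgue_on {a..b})" "bounded (f ` {a..b})"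
    and g: "g \<in> borel_measurable (lebesgue_on {a..b})" "bounded (g ` {a..b})"
    using F G by (auto simp: is_primitive_def)
  have 1: "(\<lambda>x. f x * G x + F x * g x) \<in> borel_measurable (lebesgue_on {a..b})"
    using f g cF cG by measurable
  have 2: "bounded ((\<lambda>x. f x * G x + F x * g x) ` {a..b})"
    by (intro bounded_plus_comp bounded_mult_comp f g cF cG)
  obtain K where K: "K > 0" "\<And>x. x \<in> {a..b} \<Longrightarrow> cmod (f x) \<le> K" by (rule primitive_bound[OF F]) blast
  obtain L where L: "L > 0" "\<And>x. x \<in> {a..b} \<Longrightarrow> cmod (g x) \<le> L" by (rule primitive_bound[OF G]) blast
  show ?thesis
  proof (rule primitiveI_quadratic[OF 1 2])
    fix x y assume xy: "a \<le> x" "x \<le> y" "y \<le> b"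
    have i: "(f has_integral (F y - F x)) {x..y}" "(g has_integral (G y - G x)) {x..y}"
      using F G xy by (auto simp: is_primitive_def)
    have "((\<lambda>s. f s * G y + F x * g s) has_integral ((F y - F x) * G y + F x * (G y - G x))) {x..y}"
      by (intro has_integral_add has_integral_mult_left has_integral_mult_right i)
    moreover have "((\<lambda>x. f x * G x + F x * g x) has_integral integral {x..y} (\<lambda>x. f x * G x + F x * g x)) {x..y}"
      using bounded_measurable_integrable_on[OF 1 2] xy by blast
    ultimately have d: "((\<lambda>s. (f s * G y + F x * g s) - (f s * G s + F s * g s)) has_integral
        ((F y - F x) * G y + F x * (G y - G x)) - integral {x..y} (\<lambda>x. f x * G x + F x * g x)) (cbox x y)"
      by (auto intro: has_integral_diff)
    have "norm (((F y - F x) * G y + F x * (G y - G x)) - integral {x..y} (\<lambda>x. f x * G x + F x * g x))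
       \<le> (2 * K * L * (y - x)) * measure lborel (cbox x y)"
    proof (rule has_integral_bound[OF _ d])
      show "0 \<le> 2 * K * L * (y - x)" using K L xy by simp
      fix s assume s: "s \<in> cbox x y"
      have "norm ((f s * G y + F x * g s) - (f s * G s + F s * g s))
          = norm (f s * (G y - G s) + (F x - F s) * g s)" by (simp add: algebra_simps)
      also have "\<dots> \<le> norm (f s) * norm (G y - G s) + norm (F x - F s) * norm (g s)"
        by (metis norm_mult norm_triangle_ineq)
      also have "\<dots> \<le> K * (L * \<bar>y - s\<bar>) + (K * \<bar>x - s\<bar>) * L"
        using s xy K L
        by (intro add_mono mult_mono primitive_lipschitz[OF F K(2)] primitive_lipschitz[OF G L(2)]) auto
      also have "\<dots> \<le> K * (L * (y - x)) + (K * (y - x)) * L"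
        using s xy K L by (intro add_mono mult_mono) auto
      finally show "norm ((f s * G y + F x * g s) - (f s * G s + F s * g s)) \<le> 2 * K * L * (y - x)"
        by (simp add: algebra_simps)
    qed
    then show "cmod (F y * G y - F x * G x - integral {x..y} (\<lambda>x. f x * G x + F x * g x)) \<le> (2 * K * L) * (y - x)\<^sup>2"
      using xy by (simp add: algebra_simps power2_eq_square)
  qed
qed

lemma primitive_deriv:
  assumes "\<And>x. x \<in> {a..b} \<Longrightarrow> (F has_vector_derivative f x) (at x within {a..b})"
    and "continuous_on {a..b} f"
  shows "is_primitive a b F f"
  unfolding is_primitive_def
proof (intro conjI allI impI)
  fix x y assume "a \<le> x \<and> x \<le> y \<and> y \<le> b"
  then show "(f has_integral (F y - F x)) {x..y}"
    by (intro fundamental_theorem_of_calculus)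
      (auto intro: has_vector_derivative_within_subset[OF assms(1)])
qed (use continuous_bounded_measurable[OF assms(2)] in auto)

lemma primitive_add:
  assumes "is_primitive a b F f" "is_primitive a b G g"
  shows "is_primitive a b (\<lambda>x. F x + G x) (\<lambda>x. f x + g x)"
  unfolding is_primitive_def
proof (intro conjI allI impI)
  fix x y assume "a \<le> x \<and> x \<le> y \<and> y \<le> b"
  then have "((\<lambda>x. f x + g x) has_integral (F y - F x) + (G y - G x)) {x..y}"
    using assms by (intro has_integral_add) (auto simp: is_primitive_def)
  then show "((\<lambda>x. f x + g x) has_integral (F y + G y - (F x + G x))) {x..y}"
    by (simp add: algebra_simps)
qed (use assms in \<open>auto simp: is_primitive_def intro: bounded_plus_comp\<close>)

lemma primitive_const: "is_primitive a b (\<lambda>x. c) (\<lambda>x. 0)"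
  by (simp add: is_primitive_def image_constant_conv)

lemma primitive_cmult:
  assumes "is_primitive a b F f"
  shows "is_primitive a b (\<lambda>x. c * F x) (\<lambda>x. c * f x)"
  using primitive_mult[OF primitive_const[of a b c] assms] by simp

lemma primitive_sum:
  assumes "finite I" "\<And>i. i \<in> I \<Longrightarrow> is_primitive a b (F i) (f i)"
  shows "is_primitive a b (\<lambda>x. \<Sum>i\<in>I. F i x) (\<lambda>x. \<Sum>i\<in>I. f i x)"
  using assms by (induction I rule: finite_induct) (auto intro: primitive_add primitive_const)

lemma primitive_cong:
  assumes "is_primitive a b F f" "\<And>x. x \<in> {a..b} \<Longrightarrow> F x = F' x" "\<And>x. x \<in> {a..b} \<Longrightarrow> f x = f' x"
  shows "is_primitive a b F' f'"
proof -
  have "f \<in> borel_measurable (lebesgue_on {a..b}) \<longleftrightarrow> f' \<in> borel_measurable (lebesgue_on {a..b})"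
    by (rule measurable_cong) (use assms in auto)
  moreover have "(f has_integral (F y - F x)) {x..y} \<longleftrightarrow> (f' has_integral (F' y - F' x)) {x..y}"
    if "a \<le> x \<and> x \<le> y \<and> y \<le> b" for x y
  proof -
    have "F' x = F x" "F' y = F y" using that assms(2) by auto
    moreover have "(f has_integral (F y - F x)) {x..y} \<longleftrightarrow> (f' has_integral (F y - F x)) {x..y}"
      by (rule has_integral_cong) (use that assms(3) in auto)
    ultimately show ?thesis by simp
  qed
  moreover have "f ` {a..b} = f' ` {a..b}" using assms(3) by (intro image_cong) auto
  ultimately show ?thesis using assms(1) unfolding is_primitive_def by simp
qed

lemma primitive_exp:
  assumes F: "is_primitive a b F f"
  shows "is_primitive a b (\<lambda>x. exp (F x)) (\<lambda>x. f x * exp (F x))"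
proof -
  have c: "continuous_on {a..b} (\<lambda>x. exp (F x))"
    by (intro continuous_intros primitive_continuous[OF F])
  note cE = continuous_bounded_measurable[OF c]
  have f: "f \<in> borel_measurable (lebesgue_on {a..b})" "bounded (f ` {a..b})"
    using F by (auto simp: is_primitive_def)
  have 1: "(\<lambda>x. f x * exp (F x)) \<in> borel_measurable (lebesgue_on {a..b})"
    using f cE by measurable
  have 2: "bounded ((\<lambda>x. f x * exp (F x)) ` {a..b})"
    by (intro bounded_mult_comp f cE)
  obtain K where K: "K > 0" "\<And>x. x \<in> {a..b} \<Longrightarrow> cmod (f x) \<le> K" by (rule primitive_bound[OF F]) blast
  have "bounded (F ` {a..b})" using continuous_bounded_measurable[OF primitive_continuous[OF F]] by simp
  then obtain R where R: "\<And>x. x \<in> {a..b} \<Longrightarrow> cmod (F x) \<le> R"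
    unfolding bounded_iff by blast
  show ?thesis
  proof (cases "a \<le> b")
    case False then show ?thesis using 1 2 by (auto simp: is_primitive_def)
  next
    case True
    have "R \<ge> 0" using R[of a] True by (auto intro: order_trans[OF norm_ge_zero])
    \<comment> \<open>on the ball of radius \<open>R\<close>, exp is Lipschitz, so that its first-order Taylor remainder is quadratically small\<close>
    have lip: "cmod (exp z - exp w) \<le> exp R * cmod (z - w)" if "cmod z \<le> R" "cmod w \<le> R" for z w
    proof (rule field_differentiable_bound[where S = "cball 0 R"])
      fix z :: complex assume "z \<in> cball 0 R"
      show "(exp has_field_derivative exp z) (at z within cball 0 R)"
        by (rule DERIV_subset[OF DERIV_exp]) simp
      show "cmod (exp z) \<le> exp R" using \<open>z \<in> cball 0 R\<close> norm_exp[of z]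
        by (auto intro: order_trans)
    qed (use that in auto)
    have quad: "cmod (exp z - exp w - exp w * (z - w)) \<le> exp R * cmod (z - w) ^ 2"
      if "cmod z \<le> R" "cmod w \<le> R" for z w
    proof -
      have "cmod ((exp z - exp w * z) - (exp w - exp w * w)) \<le> (exp R * cmod (z - w)) * cmod (z - w)"
      proof (rule field_differentiable_bound[where S = "closed_segment w z"])
        fix v :: complex assume v: "v \<in> closed_segment w z"
        show "((\<lambda>z. exp z - exp w * z) has_field_derivative (exp v - exp w)) (at v within closed_segment w z)"
          by (auto intro!: derivative_eq_intros)
        have "cmod v \<le> R"
          using v that closed_segment_subset[of w "cball (0::complex) R" z] by auto
        then have "cmod (exp v - exp w) \<le> exp R * cmod (v - w)" using lip that by blast
        also have "\<dots> \<le> exp R * cmod (z - w)"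
          using v segment_bound1[of v w z] by (simp add: norm_minus_commute)
        finally show "cmod (exp v - exp w) \<le> exp R * cmod (z - w)" .
      qed auto
      then show ?thesis by (simp add: algebra_simps power2_eq_square)
    qed
    show ?thesis
    proof (rule primitiveI_quadratic[OF 1 2])
      fix x y assume xy: "a \<le> x" "x \<le> y" "y \<le> b"
      have i: "(f has_integral (F y - F x)) {x..y}"
        using F xy by (auto simp: is_primitive_def)
      have "((\<lambda>s. f s * exp (F x)) has_integral ((F y - F x) * exp (F x))) {x..y}"
        by (intro has_integral_mult_left i)
      moreover have "((\<lambda>x. f x * exp (F x)) has_integral integral {x..y} (\<lambda>x. f x * exp (F x))) {x..y}"
        using bounded_measurable_integrable_on[OF 1 2] xy by blast
      ultimately have d: "((\<lambda>s. f s * exp (F x) - f s * exp (F s)) has_integral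
          ((F y - F x) * exp (F x) - integral {x..y} (\<lambda>x. f x * exp (F x)))) (cbox x y)"
        by (auto intro: has_integral_diff)
      have e1: "norm ((F y - F x) * exp (F x) - integral {x..y} (\<lambda>x. f x * exp (F x)))
         \<le> (K * (exp R * (K * (y - x)))) * measure lborel (cbox x y)"
      proof (rule has_integral_bound[OF _ d])
        show "0 \<le> K * (exp R * (K * (y - x)))" using K xy by simp
        fix s assume s: "s \<in> cbox x y"
        have "norm (f s * exp (F x) - f s * exp (F s)) = norm (f s) * norm (exp (F x) - exp (F s))"
          by (metis norm_mult right_diff_distrib)
        also have "\<dots> \<le> K * (exp R * cmod (F x - F s))"
          using s xy K by (intro mult_mono lip R) auto
        also have "\<dots> \<le> K * (exp R * (K * \<bar>x - s\<bar>))"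
          using s xy K by (intro mult_left_mono primitive_lipschitz[OF F K(2)]) auto
        also have "\<dots> \<le> K * (exp R * (K * (y - x)))"
          using s xy K by (intro mult_left_mono) auto
        finally show "norm (f s * exp (F x) - f s * exp (F s)) \<le> K * (exp R * (K * (y - x)))" .
      qed
      have "cmod (exp (F y) - exp (F x) - exp (F x) * (F y - F x)) \<le> exp R * cmod (F y - F x) ^ 2"
        using xy by (intro quad R) auto
      also have "\<dots> \<le> exp R * (K * \<bar>y - x\<bar>) ^ 2"
        using xy K by (intro mult_left_mono power_mono primitive_lipschitz[OF F K(2)]) auto
      finally have e2: "cmod (exp (F y) - exp (F x) - exp (F x) * (F y - F x)) \<le> exp R * (K * \<bar>y - x\<bar>) ^ 2" .
      have "cmod (exp (F y) - exp (F x) - integral {x..y} (\<lambda>x. f x * exp (F x)))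
        \<le> cmod (exp (F y) - exp (F x) - exp (F x) * (F y - F x))
          + cmod ((F y - F x) * exp (F x) - integral {x..y} (\<lambda>x. f x * exp (F x)))"
        using norm_triangle_ineq[of "exp (F y) - exp (F x) - exp (F x) * (F y - F x)"
          "(F y - F x) * exp (F x) - integral {x..y} (\<lambda>x. f x * exp (F x))"]
        by (simp add: algebra_simps)
      also have "\<dots> \<le> (2 * exp R * K\<^sup>2) * (y - x)\<^sup>2"
        using e1 e2 xy by (simp add: algebra_simps power2_eq_square)
      finally show "cmod (exp (F y) - exp (F x) - integral {x..y} (\<lambda>x. f x * exp (F x)))
         \<le> (2 * exp R * K\<^sup>2) * (y - x)\<^sup>2" .
    qed
  qed
qed

text \<open>Change of variables \<open>y \<mapsto> t + y / T\<close>.\<close>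

lemma primitive_affine:
  assumes F: "is_primitive a b F f" and T: "T > 0" and "a \<le> t + a' / T" "t + b' / T \<le> b"
  shows "is_primitive a' b' (\<lambda>y. F (t + y / T)) (\<lambda>y. f (t + y / T) / T)"
  unfolding is_primitive_def
proof (intro conjI allI impI)
  have f: "f \<in> borel_measurable (lebesgue_on {a..b})" "bounded (f ` {a..b})"
    using F by (auto simp: is_primitive_def)
  have mem: "t + y / T \<in> {a..b}" if "y \<in> {a'..b'}" for y
  proof -
    have "a' / T \<le> y / T" "y / T \<le> b' / T" using that T by (auto simp: divide_right_mono)
    then show ?thesis using assms(3,4) by auto
  qed
  then have im: "(\<lambda>y. t + y / T) ` {a'..b'} \<subseteq> {a..b}" by blast
  have "bounded ((\<lambda>y. z y * (1 / complex_of_real T)) ` S)" if "bounded (z ` S)" for z :: "real \<Rightarrow> complex" and S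
    by (intro bounded_mult_comp that finite_imp_bounded) (simp add: image_constant_conv)
  from this[of "\<lambda>y. f (t + y / T)" "{a'..b'}"] show "bounded ((\<lambda>y. f (t + y / T) / T) ` {a'..b'})"
    using bounded_subset[OF f(2), of "(\<lambda>y. f (t + y / T)) ` {a'..b'}"] im by (auto simp: image_subset_iff)
  fix x y assume xy: "a' \<le> x \<and> x \<le> y \<and> y \<le> b'"
  have "(f has_integral (F (t + y/T) - F (t + x/T))) (cbox (t + x/T) (t + y/T))"
    using F xy T mem[of x] mem[of y] by (auto simp: is_primitive_def divide_right_mono)
  from has_integral_affinity[OF this, of "1/T" t]
  have "((\<lambda>s. f (s / T + t)) has_integral T *\<^sub>R (F (t + y/T) - F (t + x/T))) ((\<lambda>s. T * s + - (T * t)) ` {t + x/T..t + y/T})"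
    using T by (simp add: o_def)
  moreover have "(\<lambda>s. T * s + - (T * t)) ` {t + x/T..t + y/T} = {x..y}"
  proof -
    have "t + x / T \<le> t + y / T" using T xy by (simp add: divide_right_mono)
    then have "(\<lambda>s. T * s + - (T * t)) ` {t + x/T..t + y/T} = {T * (t + x/T) + - (T * t)..T * (t + y/T) + - (T * t)}"
      using T by (subst image_affinity_atLeastAtMost) auto
    also have "\<dots> = {x..y}" using T by (simp add: distrib_left)
    finally show ?thesis .
  qed
  ultimately have "((\<lambda>s. f (t + s / T)) has_integral T *\<^sub>R (F (t + y/T) - F (t + x/T))) {x..y}"
    by (simp add: add.commute)
  from has_integral_mult_left[OF this, of "1 / complex_of_real T"]
  show "((\<lambda>y. f (t + y / T) / T) has_integral (F (t + y/T) - F (t + x/T))) {x..y}"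
    using T by (simp add: scaleR_conv_of_real)
next
  let ?f = "\<lambda>x. if x \<in> {a..b} then f x else 0"
  have "?f \<in> borel_measurable lebesgue"
    using F by (intro borel_measurable_if_I) (auto simp: is_primitive_def)
  from measurable_compose[OF lebesgue_affine_measurable[where c = "\<lambda>_. 1 / T" and t = t] this]
  have "(\<lambda>y. ?f (t + y / T)) \<in> borel_measurable lebesgue"
    using T by (simp add: cong: if_cong)
  then have "(\<lambda>y. ?f (t + y / T)) \<in> borel_measurable (lebesgue_on {a'..b'})"
    by (rule measurable_restrict_space1)
  moreover have "(\<lambda>y. ?f (t + y / T)) \<in> borel_measurable (lebesgue_on {a'..b'}) \<longleftrightarrow>
      (\<lambda>y. f (t + y / T)) \<in> borel_measurable (lebesgue_on {a'..b'})"
  proof (rule measurable_cong)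
    fix y assume "y \<in> space (lebesgue_on {a'..b'})"
    then have "t + y / T \<in> {a..b}"
      using T assms(3,4) divide_right_mono[of a' y T] divide_right_mono[of y b' T] by auto
    then show "?f (t + y / T) = f (t + y / T)" by simp
  qed
  ultimately show "(\<lambda>y. f (t + y / T) / T) \<in> borel_measurable (lebesgue_on {a'..b'})"
    by simp
qed

lemma primitive_subset:
  assumes F: "is_primitive a b F f" and "a \<le> a'" "b' \<le> b"
  shows "is_primitive a' b' F f"
  using primitive_affine[OF F, of 1 0 a' b'] assms by simp

lemma primitive_glue:
  assumes F: "is_primitive a b F f" and G: "is_primitive b c G g" and eq: "F b = G b" and "a \<le> b" "b \<le> c"
  shows "is_primitive a c (\<lambda>x. if x \<le> b then F x else G x) (\<lambda>x. if x \<le> b then f x else g x)"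
    (is "is_primitive a c ?H ?h")
proof -
  have lo: "(?h has_integral (?H y - ?H x)) {x..y}" if "a \<le> x" "x \<le> y" "y \<le> b" for x y
  proof -
    have "(f has_integral (F y - F x)) {x..y}" using F that by (auto simp: is_primitive_def)
    then have "(?h has_integral (F y - F x)) {x..y}"
      by (rule has_integral_eq[rotated]) (use that in auto)
    then show ?thesis using that by simp
  qed
  have hi: "(?h has_integral (?H y - ?H x)) {x..y}" if "b \<le> x" "x \<le> y" "y \<le> c" for x y
  proof -
    have "(g has_integral (G y - G x)) {x..y}" using G that by (auto simp: is_primitive_def)
    then have "(?h has_integral (G y - G x)) {x..y}"
      by (rule has_integral_spike_finite[rotated 2, where S = "{b}"]) (use that in auto)
    moreover have at: "(if z \<le> b then F z else G z) = G z" if "b \<le> z" for z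
      using that eq by (cases "z = b") auto
    have "?H x = G x" "?H y = G y" by (rule at, use that in simp)+
    ultimately show ?thesis by simp
  qed
  have both: "(?h has_integral (?H y - ?H x)) {x..y}" if "a \<le> x \<and> x \<le> y \<and> y \<le> c" for x y
  proof -
    consider "y \<le> b" | "b \<le> x" | "x \<le> b" "b \<le> y" by linarith
    then show ?thesis
    proof cases
      case 3
      have "(?h has_integral ((?H b - ?H x) + (?H y - ?H b))) {x..y}"
        by (rule has_integral_combine[OF 3]) (use lo[of x b] hi[of b y] 3 that in auto)
      then show ?thesis by (simp add: algebra_simps)
    qed (use lo hi that in blast)+
  qed
  obtain A where A: "A > 0" "\<And>x. x \<in> {a..b} \<Longrightarrow> cmod (f x) \<le> A" by (rule primitive_bound[OF F]) blast
  obtain B where B: "B > 0" "\<And>x. x \<in> {b..c} \<Longrightarrow> cmod (g x) \<le> B" by (rule primitive_bound[OF G]) blast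
  have "cmod (?h x) \<le> A + B" if "x \<in> {a..c}" for x
    using A(2)[of x] B(2)[of x] A(1) B(1) that by (cases "x \<le> b") auto
  then have bd: "bounded (?h ` {a..c})" unfolding bounded_iff by blast
  have m: "(\<lambda>x. if x \<in> {a..b} then f x else 0) \<in> borel_measurable lebesgue"
    "(\<lambda>x. if x \<in> {b..c} then g x else 0) \<in> borel_measurable lebesgue"
    using F G by (auto intro!: borel_measurable_if_I simp: is_primitive_def simp del: atLeastAtMost_iff)
  have "(\<lambda>x. if x \<le> b then (if x \<in> {a..b} then f x else 0) else (if x \<in> {b..c} then g x else 0))
      \<in> borel_measurable lebesgue"
    by (rule measurable_If[OF m]) simp
  then have "(\<lambda>x. if x \<le> b then (if x \<in> {a..b} then f x else 0) else (if x \<in> {b..c} then g x else 0))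
      \<in> borel_measurable (lebesgue_on {a..c})"
    by (rule measurable_restrict_space1)
  also have "?this \<longleftrightarrow> ?h \<in> borel_measurable (lebesgue_on {a..c})"
    by (rule measurable_cong) auto
  finally show ?thesis using bd both unfolding is_primitive_def by blast
qed

section \<open>Weak* limits of bounded families\<close>

text \<open>The induction principle that expresses the density of step functions in \<open>L\<^sup>1\<close>: a property that
  holds for indicators of intervals and is closed under linear combinations and \<open>L\<^sup>1\<close>-limits holds for
  all integrable functions. From intervals it passes to Borel sets by a Dynkin argument.\<close>

lemma integrable_I01_interval_induct [consumes 1, case_names interval add cmult lim]:
  fixes g :: "real \<Rightarrow> complex"
  assumes g: "integrable I01 g"
    and interval: "\<And>a b. \<lbrakk>0 \<le> a; a \<le> b; b \<le> 1\<rbrakk> \<Longrightarrow> P (indicator {a..b})"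
    and add: "\<And>f g. \<lbrakk>integrable I01 f; P f; integrable I01 g; P g\<rbrakk> \<Longrightarrow> P (\<lambda>x. f x + g x)"
    and cmult: "\<And>f c. \<lbrakk>integrable I01 f; P f\<rbrakk> \<Longrightarrow> P (\<lambda>x. c * f x)"
    and lim: "\<And>f. \<lbrakk>integrable I01 f;
        \<And>e. e > 0 \<Longrightarrow> \<exists>h. integrable I01 h \<and> P h \<and> (LINT x|I01. cmod (f x - h x)) < e\<rbrakk> \<Longrightarrow> P f"
  shows "P g"
proof -
  interpret finite_measure I01 by (rule finite_measure_lebesgue_on) simp
  have cong: "P f" if "integrable I01 f" "integrable I01 h" "P h" "AE x in I01. f x = h x" for f h
  proof (rule lim[OF that(1)])
    fix e :: real assume "e > 0"
    have "(LINT x|I01. cmod (f x - h x)) = (LINT x|I01. 0)"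
      by (rule integral_cong_AE) (use that in auto)
    then show "\<exists>h. integrable I01 h \<and> P h \<and> (LINT x|I01. cmod (f x - h x)) < e"
      using that \<open>e > 0\<close> by auto
  qed
  have seq: "P f" if s: "\<And>i. integrable I01 (s i)" "\<And>i. P (s i)"
    and f: "integrable I01 f" and w: "integrable I01 w"
    and l: "\<And>x. x \<in> {0..1} \<Longrightarrow> (\<lambda>i. s i x) \<longlonglongrightarrow> f x"
    and b: "\<And>i x. x \<in> {0..1} \<Longrightarrow> cmod (s i x) \<le> w x" for s f and w :: "real \<Rightarrow> real"
  proof (rule lim[OF f])
    fix e :: real assume "e > 0"
    have "(\<lambda>i. LINT x|I01. cmod (f x - s i x)) \<longlonglongrightarrow> (LINT x|I01. (0::real))"
    proof (rule integral_dominated_convergence[where w = "\<lambda>x. cmod (f x) + w x"])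
      show "AE x in I01. (\<lambda>i. cmod (f x - s i x)) \<longlonglongrightarrow> 0"
      proof (rule AE_I2)
        fix x assume "x \<in> space I01"
        then have "(\<lambda>i. f x - s i x) \<longlonglongrightarrow> f x - f x" by (intro tendsto_intros l) auto
        then show "(\<lambda>i. cmod (f x - s i x)) \<longlonglongrightarrow> 0" by (simp add: tendsto_norm_zero)
      qed
      show "AE x in I01. norm (cmod (f x - s i x)) \<le> cmod (f x) + w x" for i
      proof (rule AE_I2)
        fix x assume "x \<in> space I01"
        then show "norm (cmod (f x - s i x)) \<le> cmod (f x) + w x"
          using norm_triangle_ineq4[of "f x" "s i x"] b[of x i] by auto
      qed
    qed (use f s w in auto)
    then have "\<forall>\<^sub>F i in sequentially. (LINT x|I01. cmod (f x - s i x)) < e"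
      using \<open>e > 0\<close> by (auto dest: order_tendstoD)
    then obtain i where "(LINT x|I01. cmod (f x - s i x)) < e"
      by (auto simp: eventually_sequentially)
    then show "\<exists>h. integrable I01 h \<and> P h \<and> (LINT x|I01. cmod (f x - h x)) < e"
      using s by blast
  qed
  have ind_int: "integrable I01 (indicator A :: real \<Rightarrow> complex)" if "A \<in> sets lebesgue" for A
    by (rule integrable_const_bound[where B = 1, OF _ measurable_restrict_space1[OF borel_measurable_indicator[OF that]]])
      (simp add: indicator_def)
  have zero: "P (\<lambda>x. 0)"
    using cmult[OF ind_int interval[of 0 0], of 0] by simp
  have borel: "P (indicator A)" if "A \<in> sets borel" for A :: "real set"
  proof -
    have "Int_stable (range (atMost :: real \<Rightarrow> real set))"
      by (auto simp: Int_stable_def)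
    moreover have "range (atMost :: real \<Rightarrow> real set) \<subseteq> Pow UNIV" by auto
    moreover have "A \<in> sigma_sets UNIV (range atMost)"
      using that by (simp add: borel_eq_atMost)
    ultimately have "A \<in> sets borel \<and> P (indicator A)"
    proof (induction A rule: sigma_sets_induct_disjoint)
      case (basic A)
      then obtain a where A: "A = {..a}" by auto
      have "P (indicator A)"
      proof (cases "a < 0")
        case True
        show ?thesis by (rule cong[OF ind_int _ zero]) (use True A in \<open>auto simp: AE_restrict_space_iff indicator_def\<close>)
      next
        case False
        have 1: "P (indicator {0..min a 1})" by (rule interval) (use False in auto)
        show ?thesis by (rule cong[OF ind_int ind_int 1]) (use False A in \<open>auto simp: AE_restrict_space_iff indicator_def\<close>)
      qed
      then show ?case using A by simp
    next
      case empty
      show ?case using zero by (simp add: indicator_def[abs_def])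
    next
      case (compl A)
      have A: "A \<in> sets lebesgue" using compl by auto
      have 1: "P (\<lambda>x. indicator {0..1} x + (-1) * indicator A x)"
        by (rule add[OF ind_int interval _ cmult]) (use A compl ind_int in auto)
      have UA: "UNIV - A \<in> sets lebesgue" using sets.compl_sets[OF A] by simp
      have i: "integrable I01 (\<lambda>x. indicator {0..1} x + (-1) * indicator A x :: complex)"
        by (intro Bochner_Integration.integrable_add integrable_mult_right ind_int A) simp
      have "P (indicator (UNIV - A))"
        by (rule cong[OF ind_int[OF UA] i 1]) (simp add: AE_restrict_space_iff indicator_def)
      then show ?case using compl by auto
    next
      case (union A)
      note union = union.hyps(1) union.hyps(2) union.IH
      have A: "A i \<in> sets lebesgue" for i using union by auto
      have part: "integrable I01 (\<lambda>x. \<Sum>i<n. indicator (A i) x :: complex) \<and> P (\<lambda>x. \<Sum>i<n. indicator (A i) x)" for n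
        using union(3) by (induction n) (auto intro!: add zero ind_int A integrable_sum)
      have "P (indicator (\<Union>i. A i))"
      proof (rule seq[where s = "\<lambda>n x. \<Sum>i<n. indicator (A i) x" and w = "\<lambda>_. 1"])
        have sums: "(\<lambda>i. indicator (A i) x :: real) sums indicator (\<Union>i. A i) x" for x
          using union(1) by (intro indicator_sums) (auto simp: disjoint_family_on_def)
        show "(\<lambda>n. \<Sum>i<n. indicator (A i) x :: complex) \<longlonglongrightarrow> indicator (\<Union>i. A i) x" for x
          using tendsto_of_real[OF sums[of x, unfolded sums_def], where 'a = complex]
          by (simp add: of_real_indicator)
        show "cmod (\<Sum>i<n. indicator (A i) x) \<le> 1" for n x
        proof -
          have "(\<Sum>i<n. indicator (A i) x :: real) \<le> (\<Sum>i. indicator (A i) x)"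
            using sums[of x] by (intro sum_le_suminf) (auto simp: sums_iff)
          also have "\<dots> \<le> 1" using sums[of x] by (simp add: sums_iff indicator_def)
          finally have "(\<Sum>i<n. indicator (A i) x :: real) \<le> 1" .
          moreover have "(\<Sum>i<n. indicator (A i) x :: complex) = of_real (\<Sum>i<n. indicator (A i) x)"
            by (simp add: of_real_indicator)
          moreover have "0 \<le> (\<Sum>i<n. indicator (A i) x :: real)" by (simp add: sum_nonneg)
          ultimately show ?thesis by (simp only: norm_of_real abs_of_nonneg)
        qed
      qed (use part A ind_int in auto)
      then show ?case using union by auto
    qed
    then show ?thesis by simp
  qed
  have leb: "P (indicator A)" if A: "A \<in> sets lebesgue" for A :: "real set"
  proof -
    obtain S N N' where *: "A = S \<union> N" "N \<subseteq> N'" "N' \<in> null_sets lborel" "S \<in> sets lborel"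
      using A by (auto elim!: sets_completionE)
    have "AE x in lebesgue. x \<notin> N'" using * by (intro AE_not_in null_sets_completionI)
    then have "AE x in I01. x \<notin> N'" by (auto simp: AE_restrict_space_iff)
    then have ae: "AE x in I01. indicator A x = (indicator S x :: complex)"
      by eventually_elim (use * in \<open>auto simp: indicator_def\<close>)
    show ?thesis
      by (rule cong[OF ind_int ind_int borel ae]) (use * A in auto)
  qed
  show ?thesis using g
  proof (induction rule: integrable_induct)
    case (base A c)
    have A: "A \<in> sets lebesgue" using base by (auto simp: sets_restrict_space_iff)
    have "P (\<lambda>x. c * indicator A x)" by (rule cmult[OF ind_int[OF A] leb[OF A]])
    then show ?case by (rule back_subst[of P]) (auto simp: indicator_def)
  next
    case (add f g)
    show ?case by (rule assms(3)) (use add in simp_all)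
  next
    case (lim f s)
    show ?case by (rule seq[where s = s and w = "\<lambda>x. 2 * cmod (f x)"]) (use lim in auto)
  qed
qed

lemma integrable_mult_bounded_I01:
  fixes f g :: "real \<Rightarrow> complex"
  assumes "f \<in> borel_measurable I01" "AE x in I01. cmod (f x) \<le> K" "integrable I01 g"
  shows "integrable I01 (\<lambda>x. f x * g x)"
proof (rule Bochner_Integration.integrable_bound[where f = "\<lambda>x. complex_of_real K * g x"])
  show "AE x in I01. norm (f x * g x) \<le> norm (complex_of_real K * g x)"
    using assms(2)
  proof eventually_elim
    case (elim x)
    then have "cmod (f x) \<le> \<bar>K\<bar>" by linarith
    then show ?case by (simp add: norm_mult mult_right_mono)
  qed
qed (use assms in auto)

lemma norm_integral_mult_bounded_I01:
  fixes f g :: "real \<Rightarrow> complex"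
  assumes "f \<in> borel_measurable I01" "AE x in I01. cmod (f x) \<le> K" "integrable I01 g"
  shows "cmod (LINT x|I01. f x * g x) \<le> K * (LINT x|I01. cmod (g x))"
proof -
  have "cmod (LINT x|I01. f x * g x) \<le> (LINT x|I01. cmod (f x * g x))" by (rule integral_norm_bound)
  also have "\<dots> \<le> (LINT x|I01. K * cmod (g x))"
  proof (rule integral_mono_AE)
    show "AE x in I01. cmod (f x * g x) \<le> K * cmod (g x)"
      using assms(2) by eventually_elim (simp add: norm_mult mult_right_mono)
  qed (use assms integrable_mult_bounded_I01 in auto)
  finally show ?thesis by simp
qed

text \<open>The density of step functions in \<open>L\<^sup>1\<close>, in the form in which it serves weak* convergence:
  a bounded family converges weakly* to \<open>0\<close> as soon as its integrals over intervals do.\<close>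

lemma tendsto_pairing_if_intervals:
  fixes \<psi> :: "'i \<Rightarrow> real \<Rightarrow> complex"
  assumes bd: "\<forall>\<^sub>F i in F. \<psi> i \<in> borel_measurable I01 \<and> (AE x in I01. cmod (\<psi> i x) \<le> K)"
    and int: "\<And>a b. \<lbrakk>0 \<le> a; a \<le> b; b \<le> 1\<rbrakk> \<Longrightarrow>
      ((\<lambda>i. LINT x|I01. \<psi> i x * indicator {a..b} x) \<longlongrightarrow> 0) F"
    and g: "integrable I01 g"
  shows "((\<lambda>i. LINT x|I01. \<psi> i x * g x) \<longlongrightarrow> 0) F"
  using g
proof (induction rule: integrable_I01_interval_induct)
  case (interval a b)
  then show ?case by (rule int)
next
  case (add f g)
  have "\<forall>\<^sub>F i in F. (LINT x|I01. \<psi> i x * f x) + (LINT x|I01. \<psi> i x * g x) = (LINT x|I01. \<psi> i x * (f x + g x))"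
    using bd
  proof eventually_elim
    case (elim i)
    then have "integrable I01 (\<lambda>x. \<psi> i x * f x)" "integrable I01 (\<lambda>x. \<psi> i x * g x)"
      using add integrable_mult_bounded_I01 by blast+
    then show ?case by (simp add: distrib_left)
  qed
  then show ?case using tendsto_add[OF add.IH] by (auto elim: Lim_transform_eventually[rotated])
next
  case (cmult f c)
  have "(LINT x|I01. \<psi> i x * (c * f x)) = c * (LINT x|I01. \<psi> i x * f x)" for i
    by (simp add: mult.left_commute)
  then show ?case using tendsto_mult_right_zero[OF cmult.IH] by simp
next
  case (lim f)
  show ?case
  proof (rule tendstoI)
    fix e :: real assume "e > 0"
    have K1: "\<bar>K\<bar> + 1 > 0" by simp
    with \<open>e > 0\<close> have "e / 2 / (\<bar>K\<bar> + 1) > 0" by simp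
    then obtain h where h: "integrable I01 h" "((\<lambda>i. LINT x|I01. \<psi> i x * h x) \<longlongrightarrow> 0) F"
      "(LINT x|I01. cmod (f x - h x)) < e / 2 / (\<bar>K\<bar> + 1)"
      using lim.IH by blast
    have "\<forall>\<^sub>F i in F. dist (LINT x|I01. \<psi> i x * h x) 0 < e / 2"
      using h(2) \<open>e > 0\<close> by (intro tendstoD) auto
    then show "\<forall>\<^sub>F i in F. dist (LINT x|I01. \<psi> i x * f x) 0 < e"
      using bd
    proof eventually_elim
      case (elim i)
      have i: "integrable I01 (\<lambda>x. \<psi> i x * f x)" "integrable I01 (\<lambda>x. \<psi> i x * h x)"
        using elim h lim(1) integrable_mult_bounded_I01 by blast+
      then have "(LINT x|I01. \<psi> i x * f x) = (LINT x|I01. \<psi> i x * h x) + (LINT x|I01. \<psi> i x * (f x - h x))"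
        by (simp add: right_diff_distrib)
      moreover have "cmod (LINT x|I01. \<psi> i x * (f x - h x)) \<le> K * (LINT x|I01. cmod (f x - h x))"
        using elim h lim(1) by (intro norm_integral_mult_bounded_I01) auto
      moreover have "K * (LINT x|I01. cmod (f x - h x)) \<le> (\<bar>K\<bar> + 1) * (LINT x|I01. cmod (f x - h x))"
        by (intro mult_right_mono) auto
      moreover have "(\<bar>K\<bar> + 1) * (LINT x|I01. cmod (f x - h x)) < e / 2"
        using h(3) K1 by (simp add: field_simps)
      ultimately show ?case
        using elim(1) norm_triangle_ineq[of "LINT x|I01. \<psi> i x * h x" "LINT x|I01. \<psi> i x * (f x - h x)"]
        by simp
    qed
  qed
qed

text \<open>The filter is arbitrary, so that the lemma also covers convergence uniformly in time
  (through product filters).\<close>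

lemma weak_star_eventually_mem:
  assumes "openin weak_star U" "d \<in> U" and X: "\<forall>\<^sub>F i in F. \<phi> i \<in> X_space"
    and lim: "\<And>g. integrable I01 g \<Longrightarrow> ((\<lambda>i. pairing (\<phi> i) g) \<longlongrightarrow> pairing d g) F"
  shows "\<forall>\<^sub>F i in F. \<phi> i \<in> U"
proof -
  have "generate_topology_on {{f \<in> X_space. pairing f g \<in> U} | g U. integrable I01 g \<and> open U} U"
    using assms(1) unfolding weak_star_def openin_topology_generated_by_iff .
  then show ?thesis using \<open>d \<in> U\<close>
  proof induction
    case (Int a b)
    then show ?case by (auto intro: eventually_conj)
  next
    case (UN K)
    then obtain k where "k \<in> K" "d \<in> k" by auto
    then have "\<forall>\<^sub>F i in F. \<phi> i \<in> k" using UN by blast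
    then show ?case by eventually_elim (use \<open>k \<in> K\<close> in auto)
  next
    case (Basis s)
    then obtain g V where s: "s = {f \<in> X_space. pairing f g \<in> V}" "integrable I01 g" "open V" by auto
    then have "\<forall>\<^sub>F i in F. pairing (\<phi> i) g \<in> V"
      using Basis lim[of g] by (intro topological_tendstoD) auto
    then show ?case using X by eventually_elim (use s in auto)
  qed auto
qed

lemma topspace_weak_star: "topspace weak_star = X_space"
proof -
  have "X_space = {f \<in> X_space. pairing f (\<lambda>_. 0) \<in> UNIV}" by simp
  then have "X_space \<in> {{f \<in> X_space. pairing f g \<in> U} | g U. integrable I01 g \<and> open U}"
    by (intro CollectI exI[of _ "\<lambda>_. 0"] exI[of _ UNIV]) auto
  then show ?thesis unfolding weak_star_def topology_generated_by_topspace by blast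
qed

lemma openin_weak_star_basis:
  assumes "integrable I01 g" "open V"
  shows "openin weak_star {f \<in> X_space. pairing f g \<in> V}"
  unfolding weak_star_def by (rule topology_generated_by_Basis) (use assms in auto)

lemma limitin_weak_star_iff:
  assumes "\<forall>\<^sub>F i in F. \<phi> i \<in> X_space"
  shows "limitin weak_star \<phi> d F \<longleftrightarrow>
    d \<in> X_space \<and> (\<forall>g. integrable I01 g \<longrightarrow> ((\<lambda>i. pairing (\<phi> i) g) \<longlongrightarrow> pairing d g) F)"
proof
  assume L: "limitin weak_star \<phi> d F"
  then have d: "d \<in> X_space" by (simp add: limitin_def topspace_weak_star)
  have "((\<lambda>i. pairing (\<phi> i) g) \<longlongrightarrow> pairing d g) F" if g: "integrable I01 g" for g
  proof (rule topological_tendstoI)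
    fix V assume V: "open V" "pairing d g \<in> V"
    have "\<forall>\<^sub>F i in F. \<phi> i \<in> {f \<in> X_space. pairing f g \<in> V}"
      using L openin_weak_star_basis[OF g V(1)] d V(2) by (auto simp: limitin_def)
    then show "\<forall>\<^sub>F i in F. pairing (\<phi> i) g \<in> V" by eventually_elim simp
  qed
  with d show "d \<in> X_space \<and> (\<forall>g. integrable I01 g \<longrightarrow> ((\<lambda>i. pairing (\<phi> i) g) \<longlongrightarrow> pairing d g) F)" by simp
next
  assume "d \<in> X_space \<and> (\<forall>g. integrable I01 g \<longrightarrow> ((\<lambda>i. pairing (\<phi> i) g) \<longlongrightarrow> pairing d g) F)"
  then show "limitin weak_star \<phi> d F"
    using weak_star_eventually_mem[OF _ _ assms, of _ d] by (auto simp: limitin_def topspace_weak_star)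
qed

lemma continuous_map_weak_starI:
  fixes v :: "real \<Rightarrow> real \<Rightarrow> complex^'m"
  assumes "\<And>t. t \<in> S \<Longrightarrow> v t \<in> X_space"
    and "\<And>g t. \<lbrakk>integrable I01 g; t \<in> S\<rbrakk> \<Longrightarrow> ((\<lambda>r. pairing (v r) g) \<longlongrightarrow> pairing (v t) g) (at t within S)"
  shows "continuous_map (top_of_set S) weak_star v"
  unfolding weak_star_def
proof (rule continuous_on_generated_topo)
  fix U :: "(real \<Rightarrow> complex^'m) set"
  assume "U \<in> {{f \<in> X_space. pairing f g \<in> U} | g U. integrable I01 g \<and> open U}"
  then obtain g V where U: "U = {f \<in> X_space. pairing f g \<in> V}" "integrable I01 g" "open V" by auto
  have "continuous_on S (\<lambda>r. pairing (v r) g)"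
    using assms(2) U by (auto simp: continuous_on_def)
  then have "openin (top_of_set S) (S \<inter> (\<lambda>r. pairing (v r) g) -` V)"
    using U(3) by (rule continuous_openin_preimage_gen)
  moreover have "v -` U \<inter> topspace (top_of_set S) = S \<inter> (\<lambda>r. pairing (v r) g) -` V"
    using assms(1) U(1) by auto
  ultimately show "openin (top_of_set S) (v -` U \<inter> topspace (top_of_set S))" by simp
next
  show "v ` topspace (top_of_set S) \<subseteq> \<Union> {{f \<in> X_space. pairing f g \<in> U} | g U. integrable I01 g \<and> open U}"
    using assms(1) topspace_weak_star unfolding weak_star_def topology_generated_by_topspace by auto
qed

section \<open>The lemma of du Bois-Reymond\<close>

lemma finite_measure_I01: "finite_measure I01"
  by (rule finite_measure_lebesgue_on) simp

lemma integrable_I01_bounded: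
  fixes f :: "real \<Rightarrow> complex"
  assumes "f \<in> borel_measurable I01" "AE x in I01. cmod (f x) \<le> K"
  shows "integrable I01 f"
  by (rule finite_measure.integrable_const_bound[OF finite_measure_I01 assms(2,1)])

lemma integrable_I01_continuous:
  fixes f :: "real \<Rightarrow> complex"
  assumes "continuous_on {0..1} f"
  shows "integrable I01 f"
proof -
  obtain K where "\<And>x. x \<in> {0..1} \<Longrightarrow> cmod (f x) \<le> K"
    using continuous_bounded_measurable(2)[OF assms] unfolding bounded_iff by blast
  then show ?thesis
    using continuous_bounded_measurable(1)[OF assms] by (intro integrable_I01_bounded[where K = K]) auto
qed

lemma integrable_indicator_interval: "integrable I01 (indicator {a..b} :: real \<Rightarrow> complex)"
proof -
  have "indicator {a..b} \<in> borel_measurable (lebesgue :: real measure)" 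
    by (rule borel_measurable_indicator) simp
  then show ?thesis
    by (intro integrable_I01_bounded[where K = 1] measurable_restrict_space1) (auto simp: indicator_def)
qed

lemma LINT_indicator_eq_integral:
  fixes f :: "real \<Rightarrow> complex"
  assumes f: "integrable I01 f" and ab: "0 \<le> a" "b \<le> 1"
  shows "(LINT x|I01. f x * indicator {a..b} x) = integral {a..b} f"
proof -
  have "(LINT x|I01. f x * indicator {a..b} x) = (LINT x|I01. (if x \<in> {a..b} then f x else 0))"
    by (rule Bochner_Integration.integral_cong) (auto simp: indicator_def)
  also have "\<dots> = (LINT x|lebesgue_on ({a..b} \<inter> {0..1}). f x)"
    by (rule Lebesgue_Measure.integral_restrict_Int) auto
  also have "{a..b} \<inter> {0..1} = {a..b}" using ab by auto
  also have "(LINT x|lebesgue_on {a..b}. f x) = integral {a..b} f"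
    by (rule lebesgue_integral_eq_integral[OF integrable_subinterval[OF f]]) (use ab in auto)
  finally show ?thesis .
qed

text \<open>Pairing \<open>f\<close> with its own conjugate gives \<open>\<integral>|f|\<^sup>2 = 0\<close>.\<close>

lemma AE_zero_if_interval_integrals_zero:
  fixes f :: "real \<Rightarrow> complex"
  assumes f: "f \<in> borel_measurable I01" "AE x in I01. cmod (f x) \<le> K"
    and zero: "\<And>a b. \<lbrakk>0 \<le> a; a < b; b \<le> 1\<rbrakk> \<Longrightarrow> (LINT x|I01. f x * indicator {a..b} x) = 0"
  shows "AE x in I01. f x = 0"
proof -
  have cf: "integrable I01 (\<lambda>x. cnj (f x))" using integrable_I01_bounded[OF f] by simp
  have "((\<lambda>i::nat. LINT x|I01. f x * cnj (f x)) \<longlongrightarrow> 0) sequentially"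
  proof (rule tendsto_pairing_if_intervals[where K = K, OF _ _ cf])
    fix a b :: real assume ab: "0 \<le> a" "a \<le> b" "b \<le> 1"
    have "(LINT x|I01. f x * indicator {a..b} x) = 0"
    proof (cases "a = b")
      case True
      then show ?thesis
        using LINT_indicator_eq_integral[OF integrable_I01_bounded[OF f], of a b] ab by simp
    qed (use zero ab in auto)
    then show "((\<lambda>i::nat. LINT x|I01. f x * indicator {a..b} x) \<longlongrightarrow> 0) sequentially" by simp
  qed (use f in auto)
  then have "(LINT x|I01. f x * cnj (f x)) = 0" by (simp add: LIMSEQ_const_iff)
  then have "(LINT x|I01. complex_of_real ((cmod (f x))\<^sup>2)) = 0" by (simp only: complex_norm_square)
  then have "(LINT x|I01. (cmod (f x))\<^sup>2) = 0"
    by (simp only: integral_complex_of_real of_real_eq_0_iff)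
  moreover have "integrable I01 (\<lambda>x. (cmod (f x))\<^sup>2)"
  proof -
    have "integrable I01 (\<lambda>x. cmod (f x * cnj (f x)))"
      using integrable_mult_bounded_I01[OF f cf] by simp
    then show ?thesis by (simp add: norm_mult power2_eq_square)
  qed
  ultimately have "AE x in I01. (cmod (f x))\<^sup>2 = 0"
    by (subst (asm) integral_nonneg_eq_0_iff_AE) auto
  then show ?thesis by simp
qed

lemma test_function_primitive:
  fixes \<psi> :: "real \<Rightarrow> real"
  assumes cont: "continuous_on UNIV \<psi>" and supp: "\<And>x. x \<notin> {a..b} \<Longrightarrow> \<psi> x = 0"
    and ab: "0 < a" "b < 1" and int: "integral {0..1} \<psi> = 0"
  obtains \<phi> where "test_function \<phi>" "deriv \<phi> = \<psi>"
proof
  define \<phi> where "\<phi> x = integral {0..x} \<psi>" for x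
  have int: "\<psi> integrable_on {x..y}" for x y
    by (intro integrable_continuous_real continuous_on_subset[OF cont]) auto
  have low: "\<phi> x = 0" if "x \<le> a" for x
  proof -
    have "integral {0..x} \<psi> = integral {0..x} (\<lambda>_. 0)"
      by (rule integral_spike[of "{a}"]) (use that supp in auto)
    then show ?thesis by (simp add: \<phi>_def)
  qed
  have high: "\<phi> x = 0" if "x \<ge> b" for x
  proof -
    have tail: "integral {b..c} \<psi> = 0" for c
    proof -
      have "integral {b..c} \<psi> = integral {b..c} (\<lambda>_. 0)"
        by (rule integral_spike[of "{b}"]) (use supp in auto)
      then show ?thesis by simp
    qed
    show ?thesis
    proof (cases "a \<le> b")
      case True
      have "integral {0..b} \<psi> + integral {b..c} \<psi> = integral {0..c} \<psi>" if "b \<le> c" for c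
        by (rule Henstock_Kurzweil_Integration.integral_combine) (use that int True ab in auto)
      from this[of x] this[of 1] show ?thesis
        using assms(5) tail that ab by (simp add: \<phi>_def)
    next
      case False
      then have "\<psi> = (\<lambda>_. 0)" using supp by auto
      then show ?thesis by (simp add: \<phi>_def)
    qed
  qed
  have der: "(\<phi> has_vector_derivative \<psi> x) (at x)" for x
  proof (cases "x < a")
    case True
    have "((\<lambda>_. 0) has_vector_derivative \<psi> x) (at x)"
      using supp[of x] True by simp
    moreover have "\<forall>\<^sub>F y in nhds x. \<phi> y = 0"
      using eventually_nhds_in_open[of "{..<a}" x] True by (auto elim!: eventually_mono simp: low)
    ultimately show ?thesis
      by (subst has_vector_derivative_cong_ev[where g = "\<lambda>_. 0"])
        (use low True in \<open>auto intro: eventually_nhds_x_imp_x\<close>)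
  next
    case False
    then have x: "x \<in> {0<..<x+1}" using ab by auto
    have "(\<phi> has_vector_derivative \<psi> x) (at x within {0..x+1})"
      unfolding \<phi>_def using x by (intro integral_has_vector_derivative continuous_on_subset[OF cont]) auto
    then have "(\<phi> has_vector_derivative \<psi> x) (at x within {0<..<x+1})"
      by (rule has_vector_derivative_within_subset) auto
    then show ?thesis using x by (simp add: at_within_open[OF x])
  qed
  then show "deriv \<phi> = \<psi>"
    by (auto simp: fun_eq_iff has_real_derivative_iff_has_vector_derivative intro!: DERIV_imp_deriv)
  have "x \<in> {a..b}" if "\<phi> x \<noteq> 0" for x
    using low[of x] high[of x] that by (cases "x \<le> a"; cases "b \<le> x") auto
  then have "{s. \<phi> s \<noteq> 0} \<subseteq> {a..b}" by blast
  then have "closure {s. \<phi> s \<noteq> 0} \<subseteq> {a..b}" by (rule closure_minimal) simp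
  then show "test_function \<phi>"
    unfolding test_function_def C1_differentiable_on_def using der cont ab by force
qed

text \<open>A continuous function with values in \<open>[0,1]\<close> that vanishes outside \<open>[a + 1/n, b - 1/n]\<close>. For \<open>n \<rightarrow> \<infinity>\<close>
  it tends to the indicator of the open interval. For \<open>n = 0\<close> it is \<open>0\<close>, therefore the statement about the
  support is made for \<open>Suc n\<close>.\<close>

definition trapezoid :: "real \<Rightarrow> real \<Rightarrow> nat \<Rightarrow> real \<Rightarrow> real" where
  "trapezoid a b n x = max 0 (min 1 (real n * min (x - a) (b - x) - 1))"

lemma trapezoid_continuous: "continuous_on S (trapezoid a b n)"
  unfolding trapezoid_def by (intro continuous_intros)

lemma trapezoid_range: "0 \<le> trapezoid a b n x" "trapezoid a b n x \<le> 1"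
  by (auto simp: trapezoid_def)

lemma trapezoid_support:
  assumes "x \<notin> {a + 1 / real (Suc n)..b - 1 / real (Suc n)}"
  shows "trapezoid a b (Suc n) x = 0"
proof -
  have "min (x - a) (b - x) < 1 / real (Suc n)" using assms by auto
  then have "real (Suc n) * min (x - a) (b - x) < real (Suc n) * (1 / real (Suc n))"
    by (intro mult_strict_left_mono) auto
  also have "\<dots> = 1" by simp
  finally show ?thesis by (simp add: trapezoid_def)
qed

lemma trapezoid_tendsto:
  "(\<lambda>n. trapezoid a b n x) \<longlonglongrightarrow> indicator {a<..<b} x"
proof (cases "x \<in> {a<..<b}")
  case True
  define d where "d = min (x - a) (b - x)"
  have "d > 0" using True by (auto simp: d_def)
  obtain N :: nat where N: "2 / d < real N" using reals_Archimedean2 by blast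
  have "\<forall>\<^sub>F n in sequentially. trapezoid a b n x = 1"
    using eventually_ge_at_top[of N]
  proof eventually_elim
    case (elim n)
    have "2 < real N * d" using N \<open>d > 0\<close> by (simp add: field_simps)
    also have "\<dots> \<le> real n * d" using elim \<open>d > 0\<close> by (intro mult_right_mono) auto
    finally show ?case by (simp add: trapezoid_def d_def)
  qed
  then show ?thesis using True by (auto intro: tendsto_eventually)
next
  case False
  then have "min (x - a) (b - x) \<le> 0" by auto
  then have "real n * min (x - a) (b - x) \<le> 0" for n by (simp add: mult_nonneg_nonpos)
  then have "trapezoid a b n x = 0" for n
    unfolding trapezoid_def by (smt (verit))
  then show ?thesis using False by simp
qed

lemma LINT_trapezoid_tendsto:
  fixes f :: "real \<Rightarrow> complex"
  assumes f: "integrable I01 f" and "0 \<le> a" "b \<le> 1"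
  shows "(\<lambda>n. LINT x|I01. trapezoid a b n x *\<^sub>R f x) \<longlonglongrightarrow> (LINT x|I01. f x * indicator {a..b} x)"
proof -
  have "indicat_real {a<..<b} \<in> borel_measurable I01"
    by (rule measurable_restrict_space1, rule borel_measurable_indicator) simp
  then have ind: "(\<lambda>x. indicat_real {a<..<b} x *\<^sub>R f x) \<in> borel_measurable I01"
    using f by (intro borel_measurable_scaleR) auto
  have m: "trapezoid a b n \<in> borel_measurable I01" for n
    by (intro continuous_imp_measurable_on_sets_lebesgue trapezoid_continuous) auto
  have "(\<lambda>n. LINT x|I01. trapezoid a b n x *\<^sub>R f x) \<longlonglongrightarrow> (LINT x|I01. indicator {a<..<b} x *\<^sub>R f x)"
  proof (rule integral_dominated_convergence[where w = "\<lambda>x. cmod (f x)"])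
    show "(\<lambda>x. indicat_real {a<..<b} x *\<^sub>R f x) \<in> borel_measurable I01"
      by (rule ind)
    show "(\<lambda>x. trapezoid a b n x *\<^sub>R f x) \<in> borel_measurable I01" for n
      using m f by auto
    show "AE x in I01. (\<lambda>n. trapezoid a b n x *\<^sub>R f x) \<longlonglongrightarrow> indicat_real {a<..<b} x *\<^sub>R f x"
      by (intro AE_I2 tendsto_intros trapezoid_tendsto)
    show "AE x in I01. norm (trapezoid a b n x *\<^sub>R f x) \<le> cmod (f x)" for n
      using trapezoid_range[of a b n] by (intro AE_I2) (simp add: mult_left_le_one_le)
  qed (use f in auto)
  also have "(LINT x|I01. indicat_real {a<..<b} x *\<^sub>R f x) = (LINT x|I01. f x * indicator {a..b} x)"
  proof (rule integral_cong_AE)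
    have "AE x in lebesgue. x \<notin> {a, b}" by (intro AE_not_in null_sets_completionI finite_imp_null_set_lborel) simp
    then have "AE x in I01. x \<notin> {a, b}" by (auto simp: AE_restrict_space_iff)
    then show "AE x in I01. indicat_real {a<..<b} x *\<^sub>R f x = f x * indicator {a..b} x"
      by eventually_elim (auto simp: indicator_def)
    show "(\<lambda>x. indicat_real {a<..<b} x *\<^sub>R f x) \<in> borel_measurable I01"
      by (rule ind)
    show "(\<lambda>x. f x * indicator {a..b} x) \<in> borel_measurable I01"
      using integrable_indicator_interval[of a b] f by auto
  qed
  finally show ?thesis .
qed

lemma LINT_trapezoid_pos: obtains n where "(LINT x|I01. trapezoid 0 1 (Suc n) x) > 0"
proof -
  have "(\<lambda>n. LINT x|I01. trapezoid 0 1 n x *\<^sub>R (1::complex)) \<longlonglongrightarrow> (LINT x|I01. 1 * indicator {0..1} x)"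
    by (rule LINT_trapezoid_tendsto) (auto intro: integrable_I01_continuous)
  also have "(LINT x|I01. 1 * indicator {0..1} x) = (1::complex)"
    by (subst LINT_indicator_eq_integral) (auto intro: integrable_I01_continuous)
  finally have "(\<lambda>n. complex_of_real (LINT x|I01. trapezoid 0 1 n x)) \<longlonglongrightarrow> complex_of_real 1"
    by (simp add: scaleR_conv_of_real)
  then have "(\<lambda>n. LINT x|I01. trapezoid 0 1 n x) \<longlonglongrightarrow> 1"
    by (simp only: tendsto_of_real_iff)
  then have "\<forall>\<^sub>F n in sequentially. 0 < (LINT x|I01. trapezoid 0 1 n x)"
    by (rule order_tendstoD) simp
  then obtain N where "\<And>n. n \<ge> N \<Longrightarrow> 0 < (LINT x|I01. trapezoid 0 1 n x)"
    by (auto simp: eventually_sequentially)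
  then show thesis using that[of N] by auto
qed

lemma du_Bois_Reymond:
  fixes h :: "real \<Rightarrow> complex"
  assumes h: "h \<in> borel_measurable I01" "AE x in I01. cmod (h x) \<le> K"
    and weak: "\<And>\<phi>. test_function \<phi> \<Longrightarrow> (LINT s|I01. deriv \<phi> s *\<^sub>R h s) = 0"
  obtains \<kappa> where "AE x in I01. h x = \<kappa>"
proof -
  have hi: "integrable I01 h" by (rule integrable_I01_bounded[OF h])
  have ti: "integrable I01 (\<lambda>x. trapezoid a b n x *\<^sub>R f x)" if "integrable I01 f"
    for a b n and f :: "real \<Rightarrow> complex"
  proof -
    have "trapezoid a b n \<in> borel_measurable I01"
      by (intro continuous_imp_measurable_on_sets_lebesgue trapezoid_continuous) auto
    then show ?thesis using that trapezoid_range[of a b n]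
      by (intro Bochner_Integration.integrable_bound[OF that] AE_I2) (auto simp: mult_left_le_one_le)
  qed
  have tr: "integrable I01 (trapezoid a b n)" for a b n
    by (intro finite_measure.integrable_const_bound[OF finite_measure_I01, where B = 1]
      continuous_imp_measurable_on_sets_lebesgue trapezoid_continuous)
      (use trapezoid_range[of a b n] in auto)
  obtain m where m: "(LINT x|I01. trapezoid 0 1 (Suc m) x) > 0" by (rule LINT_trapezoid_pos)
  define \<eta> where "\<eta> = trapezoid 0 1 (Suc m)"
  define I where "I = (LINT x|I01. \<eta> x)"
  define \<kappa> where "\<kappa> = (LINT x|I01. \<eta> x *\<^sub>R h x) / I"
  have I: "I > 0" using m by (simp add: I_def \<eta>_def)
  \<comment> \<open>Subtracting a multiple of \<open>\<eta>\<close> makes the mean zero, so that the difference is the derivative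
    of a test function.\<close>
  have trap: "(LINT x|I01. trapezoid a b (Suc n) x *\<^sub>R (h x - \<kappa>)) = 0" if ab: "0 \<le> a" "b \<le> 1" for a b n
  proof -
    define J where "J = (LINT x|I01. trapezoid a b (Suc n) x)"
    define \<psi> where "\<psi> x = trapezoid a b (Suc n) x - J / I * \<eta> x" for x
    define \<delta> where "\<delta> = min (1 / real (Suc n)) (1 / real (Suc m))"
    have \<psi>_cont: "continuous_on S \<psi>" for S
      unfolding \<psi>_def \<eta>_def by (intro continuous_intros trapezoid_continuous)
    have "(LINT x|I01. \<psi> x) = 0"
      unfolding \<psi>_def using I tr[of a b "Suc n"] tr[of 0 1 "Suc m"] by (simp add: J_def I_def \<eta>_def)
    moreover have "integrable I01 \<psi>"
      unfolding \<psi>_def \<eta>_def using tr by auto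
    ultimately have "integral {0..1} \<psi> = 0"
      by (simp add: lebesgue_integral_eq_integral)
    moreover have "\<psi> x = 0" if "x \<notin> {\<delta>..1 - \<delta>}" for x
      unfolding \<psi>_def \<eta>_def
      by (subst (1 2) trapezoid_support) (use that ab in \<open>auto simp: \<delta>_def min_def split: if_splits\<close>)
    moreover have "0 < \<delta>" by (simp add: \<delta>_def)
    ultimately obtain \<phi> where "test_function \<phi>" "deriv \<phi> = \<psi>"
      using test_function_primitive[of \<psi> \<delta> "1 - \<delta>"] \<psi>_cont by auto
    then have "(LINT s|I01. \<psi> s *\<^sub>R h s) = 0" using weak[of \<phi>] by simp
    also have "(\<lambda>s. \<psi> s *\<^sub>R h s) = (\<lambda>s. trapezoid a b (Suc n) s *\<^sub>R h s - (J / I) *\<^sub>R (\<eta> s *\<^sub>R h s))"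
      by (simp add: \<psi>_def fun_eq_iff scaleR_diff_left)
    also have "(LINT s|I01. trapezoid a b (Suc n) s *\<^sub>R h s - (J / I) *\<^sub>R (\<eta> s *\<^sub>R h s))
        = (LINT s|I01. trapezoid a b (Suc n) s *\<^sub>R h s) - (J / I) *\<^sub>R (LINT s|I01. \<eta> s *\<^sub>R h s)"
      by (subst Bochner_Integration.integral_diff)
        (use ti[OF hi] in \<open>auto simp: \<eta>_def simp del: scaleR_scaleR\<close>)
    finally have "(LINT s|I01. trapezoid a b (Suc n) s *\<^sub>R h s) = J * \<kappa>"
      by (simp add: \<kappa>_def scaleR_conv_of_real)
    moreover have "(LINT s|I01. trapezoid a b (Suc n) s *\<^sub>R \<kappa>) = J * \<kappa>"
      using tr[of a b "Suc n"] by (simp add: J_def scaleR_conv_of_real)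
    ultimately show ?thesis
      using ti[OF hi] ti[OF integrable_I01_continuous[of "\<lambda>_. \<kappa>"]] by (simp add: scaleR_diff_right)
  qed
  have hk: "integrable I01 (\<lambda>x. h x - \<kappa>)"
    using hi integrable_I01_continuous[of "\<lambda>_. \<kappa>"] by auto
  have "AE x in I01. h x - \<kappa> = 0"
  proof (rule AE_zero_if_interval_integrals_zero)
    show "AE x in I01. cmod (h x - \<kappa>) \<le> K + cmod \<kappa>"
      using h(2) by eventually_elim (use norm_triangle_ineq4 order_trans add_right_mono in blast)
    fix a b :: real assume "0 \<le> a" "a < b" "b \<le> 1"
    then have "(\<lambda>n. LINT x|I01. trapezoid a b (Suc n) x *\<^sub>R (h x - \<kappa>))
        \<longlonglongrightarrow> (LINT x|I01. (h x - \<kappa>) * indicator {a..b} x)"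
      using LINT_trapezoid_tendsto[OF hk, of a b] by (intro LIMSEQ_Suc) auto
    then show "(LINT x|I01. (h x - \<kappa>) * indicator {a..b} x) = 0"
      using trap \<open>0 \<le> a\<close> \<open>b \<le> 1\<close> by (simp add: LIMSEQ_const_iff)
  qed (use h in auto)
  then show thesis using that[of \<kappa>] by simp
qed

lemma test_function_is_primitive:
  assumes "test_function \<phi>"
  shows "is_primitive 0 1 (\<lambda>x. complex_of_real (\<phi> x)) (\<lambda>x. complex_of_real (deriv \<phi> x))" "\<phi> 0 = 0" "\<phi> 1 = 0"
proof -
  obtain D where D: "\<And>x. (\<phi> has_vector_derivative D x) (at x)" "continuous_on UNIV D"
    using assms by (auto simp: test_function_def C1_differentiable_on_def)
  have "deriv \<phi> = D"
    using D(1) by (auto simp: fun_eq_iff has_real_derivative_iff_has_vector_derivative intro!: DERIV_imp_deriv)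
  then show "is_primitive 0 1 (\<lambda>x. complex_of_real (\<phi> x)) (\<lambda>x. complex_of_real (deriv \<phi> x))"
    using D by (intro primitive_deriv continuous_intros)
      (auto intro: continuous_on_subset has_vector_derivative_at_within
        intro!: bounded_linear.has_vector_derivative[OF bounded_linear_of_real])
  have "{s. \<phi> s \<noteq> 0} \<subseteq> {0<..<1}"
    using assms closure_subset[of "{s. \<phi> s \<noteq> 0}"] unfolding test_function_def by (meson order_trans)
  then show "\<phi> 0 = 0" "\<phi> 1 = 0" by force+
qed

lemma primitive_integrable:
  assumes "is_primitive 0 1 F f"
  shows "integrable I01 f" "integrable I01 F"
proof -
  obtain K where "K > 0" "\<And>x. x \<in> {0..1} \<Longrightarrow> cmod (f x) \<le> K" by (rule primitive_bound[OF assms]) blast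
  then show "integrable I01 f"
    using assms by (intro integrable_I01_bounded[where K = K]) (auto simp: is_primitive_def)
  show "integrable I01 F" by (rule integrable_I01_continuous[OF primitive_continuous[OF assms]])
qed

lemma primitive_integration_by_parts:
  assumes F: "is_primitive 0 1 F f" and \<phi>: "test_function \<phi>"
  shows "(LINT s|I01. deriv \<phi> s *\<^sub>R F s) = - (LINT s|I01. \<phi> s *\<^sub>R f s)"
proof -
  let ?\<phi> = "\<lambda>x. complex_of_real (\<phi> x)" and ?d = "\<lambda>x. complex_of_real (deriv \<phi> x)"
  note P = test_function_is_primitive[OF \<phi>]
  note prod = primitive_mult[OF P(1) F]
  have "((\<lambda>x. ?d x * F x + ?\<phi> x * f x) has_integral (?\<phi> 1 * F 1 - ?\<phi> 0 * F 0)) {0..1}"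
    using prod by (auto simp: is_primitive_def)
  then have "integral {0..1} (\<lambda>x. ?d x * F x + ?\<phi> x * f x) = 0" using P by (simp add: integral_unique)
  then have "(LINT x|I01. ?d x * F x + ?\<phi> x * f x) = 0"
    using primitive_integrable(1)[OF prod] by (simp add: lebesgue_integral_eq_integral)
  moreover have "integrable I01 (\<lambda>x. ?d x * F x)"
  proof -
    obtain K where "K > 0" "\<And>x. x \<in> {0..1} \<Longrightarrow> cmod (?d x) \<le> K" by (rule primitive_bound[OF P(1)]) blast
    then show ?thesis
      using P(1) primitive_integrable[OF F]
      by (intro integrable_mult_bounded_I01[where K = K]) (auto simp: is_primitive_def)
  qed
  moreover have "integrable I01 (\<lambda>x. ?\<phi> x * f x)"
    using primitive_integrable(1)[OF prod] calculation(2) Bochner_Integration.integrable_diff by fastforce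
  ultimately have "(LINT x|I01. ?d x * F x) + (LINT x|I01. ?\<phi> x * f x) = 0" by simp
  then show ?thesis by (simp add: scaleR_conv_of_real eq_neg_iff_add_eq_0)
qed

section \<open>Components of elements of X\<close>

lemma borel_measurable_vec_component:
  fixes f :: "'a \<Rightarrow> complex^'m"
  assumes "f \<in> borel_measurable M"
  shows "(\<lambda>s. f s $ j) \<in> borel_measurable M"
proof -
  have "(\<lambda>z::complex^'m. z $ j) \<in> borel_measurable borel"
    by (intro borel_measurable_continuous_onI continuous_intros)
  from measurable_compose[OF assms this] show ?thesis .
qed

lemma vec_eq_sum_axis: "(z :: complex^'m) = (\<Sum>j\<in>UNIV. axis j (z $ j))"
  by (simp add: vec_eq_iff axis_def sum.delta')

lemma borel_measurable_axis:
  assumes "h \<in> borel_measurable M"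
  shows "(\<lambda>s. axis j (h s) :: complex^'m) \<in> borel_measurable M"
proof -
  have "continuous_on UNIV (\<lambda>z. if i = j then z else (0::complex))" for i
    by (cases "i = j") auto
  then have "continuous_on UNIV (\<lambda>z. axis j z :: complex^'m)"
    unfolding axis_def by (intro continuous_on_vec_lambda)
  then have "(\<lambda>z. axis j z :: complex^'m) \<in> borel_measurable borel"
    by (rule borel_measurable_continuous_onI)
  from measurable_compose[OF assms this] show ?thesis .
qed

lemma borel_measurable_vecI:
  fixes f :: "'a \<Rightarrow> complex^'m"
  assumes "\<And>j. (\<lambda>s. f s $ j) \<in> borel_measurable M"
  shows "f \<in> borel_measurable M"
proof -
  have "(\<lambda>s. \<Sum>j\<in>UNIV. axis j (f s $ j)) \<in> borel_measurable M"
    by (intro borel_measurable_sum borel_measurable_axis assms)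
  then show ?thesis by (simp add: vec_eq_sum_axis[symmetric])
qed

lemma norm_axis: "norm (axis j z :: complex^'m) = cmod z"
proof -
  have "(cmod (if i = j then z else 0))\<^sup>2 = (if i = j then (cmod z)\<^sup>2 else 0)" for i :: 'm
    by simp
  then show ?thesis by (simp add: norm_vec_def L2_set_def axis_def)
qed

lemma integrable_axis:
  assumes "integrable M h"
  shows "integrable M (\<lambda>s. axis j (h s) :: complex^'m)"
  by (rule Bochner_Integration.integrable_bound[OF assms borel_measurable_axis])
    (use assms in \<open>auto simp: norm_axis\<close>)

lemma integrable_vecI:
  fixes f :: "'a \<Rightarrow> complex^'m"
  assumes "\<And>j. integrable M (\<lambda>s. f s $ j)"
  shows "integrable M f"
proof -
  have "integrable M (\<lambda>s. \<Sum>j\<in>UNIV. axis j (f s $ j))"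
    by (intro Bochner_Integration.integrable_sum integrable_axis assms)
  then show ?thesis by (simp add: vec_eq_sum_axis[symmetric])
qed

lemma integrable_vec_component:
  fixes f :: "'a \<Rightarrow> complex^'m"
  assumes "integrable M f"
  shows "integrable M (\<lambda>s. f s $ j)"
  using integrable_bounded_linear[OF bounded_linear_vec_nth assms] .

lemma Linf_AE_bound:
  assumes "f \<in> Linf N"
  obtains K where "AE s in I01. N (f s) \<le> K"
proof -
  have "AE s in I01. ereal (N (f s)) \<le> Linf_norm N f"
    unfolding Linf_norm_def by (rule esssup_AE)
  moreover obtain K where "Linf_norm N f \<le> ereal K"
    using assms unfolding Linf_def by (cases "Linf_norm N f") auto
  ultimately have "AE s in I01. N (f s) \<le> K"
    by (auto elim!: eventually_mono dest: order_trans)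
  then show thesis by (rule that)
qed

lemma cmod_le_l1norm: "cmod (z $ j) \<le> l1norm z"
  unfolding l1norm_def by (rule member_le_sum) auto

lemma X_norm_component:
  assumes "X_norm f \<le> ereal K"
  shows "AE s in I01. cmod (f s $ j) \<le> K"
proof -
  have "AE s in I01. ereal (l1norm (f s)) \<le> X_norm f"
    unfolding Linf_norm_def by (rule esssup_AE)
  then show ?thesis
  proof eventually_elim
    case (elim s)
    then have "l1norm (f s) \<le> K" using assms order_trans by fastforce
    then show ?case using cmod_le_l1norm order_trans by blast
  qed
qed

lemma X_norm_le:
  fixes f :: "real \<Rightarrow> complex^'m"
  assumes "\<And>j. (\<lambda>s. f s $ j) \<in> borel_measurable I01" "\<And>j. AE s in I01. cmod (f s $ j) \<le> K j"
  shows "X_norm f \<le> ereal (\<Sum>j\<in>UNIV. K j)"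
  unfolding Linf_norm_def
proof (rule esssup_I)
  show "(\<lambda>s. ereal (l1norm (f s))) \<in> borel_measurable I01"
    unfolding l1norm_def using assms(1) by auto
  have "AE s in I01. \<forall>j. cmod (f s $ j) \<le> K j"
    using assms(2) by (simp add: AE_all_countable)
  then show "AE s in I01. ereal (l1norm (f s)) \<le> ereal (\<Sum>j\<in>UNIV. K j)"
    by eventually_elim (auto simp: l1norm_def intro: sum_mono)
qed

lemma X_spaceI:
  fixes f :: "real \<Rightarrow> complex^'m"
  assumes "\<And>j. (\<lambda>s. f s $ j) \<in> borel_measurable I01" "\<And>j. AE s in I01. cmod (f s $ j) \<le> K j"
  shows "f \<in> X_space"
  using X_norm_le[OF assms] borel_measurable_vecI[OF assms(1)]
  by (auto simp: Linf_def intro: le_less_trans)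

lemma X_space_component:
  assumes "f \<in> X_space"
  obtains K where "\<And>j. (\<lambda>s. f s $ j) \<in> borel_measurable I01" "\<And>j. AE s in I01. cmod (f s $ j) \<le> K"
proof -
  obtain K where K: "AE s in I01. l1norm (f s) \<le> K" by (rule Linf_AE_bound[OF assms])
  have "AE s in I01. cmod (f s $ j) \<le> K" for j
    using K by eventually_elim (use cmod_le_l1norm order_trans in blast)
  moreover have "(\<lambda>s. f s $ j) \<in> borel_measurable I01" for j
    using assms by (intro borel_measurable_vec_component) (simp add: Linf_def)
  ultimately show thesis using that by blast
qed

lemma X_space_mult_integrable:
  assumes "f \<in> X_space" "integrable I01 g"
  shows "integrable I01 (\<lambda>s. f s $ j * g s)"
proof -
  obtain K where "\<And>j. (\<lambda>s. f s $ j) \<in> borel_measurable I01" "\<And>j. AE s in I01. cmod (f s $ j) \<le> K"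
    by (rule X_space_component[OF assms(1)]) blast
  then show ?thesis using assms(2) by (rule integrable_mult_bounded_I01)
qed

lemma pairing_eq_sum:
  assumes "f \<in> X_space" "integrable I01 g"
  shows "pairing f g = (\<Sum>j\<in>UNIV. LINT s|I01. f s $ j * g s $ j)"
  unfolding pairing_def
  by (intro Bochner_Integration.integral_sum X_space_mult_integrable integrable_vec_component assms)

lemma pairing_axis: "pairing f (\<lambda>s. axis j (g s)) = (LINT s|I01. f s $ j * g s)"
proof -
  have "f s $ i * axis j (g s) $ i = (if i = j then f s $ i * g s else 0)" for i s
    by (simp add: axis_def)
  then show ?thesis by (simp add: pairing_def)
qed

lemma pairing_zero: "pairing (\<lambda>s. 0) g = 0"
  by (simp add: pairing_def)

section \<open>Functions in the Sobolev space as antiderivatives\<close>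

lemma clip_bounded:
  fixes f :: "real \<Rightarrow> complex"
  assumes f: "f \<in> borel_measurable I01" "AE x in I01. cmod (f x) \<le> K"
  obtains f' where "f' \<in> borel_measurable I01" "bounded (f' ` {0..1})" "AE x in I01. f x = f' x"
proof
  let ?f = "\<lambda>x. if cmod (f x) \<le> K then f x else 0"
  show "?f \<in> borel_measurable I01" using f(1) by measurable
  have "\<forall>x\<in>{0..1}. cmod (?f x) \<le> max K 0" by auto
  then show "bounded (?f ` {0..1})" unfolding bounded_iff by blast
  show "AE x in I01. f x = ?f x" using f(2) by eventually_elim simp
qed

lemma primitive_of_density:
  assumes "f \<in> borel_measurable (lebesgue_on {a..b})" "bounded (f ` {a..b})"
  shows "is_primitive a b (\<lambda>x. integral {a..x} f) f"
proof (rule primitiveI_quadratic[OF assms, where K = 0])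
  fix x y assume xy: "a \<le> x" "x \<le> y" "y \<le> b"
  have "integral {a..x} f + integral {x..y} f = integral {a..y} f"
    by (rule Henstock_Kurzweil_Integration.integral_combine)
      (use xy bounded_measurable_integrable_on[OF assms] in auto)
  then show "cmod (integral {a..y} f - integral {a..x} f - integral {x..y} f) \<le> 0 * (y - x)\<^sup>2"
    by (metis add_diff_cancel_left' diff_self mult_zero_left norm_zero order_refl)
qed

lemma primitive_integral_continuous:
  assumes "continuous_on {a..b} f"
  shows "is_primitive a b (\<lambda>x. integral {a..x} f) f"
  using primitive_of_density[OF continuous_bounded_measurable[OF assms]] .

lemma weak_deriv_imp_primitive:
  fixes f g :: "real \<Rightarrow> complex"
  assumes f: "f \<in> borel_measurable I01" "AE x in I01. cmod (f x) \<le> K"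
    and g: "g \<in> borel_measurable I01" "AE x in I01. cmod (g x) \<le> L"
    and weak: "\<And>\<phi>. test_function \<phi> \<Longrightarrow>
      (LINT s|I01. deriv \<phi> s *\<^sub>R f s) = - (LINT s|I01. \<phi> s *\<^sub>R g s)"
  obtains F g' where "is_primitive 0 1 F g'" "AE x in I01. F x = f x" "AE x in I01. g x = g' x"
proof -
  obtain g' where g': "g' \<in> borel_measurable I01" "bounded (g' ` {0..1})" "AE x in I01. g x = g' x"
    by (rule clip_bounded[OF g])
  define F where "F x = integral {0..x} g'" for x
  have F: "is_primitive 0 1 F g'" unfolding F_def by (rule primitive_of_density[OF g'(1,2)])
  obtain L' where L': "\<And>x. x \<in> {0..1} \<Longrightarrow> cmod (F x) \<le> L'"
    using continuous_bounded_measurable(2)[OF primitive_continuous[OF F]] unfolding bounded_iff by blast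
  have Fm: "F \<in> borel_measurable I01"
    by (rule continuous_bounded_measurable(1)[OF primitive_continuous[OF F]])
  have fi: "integrable I01 f" by (rule integrable_I01_bounded[OF f])
  obtain \<kappa> where \<kappa>: "AE x in I01. f x - F x = \<kappa>"
  proof (rule du_Bois_Reymond)
    show "(\<lambda>x. f x - F x) \<in> borel_measurable I01" using f(1) Fm by simp
    have "AE x in I01. cmod (F x) \<le> L'" using L' by (intro AE_I2) auto
    with f(2) show "AE x in I01. cmod (f x - F x) \<le> K + L'"
      by eventually_elim (meson norm_triangle_ineq4 order_trans add_mono)
    fix \<phi> assume \<phi>: "test_function \<phi>"
    have d: "integrable I01 (\<lambda>s. complex_of_real (deriv \<phi> s))"
      using primitive_integrable(1)[OF test_function_is_primitive(1)[OF \<phi>]] .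
    have "AE x in I01. cmod (F x) \<le> L'" using L' by (intro AE_I2) auto
    then have i: "integrable I01 (\<lambda>s. deriv \<phi> s *\<^sub>R f s)" "integrable I01 (\<lambda>s. deriv \<phi> s *\<^sub>R F s)"
      using integrable_mult_bounded_I01[OF f d] integrable_mult_bounded_I01[OF Fm _ d]
      by (simp_all add: scaleR_conv_of_real mult.commute)
    have "(LINT s|I01. deriv \<phi> s *\<^sub>R (f s - F s)) = (LINT s|I01. deriv \<phi> s *\<^sub>R f s) - (LINT s|I01. deriv \<phi> s *\<^sub>R F s)"
      using i by (simp add: scaleR_diff_right)
    also have "\<dots> = - (LINT s|I01. \<phi> s *\<^sub>R g s) + (LINT s|I01. \<phi> s *\<^sub>R g' s)"
      using weak[OF \<phi>] primitive_integration_by_parts[OF F \<phi>] by simp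
    also have "(LINT s|I01. \<phi> s *\<^sub>R g s) = (LINT s|I01. \<phi> s *\<^sub>R g' s)"
    proof (rule integral_cong_AE)
      have "(\<lambda>s. complex_of_real (\<phi> s)) \<in> borel_measurable I01"
        using primitive_integrable(2)[OF test_function_is_primitive(1)[OF \<phi>]] by simp
      then show "(\<lambda>s. \<phi> s *\<^sub>R g s) \<in> borel_measurable I01" "(\<lambda>s. \<phi> s *\<^sub>R g' s) \<in> borel_measurable I01"
        using g(1) g'(1) by (auto simp: scaleR_conv_of_real)
      show "AE s in I01. \<phi> s *\<^sub>R g s = \<phi> s *\<^sub>R g' s" using g'(3) by eventually_elim simp
    qed
    finally show "(LINT s|I01. deriv \<phi> s *\<^sub>R (f s - F s)) = 0" by simp
  qed
  show thesis
  proof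
    show "is_primitive 0 1 (\<lambda>x. F x + \<kappa>) g'" using primitive_add[OF F primitive_const, of \<kappa>] by simp
    show "AE x in I01. F x + \<kappa> = f x" using \<kappa> by eventually_elim (simp add: algebra_simps)
    show "AE x in I01. g x = g' x" by (rule g'(3))
  qed
qed

lemma is_weak_deriv_iff:
  fixes f g :: "real \<Rightarrow> complex^'m"
  assumes "f \<in> X_space" "g \<in> X_space"
  shows "is_weak_deriv f g \<longleftrightarrow> (\<forall>j \<phi>. test_function \<phi> \<longrightarrow>
    (LINT s|I01. deriv \<phi> s *\<^sub>R f s $ j) = - (LINT s|I01. \<phi> s *\<^sub>R g s $ j))"
proof -
  have "((LINT s|I01. deriv \<phi> s *\<^sub>R f s) = - (LINT s|I01. \<phi> s *\<^sub>R g s)) \<longleftrightarrow>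
    (\<forall>j. (LINT s|I01. deriv \<phi> s *\<^sub>R f s $ j) = - (LINT s|I01. \<phi> s *\<^sub>R g s $ j))"
    if \<phi>: "test_function \<phi>" for \<phi>
  proof -
    note P = primitive_integrable[OF test_function_is_primitive(1)[OF \<phi>]]
    have i: "integrable I01 (\<lambda>s. deriv \<phi> s *\<^sub>R f s)" "integrable I01 (\<lambda>s. \<phi> s *\<^sub>R g s)"
      using X_space_mult_integrable[OF assms(1) P(1)] X_space_mult_integrable[OF assms(2) P(2)]
      by (auto intro!: integrable_vecI simp: scaleR_conv_of_real[where 'a = complex] mult.commute)
    show ?thesis
      using integral_bounded_linear[OF bounded_linear_vec_nth i(1)]
        integral_bounded_linear[OF bounded_linear_vec_nth i(2)]
      by (simp add: vec_eq_iff)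
  qed
  then show ?thesis unfolding is_weak_deriv_def by blast
qed

lemma continuous_ae_eq_imp_eq:
  fixes F G :: "real \<Rightarrow> 'a::real_normed_vector"
  assumes "continuous_on {0..1} F" "continuous_on {0..1} G" "ae_eq F G" "x \<in> {0..1}"
  shows "F x = G x"
proof -
  let ?d = "\<lambda>x. norm (F x - G x)"
  have c: "continuous_on {0..1} ?d" by (intro continuous_intros assms)
  then have m: "?d \<in> borel_measurable I01"
    by (rule continuous_imp_measurable_on_sets_lebesgue) simp
  have ae: "AE x in I01. ?d x = 0" using assms(3) unfolding ae_eq_def by eventually_elim simp
  have i: "integrable I01 ?d"
    by (rule finite_measure.integrable_const_bound[OF finite_measure_I01 _ m, where B = 0])
      (use ae in eventually_elim, simp)
  have "(LINT x|I01. ?d x) = (LINT x|I01. 0)"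
    by (rule integral_cong_AE) (use m ae in auto)
  then have "integral {0..1} ?d = 0"
    using i by (simp add: lebesgue_integral_eq_integral)
  then show ?thesis using integral_eq_0_iff[OF c] assms(4) by auto
qed

lemma cont_rep_eq:
  fixes f :: "real \<Rightarrow> complex^'m"
  assumes "continuous_on {0..1} F" "ae_eq F f"
  shows "continuous_on {0..1} (cont_rep f)" "ae_eq (cont_rep f) f"
    "x \<in> {0..1} \<Longrightarrow> cont_rep f x = F x"
proof -
  have *: "continuous_on {0..1} (cont_rep f) \<and> ae_eq (cont_rep f) f"
    unfolding cont_rep_def by (rule someI[of _ F]) (use assms in auto)
  then show "continuous_on {0..1} (cont_rep f)" "ae_eq (cont_rep f) f" by auto
  have "ae_eq (cont_rep f) F"
    using conjunct2[OF *] assms(2) unfolding ae_eq_def by eventually_elim simp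
  then show "x \<in> {0..1} \<Longrightarrow> cont_rep f x = F x"
    using * assms(1) by (intro continuous_ae_eq_imp_eq) auto
qed

text \<open>The components of the continuous representative of \<open>f\<close> are antiderivatives of the components of the weak
  derivative.\<close>

lemma W1inf_cont_rep:
  fixes f :: "real \<Rightarrow> complex^'m"
  assumes "f \<in> W1inf"
  obtains g where "\<And>j. is_primitive 0 1 (\<lambda>x. cont_rep f x $ j) (g j)"
    "\<And>j. AE s in I01. weak_deriv f s $ j = g j s" "ae_eq (cont_rep f) f"
proof -
  let ?d = "weak_deriv f"
  have f: "f \<in> X_space" using assms by (simp add: W1inf_def)
  have d: "?d \<in> X_space" "is_weak_deriv f ?d"
    using assms someI_ex[of "\<lambda>g. g \<in> X_space \<and> is_weak_deriv f g"]
    unfolding W1inf_def weak_deriv_def by auto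
  obtain K where K: "\<And>j. (\<lambda>s. f s $ j) \<in> borel_measurable I01" "\<And>j. AE s in I01. cmod (f s $ j) \<le> K"
    by (rule X_space_component[OF f]) blast
  obtain L where L: "\<And>j. (\<lambda>s. ?d s $ j) \<in> borel_measurable I01" "\<And>j. AE s in I01. cmod (?d s $ j) \<le> L"
    by (rule X_space_component[OF d(1)]) blast
  have "\<exists>F g. is_primitive 0 1 F g \<and> (AE x in I01. F x = f x $ j) \<and> (AE x in I01. ?d x $ j = g x)" for j
    by (rule weak_deriv_imp_primitive[OF K(1)[of j] K(2)[of j] L(1)[of j] L(2)[of j]])
      (use d(2) is_weak_deriv_iff[OF f d(1)] in auto)
  then have "\<forall>j. \<exists>p. is_primitive 0 1 (fst p) (snd p) \<and> (AE x in I01. fst p x = f x $ j) \<and>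
      (AE x in I01. ?d x $ j = snd p x)" by simp
  then obtain p where p: "\<forall>j. is_primitive 0 1 (fst (p j)) (snd (p j)) \<and> (AE x in I01. fst (p j) x = f x $ j) \<and>
      (AE x in I01. ?d x $ j = snd (p j) x)" by (rule choice[THEN exE])
  define F g where "F j = fst (p j)" and "g j = snd (p j)" for j
  have Fg: "\<And>j. is_primitive 0 1 (F j) (g j)" "\<And>j. AE x in I01. F j x = f x $ j"
    "\<And>j. AE x in I01. ?d x $ j = g j x" using p by (auto simp: F_def g_def)
  have c: "continuous_on {0..1} (\<lambda>x. \<chi> j. F j x)"
    by (intro continuous_on_vec_lambda primitive_continuous[OF Fg(1)])
  have "AE x in I01. \<forall>j. F j x = f x $ j" using Fg(2) by (simp add: AE_all_countable)
  then have ae: "ae_eq (\<lambda>x. \<chi> j. F j x) f"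
    unfolding ae_eq_def by eventually_elim (simp add: vec_eq_iff)
  have "is_primitive 0 1 (\<lambda>x. cont_rep f x $ j) (g j)" for j
    by (rule primitive_cong[OF Fg(1)]) (simp_all add: cont_rep_eq(3)[OF c ae])
  then show thesis using that Fg(3) cont_rep_eq(2)[OF c ae] by blast
qed

lemma W1inf_cont_rep_continuous:
  fixes f :: "real \<Rightarrow> complex^'m"
  assumes "f \<in> W1inf"
  shows "continuous_on {0..1} (cont_rep f)" "ae_eq (cont_rep f) f"
proof -
  obtain g where g: "\<And>j. is_primitive 0 1 (\<lambda>x. cont_rep f x $ j) (g j)" and ae: "ae_eq (cont_rep f) f"
    by (rule W1inf_cont_rep[OF assms]) blast
  have "continuous_on {0..1} (\<lambda>x. \<chi> j. cont_rep f x $ j)"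
    by (intro continuous_on_vec_lambda primitive_continuous[OF g])
  then show "continuous_on {0..1} (cont_rep f)" by simp
  show "ae_eq (cont_rep f) f" by (rule ae)
qed

lemma primitive_density_unique:
  assumes "is_primitive 0 1 F f" "is_primitive 0 1 F g"
  shows "AE x in I01. f x = g x"
proof -
  obtain K where K: "K > 0" "\<And>x. x \<in> {0..1} \<Longrightarrow> cmod (f x) \<le> K" by (rule primitive_bound[OF assms(1)]) blast
  obtain L where L: "L > 0" "\<And>x. x \<in> {0..1} \<Longrightarrow> cmod (g x) \<le> L" by (rule primitive_bound[OF assms(2)]) blast
  have d: "is_primitive 0 1 (\<lambda>x. F x + (-1) * F x) (\<lambda>x. f x + (-1) * g x)"
    by (intro primitive_add primitive_cmult assms)
  have "AE x in I01. f x + (-1) * g x = 0"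
  proof (rule AE_zero_if_interval_integrals_zero)
    show "(\<lambda>x. f x + (-1) * g x) \<in> borel_measurable I01" using d by (simp add: is_primitive_def)
    show "AE x in I01. cmod (f x + (-1) * g x) \<le> K + L"
      using K L by (intro AE_I2) (auto intro: order_trans[OF norm_triangle_ineq4] add_mono)
    fix a b :: real assume ab: "0 \<le> a" "a < b" "b \<le> 1"
    have "((\<lambda>x. f x + (-1) * g x) has_integral (F b + (-1) * F b - (F a + (-1) * F a))) {a..b}"
      using d ab unfolding is_primitive_def by force
    then have "integral {a..b} (\<lambda>x. f x + (-1) * g x) = 0" by (simp add: integral_unique)
    then show "(LINT x|I01. (f x + (-1) * g x) * indicator {a..b} x) = 0"
      using LINT_indicator_eq_integral[OF primitive_integrable(1)[OF d]] ab by simp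
  qed
  then show ?thesis by simp
qed

text \<open>Converse: a vector of antiderivatives lies in \<open>W\<^sup>1\<^sup>,\<^sup>\<infinity>\<close>, and the representative and the weak
  derivative chosen for it are the expected ones.\<close>

lemma primitive_imp_W1inf:
  fixes f :: "real \<Rightarrow> complex^'m"
  assumes F: "\<And>j. is_primitive 0 1 (F j) (g j)"
    and f: "\<And>j x. x \<in> {0..1} \<Longrightarrow> f x $ j = F j x"
  shows "f \<in> W1inf" "x \<in> {0..1} \<Longrightarrow> cont_rep f x $ j = F j x"
    "AE s in I01. weak_deriv f s $ j = g j s"
proof -
  have "\<exists>K. \<forall>x\<in>{0..1}. cmod (F j x) \<le> K" for j
    using continuous_bounded_measurable(2)[OF primitive_continuous[OF F]] unfolding bounded_iff by blast
  then obtain K where K: "\<And>j x. x \<in> {0..1} \<Longrightarrow> cmod (F j x) \<le> K j" by metis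
  have "\<exists>K. \<forall>x\<in>{0..1}. cmod (g j x) \<le> K" for j
    using F unfolding is_primitive_def bounded_iff by blast
  then obtain L where L: "\<And>j x. x \<in> {0..1} \<Longrightarrow> cmod (g j x) \<le> L j" by metis
  have m: "(\<lambda>s. f s $ j) \<in> borel_measurable I01 \<longleftrightarrow> F j \<in> borel_measurable I01" for j
    by (rule measurable_cong) (use f in auto)
  have fX: "f \<in> X_space"
    by (rule X_spaceI[of _ K])
      (use m f K continuous_bounded_measurable(1)[OF primitive_continuous[OF F]] in auto)
  have gX: "(\<lambda>s. \<chi> j. g j s) \<in> X_space"
    by (rule X_spaceI[of _ L]) (use L F in \<open>auto simp: is_primitive_def\<close>)
  have "is_weak_deriv f (\<lambda>s. \<chi> j. g j s)"
    unfolding is_weak_deriv_iff[OF fX gX]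
  proof (intro allI impI)
    fix j \<phi> assume \<phi>: "test_function \<phi>"
    have "(LINT s|I01. deriv \<phi> s *\<^sub>R f s $ j) = (LINT s|I01. deriv \<phi> s *\<^sub>R F j s)"
      by (rule Bochner_Integration.integral_cong) (use f in auto)
    then show "(LINT s|I01. deriv \<phi> s *\<^sub>R f s $ j) = - (LINT s|I01. \<phi> s *\<^sub>R (\<chi> j. g j s) $ j)"
      using primitive_integration_by_parts[OF F \<phi>, of j] by simp
  qed
  with fX gX show W: "f \<in> W1inf" by (auto simp: W1inf_def)
  have c: "continuous_on {0..1} (\<lambda>x. \<chi> j. F j x)"
    by (intro continuous_on_vec_lambda primitive_continuous[OF F])
  have ae: "ae_eq (\<lambda>x. \<chi> j. F j x) f"
    unfolding ae_eq_def by (rule AE_I2) (use f in \<open>auto simp: vec_eq_iff\<close>)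
  show rep: "x \<in> {0..1} \<Longrightarrow> cont_rep f x $ j = F j x" for x j
    by (simp add: cont_rep_eq(3)[OF c ae])
  obtain h where h: "\<And>j. is_primitive 0 1 (\<lambda>x. cont_rep f x $ j) (h j)"
    "\<And>j. AE s in I01. weak_deriv f s $ j = h j s" by (rule W1inf_cont_rep[OF W]) blast
  have "is_primitive 0 1 (F j) (h j)" by (rule primitive_cong[OF h(1)]) (use rep in auto)
  then have "AE s in I01. h j s = g j s" using F by (rule primitive_density_unique)
  with h(2)[of j] show "AE s in I01. weak_deriv f s $ j = g j s"
    by eventually_elim simp
qed

section \<open>Linear delay systems\<close>

text \<open>Pointwise convergence to \<open>0\<close> of uniformly Lipschitz functions is uniform on compact
  intervals.\<close>

lemma equilipschitz_tendsto_uniform: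
  fixes Q :: "'i \<Rightarrow> real \<Rightarrow> complex"
  assumes lip: "\<And>n x y. \<lbrakk>x \<in> {0..N}; y \<in> {0..N}\<rbrakk> \<Longrightarrow> cmod (Q n x - Q n y) \<le> L * \<bar>x - y\<bar>"
    and lim: "\<And>y. y \<in> {0..N} \<Longrightarrow> ((\<lambda>n. Q n y) \<longlongrightarrow> 0) F"
    and "e > 0" "N \<ge> 0"
  shows "\<forall>\<^sub>F n in F. \<forall>y\<in>{0..N}. cmod (Q n y) < e"
proof -
  define d where "d = e / (2 * (\<bar>L\<bar> + 1))"
  have d: "d > 0" using \<open>e > 0\<close> by (simp add: d_def)
  define P where "P = (\<lambda>i. min N (real i * d)) ` {..nat \<lceil>N / d\<rceil>}"
  have "\<forall>\<^sub>F n in F. \<forall>p\<in>P. cmod (Q n p) < e / 2"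
  proof (rule eventually_ball_finite)
    show "finite P" by (simp add: P_def)
    show "\<forall>p\<in>P. \<forall>\<^sub>F n in F. cmod (Q n p) < e / 2"
    proof
      fix p assume "p \<in> P"
      then have "p \<in> {0..N}" using d \<open>N \<ge> 0\<close> by (auto simp: P_def)
      then show "\<forall>\<^sub>F n in F. cmod (Q n p) < e / 2"
        using tendstoD[OF lim, of p "e / 2"] \<open>e > 0\<close> by simp
    qed
  qed
  then show ?thesis
  proof eventually_elim
    case (elim n)
    show ?case
    proof
      fix y assume y: "y \<in> {0..N}"
      define i where "i = nat \<lfloor>y / d\<rfloor>"
      have i: "real i * d \<le> y" "y - real i * d \<le> d" "i \<le> nat \<lceil>N / d\<rceil>"
      proof -
        have ri: "real i = of_int \<lfloor>y / d\<rfloor>" using y d by (simp add: i_def)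
        have "real i \<le> y / d" "y / d \<le> real i + 1" unfolding ri by linarith+
        then show "real i * d \<le> y" "y - real i * d \<le> d" using d by (auto simp: field_simps)
        have "y / d \<le> N / d" using y d by (simp add: divide_right_mono)
        then show "i \<le> nat \<lceil>N / d\<rceil>" unfolding i_def by (intro nat_mono) linarith
      qed
      then have "real i * d \<in> P" using y by (auto simp: P_def image_iff intro!: bexI[of _ i])
      then have 1: "cmod (Q n (real i * d)) < e / 2" using elim by blast
      have L: "L * \<bar>y - real i * d\<bar> \<le> \<bar>L\<bar> * d"
        using i by (intro mult_mono) auto
      have "\<bar>L\<bar> * d < e / 2"
      proof -
        have "\<bar>L\<bar> * d < (\<bar>L\<bar> + 1) * d" using d by (intro mult_strict_right_mono) auto
        also have "\<dots> = e / 2" by (simp add: d_def field_simps add_nonneg_eq_0_iff)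
        finally show ?thesis .
      qed
      moreover have "cmod (Q n y - Q n (real i * d)) \<le> L * \<bar>y - real i * d\<bar>"
        using y i d by (intro lip) auto
      ultimately show "cmod (Q n y) < e"
        using L 1 norm_triangle_sub[of "Q n y" "Q n (real i * d)"] by linarith
    qed
  qed
qed

text \<open>The system \<open>W\<^sub>j(y) = \<Sum>\<^sub>k M\<^sub>j\<^sub>k W\<^sub>k(y - T\<^sub>j)\<close> for \<open>y > T\<^sub>j\<close>, with delays \<open>T\<^sub>j > 0\<close> and a prescribed
  history of the \<open>j\<close>-th component on \<open>[0,T\<^sub>j]\<close>.\<close>

locale delay_system =
  fixes T :: "'m::finite \<Rightarrow> real" and M :: "'m \<Rightarrow> 'm \<Rightarrow> complex"
  assumes T_pos: "T j > 0"
begin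

definition min_delay :: real where "min_delay = Min (range T)"

lemma min_delay_pos: "min_delay > 0" and min_delay_le: "min_delay \<le> T j"
  using T_pos by (auto simp: min_delay_def)

text \<open>The solution with history \<open>\<eta>\<close>. Each step back lowers \<open>y\<close> by at least the smallest delay, hence the
  recursion terminates.\<close>

function delay_ext :: "('m \<Rightarrow> real \<Rightarrow> complex) \<Rightarrow> 'm \<Rightarrow> real \<Rightarrow> complex" where
  "delay_ext \<eta> j y = (if y \<le> T j then \<eta> j y else \<Sum>k\<in>UNIV. M j k * delay_ext \<eta> k (y - T j))"
  by pat_completeness auto
termination
proof (relation "Wellfounded.measure (\<lambda>(\<eta>, j, y). nat \<lceil>y / min_delay\<rceil>)")
  fix y j
  assume "\<not> y \<le> T j"
  then have "(y - T j) / min_delay \<le> y / min_delay - 1" "0 < y / min_delay"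
    using min_delay_pos min_delay_le[of j] T_pos[of j] by (auto simp: field_simps)
  then have "\<lceil>(y - T j) / min_delay\<rceil> < \<lceil>y / min_delay\<rceil>" "0 < \<lceil>y / min_delay\<rceil>"
    by linarith+
  then show "((\<eta>, k, y - T j), \<eta>, j, y) \<in> Wellfounded.measure (\<lambda>(\<eta>, j, y). nat \<lceil>y / min_delay\<rceil>)" for \<eta> k
    by simp
qed simp

declare delay_ext.simps [simp del]

lemma delay_induct [case_names step]:
  assumes "\<And>j y. (\<And>k. T j < y \<Longrightarrow> P k (y - T j)) \<Longrightarrow> P j y"
  shows "P j y"
  by (rule delay_ext.induct[of "\<lambda>_. P"], rule assms) simp

lemma delay_ext_initial: "y \<le> T j \<Longrightarrow> delay_ext \<eta> j y = \<eta> j y"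
  by (simp add: delay_ext.simps)

lemma delay_ext_step:
  "T j < y \<Longrightarrow> delay_ext \<eta> j y = (\<Sum>k\<in>UNIV. M j k * delay_ext \<eta> k (y - T j))"
  by (subst delay_ext.simps) simp

lemma delay_ext_unique:
  assumes "\<And>j y. \<lbrakk>0 \<le> y; y \<le> T j\<rbrakk> \<Longrightarrow> W j y = \<eta> j y"
    and "\<And>j y. T j < y \<Longrightarrow> W j y = (\<Sum>k\<in>UNIV. M j k * W k (y - T j))"
    and "0 \<le> y"
  shows "W j y = delay_ext \<eta> j y"
  using assms
proof (induction j y rule: delay_induct)
  case (step j y)
  show ?case
  proof (cases "y \<le> T j")
    case True
    then show ?thesis using step by (simp add: delay_ext_initial)
  next
    case False
    then have "W k (y - T j) = delay_ext \<eta> k (y - T j)" for k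
      by (intro step(1)) (use step in auto)
    then show ?thesis using False step(3)[of j y] delay_ext_step[of j y \<eta>] by simp
  qed
qed

text \<open>A rate \<open>\<mu>\<close> with \<open>\<Sum>\<^sub>k |M\<^sub>j\<^sub>k| \<le> exp (\<mu> T\<^sub>j)\<close>, so that the bound \<open>K exp (\<mu> y)\<close> is preserved by the
  recursion.\<close>

definition growth_rate :: real where
  "growth_rate = (\<Sum>j\<in>UNIV. \<Sum>k\<in>UNIV. cmod (M j k)) / min_delay"

lemma growth_rate_nonneg: "growth_rate \<ge> 0"
  unfolding growth_rate_def using min_delay_pos by (intro divide_nonneg_pos sum_nonneg) auto

lemma row_sum_le_growth: "(\<Sum>k\<in>UNIV. cmod (M j k)) \<le> exp (growth_rate * T j)"
proof -
  have "(\<Sum>k\<in>UNIV. cmod (M j k)) \<le> (\<Sum>j\<in>UNIV. \<Sum>k\<in>UNIV. cmod (M j k))"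
    by (rule member_le_sum) (auto intro: sum_nonneg)
  also have "\<dots> = growth_rate * min_delay" using min_delay_pos by (simp add: growth_rate_def)
  also have "\<dots> \<le> growth_rate * T j" using min_delay_le growth_rate_nonneg by (intro mult_left_mono)
  also have "\<dots> \<le> exp (growth_rate * T j)" using exp_ge_add_one_self[of "growth_rate * T j"] by linarith
  finally show ?thesis .
qed

lemma delay_ext_bound:
  assumes "\<And>j y. \<lbrakk>0 \<le> y; y \<le> T j\<rbrakk> \<Longrightarrow> cmod (\<eta> j y) \<le> K" "0 \<le> y"
  shows "cmod (delay_ext \<eta> j y) \<le> K * exp (growth_rate * y)"
  using assms
proof (induction j y rule: delay_induct)
  case (step j y)
  have "cmod (\<eta> j 0) \<le> K" using step(2)[of 0 j] T_pos[of j] by simp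
  then have K: "K \<ge> 0" using norm_ge_zero order_trans by blast
  show ?case
  proof (cases "y \<le> T j")
    case True
    have "cmod (\<eta> j y) \<le> K * 1" using step True by simp
    also have "\<dots> \<le> K * exp (growth_rate * y)" using K growth_rate_nonneg \<open>0 \<le> y\<close> by (intro mult_left_mono) auto
    finally show ?thesis using True by (simp add: delay_ext_initial)
  next
    case False
    have IH: "cmod (delay_ext \<eta> k (y - T j)) \<le> K * exp (growth_rate * (y - T j))" for k
      by (rule step(1)) (use False step in auto)
    have "cmod (delay_ext \<eta> j y) \<le> (\<Sum>k\<in>UNIV. cmod (M j k * delay_ext \<eta> k (y - T j)))"
      using False by (simp add: delay_ext_step norm_sum)
    also have "\<dots> \<le> (\<Sum>k\<in>UNIV. cmod (M j k) * (K * exp (growth_rate * (y - T j))))"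
      by (intro sum_mono) (auto simp: norm_mult intro!: mult_left_mono IH)
    also have "\<dots> = (\<Sum>k\<in>UNIV. cmod (M j k)) * (K * exp (growth_rate * (y - T j)))"
      by (simp add: sum_distrib_right)
    also have "\<dots> \<le> exp (growth_rate * T j) * (K * exp (growth_rate * (y - T j)))"
      using row_sum_le_growth K by (intro mult_right_mono) auto
    also have "\<dots> = K * exp (growth_rate * y)" by (simp add: exp_diff right_diff_distrib)
    finally show ?thesis .
  qed
qed

text \<open>The compatibility condition makes the extension of \<open>\<eta>\<close> continuous at the breakpoints; its density solves the
  same delay system. At a breakpoint the density takes the value of the history, which is immaterial.\<close>

lemma primitive_delay_ext:
  assumes init: "\<And>j. is_primitive 0 (T j) (\<eta> j) (\<omega> j)"
    and compat: "\<And>j. \<eta> j (T j) = (\<Sum>k\<in>UNIV. M j k * \<eta> k 0)"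
  shows "is_primitive 0 N (delay_ext \<eta> j) (delay_ext \<omega> j)"
proof -
  have "is_primitive 0 (real n * min_delay) (delay_ext \<eta> j) (delay_ext \<omega> j)" for n j
  proof (induction n arbitrary: j)
    case 0
    have "is_primitive 0 (real 0 * min_delay) (\<eta> j) (\<omega> j)" by (rule primitive_subset[OF init]) (use T_pos[of j] in auto)
    then show ?case by (rule primitive_cong) (use T_pos[of j] in \<open>auto simp: delay_ext_initial\<close>)
  next
    case (Suc n)
    define N where "N = real (Suc n) * min_delay"
    show ?case
    proof (cases "N \<le> T j")
      case True
      have "is_primitive 0 N (\<eta> j) (\<omega> j)" by (rule primitive_subset[OF init]) (use True in auto)
      then show ?thesis
        unfolding N_def[symmetric] by (rule primitive_cong) (use True in \<open>auto simp: delay_ext_initial\<close>)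
    next
      case False
      define G where "G y = (\<Sum>k\<in>UNIV. M j k * delay_ext \<eta> k (- T j + y / 1))" for y
      define g where "g y = (\<Sum>k\<in>UNIV. M j k * (delay_ext \<omega> k (- T j + y / 1) / complex_of_real 1))" for y
      have "N - T j \<le> real n * min_delay" using min_delay_le[of j] by (simp add: N_def algebra_simps)
      then have G: "is_primitive (T j) N G g"
        unfolding G_def g_def by (intro primitive_sum primitive_cmult primitive_affine[OF Suc]) auto
      have "\<eta> j (T j) = G (T j)"
        using compat[of j] by (simp add: G_def delay_ext_initial less_imp_le[OF T_pos])
      from primitive_glue[OF init G this] have
        "is_primitive 0 N (\<lambda>x. if x \<le> T j then \<eta> j x else G x) (\<lambda>x. if x \<le> T j then \<omega> j x else g x)"
        using T_pos[of j] False by auto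
      then show ?thesis
        unfolding N_def[symmetric]
        by (rule primitive_cong) (auto simp: delay_ext_initial delay_ext_step G_def g_def)
    qed
  qed
  moreover obtain n where "N \<le> real n * min_delay"
    using reals_Archimedean3[OF min_delay_pos] less_imp_le by blast
  ultimately show ?thesis by (auto intro: primitive_subset)
qed

text \<open>Convergence of the antiderivatives passes from the history to the extension.\<close>

lemma delay_ext_integral_tendsto:
  assumes cont: "\<And>n N j. continuous_on {0..N} (delay_ext (\<eta> n) j)"
    and init: "\<And>j y. \<lbrakk>0 \<le> y; y \<le> T j\<rbrakk> \<Longrightarrow> ((\<lambda>n. integral {0..y} (\<eta> n j)) \<longlongrightarrow> 0) F"
    and "0 \<le> y"
  shows "((\<lambda>n. integral {0..y} (delay_ext (\<eta> n) j)) \<longlongrightarrow> 0) F"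
  using \<open>0 \<le> y\<close>
proof (induction j y rule: delay_induct)
  case (step j y)
  have low: "((\<lambda>n. integral {0..z} (delay_ext (\<eta> n) j)) \<longlongrightarrow> 0) F" if "0 \<le> z" "z \<le> T j" for z
  proof -
    have "integral {0..z} (delay_ext (\<eta> n) j) = integral {0..z} (\<eta> n j)" for n
      by (rule integral_cong) (use that in \<open>auto simp: delay_ext_initial\<close>)
    then show ?thesis using init[OF that] by simp
  qed
  show ?case
  proof (cases "y \<le> T j")
    case True
    then show ?thesis using low step by blast
  next
    case False
    have eq: "integral {0..y} (delay_ext (\<eta> n) j) = integral {0..T j} (delay_ext (\<eta> n) j)
        + (\<Sum>k\<in>UNIV. M j k * integral {0..y - T j} (delay_ext (\<eta> n) k))" for n
    proof -
      have i: "delay_ext (\<eta> n) k integrable_on {0..z}" for k z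
        by (intro integrable_continuous_real cont)
      have "((\<lambda>x. delay_ext (\<eta> n) k (x - T j)) has_integral integral {0..y - T j} (delay_ext (\<eta> n) k)) {T j..y}" for k
      proof -
        have "(delay_ext (\<eta> n) k has_integral integral {0..y - T j} (delay_ext (\<eta> n) k)) (cbox 0 (y - T j))"
          using integrable_integral[OF i] by simp
        from has_integral_affinity[OF this, of 1 "- T j"] show ?thesis by simp
      qed
      then have "((\<lambda>x. \<Sum>k\<in>UNIV. M j k * delay_ext (\<eta> n) k (x - T j)) has_integral
          (\<Sum>k\<in>UNIV. M j k * integral {0..y - T j} (delay_ext (\<eta> n) k))) {T j..y}"
        by (intro has_integral_sum has_integral_mult_right) auto
      then have "(delay_ext (\<eta> n) j has_integral
          (\<Sum>k\<in>UNIV. M j k * integral {0..y - T j} (delay_ext (\<eta> n) k))) {T j..y}"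
        by (rule has_integral_spike_finite[where S = "{T j}", rotated 2]) (auto simp: delay_ext_step)
      then have "integral {T j..y} (delay_ext (\<eta> n) j)
          = (\<Sum>k\<in>UNIV. M j k * integral {0..y - T j} (delay_ext (\<eta> n) k))"
        by (rule integral_unique)
      moreover have "integral {0..T j} (delay_ext (\<eta> n) j) + integral {T j..y} (delay_ext (\<eta> n) j)
          = integral {0..y} (delay_ext (\<eta> n) j)"
        by (rule Henstock_Kurzweil_Integration.integral_combine) (use False T_pos[of j] i in auto)
      ultimately show ?thesis by simp
    qed
    have "((\<lambda>n. M j k * integral {0..y - T j} (delay_ext (\<eta> n) k)) \<longlongrightarrow> 0) F" for k
      by (rule tendsto_mult_right_zero, rule step(1)) (use False in auto)
    then have "((\<lambda>n. integral {0..T j} (delay_ext (\<eta> n) j)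
        + (\<Sum>k\<in>UNIV. M j k * integral {0..y - T j} (delay_ext (\<eta> n) k))) \<longlongrightarrow> 0 + (\<Sum>k\<in>(UNIV :: 'm set). 0)) F"
      using T_pos[of j] by (intro tendsto_add low tendsto_sum) auto
    then show ?thesis by (simp add: eq)
  qed
qed

end

section \<open>Constancy along characteristics\<close>

text \<open>The value at a point is bounded by the mean value plus the oscillation.\<close>

lemma pointwise_le_if_mean_le:
  fixes g :: "real \<Rightarrow> complex"
  assumes "a < b" "x \<in> {a..b}" and cont: "continuous_on {a..b} g"
    and mean: "cmod (integral {a..b} g) \<le> C * (b - a)"
    and osc: "\<And>y. y \<in> {a..b} \<Longrightarrow> cmod (g x - g y) \<le> D"
  shows "cmod (g x) \<le> C + D"
proof -
  have "D \<ge> 0" using osc[OF assms(2)] by simp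
  have "((\<lambda>y. g x - g y) has_integral (b - a) *\<^sub>R g x - integral {a..b} g) (cbox a b)"
    using has_integral_diff[OF has_integral_const_real[of "g x" a b]
        integrable_integral[OF integrable_continuous_real[OF cont]]] \<open>a < b\<close> by simp
  from has_integral_bound[OF \<open>D \<ge> 0\<close> this] osc
  have "cmod ((b - a) *\<^sub>R g x - integral {a..b} g) \<le> D * (b - a)" using \<open>a < b\<close> by simp
  then have "cmod ((b - a) *\<^sub>R g x) \<le> (C + D) * (b - a)"
    using mean norm_triangle_sub[of "(b - a) *\<^sub>R g x" "integral {a..b} g"]
    by (simp add: algebra_simps)
  then show ?thesis using \<open>a < b\<close> by (simp add: mult.commute)
qed

lemma small_step:
  fixes L :: real
  assumes "e > 0" "L \<ge> 0" "\<delta> > 0"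
  obtains h where "0 < h" "h \<le> \<delta>" "2 * L * h \<le> e"
proof
  show "0 < min \<delta> (e / (2 * L + 1))" "min \<delta> (e / (2 * L + 1)) \<le> \<delta>" using assms by auto
  have "2 * L * min \<delta> (e / (2 * L + 1)) \<le> (2 * L + 1) * (e / (2 * L + 1))"
    using assms by (intro mult_mono) auto
  also have "\<dots> = e" using assms by simp
  finally show "2 * L * min \<delta> (e / (2 * L + 1)) \<le> e" .
qed

lemma vector_derivative_increment:
  fixes I :: "real \<Rightarrow> complex"
  assumes "\<And>t. t \<in> {0..N} \<Longrightarrow> (I has_vector_derivative D t) (at t within {0..N})"
    and "r \<in> {0..N}" "r' \<in> {0..N}" "r \<le> r'"
    and bd: "\<And>t. t \<in> {r..r'} \<Longrightarrow> cmod (D t - z) \<le> K"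
  shows "cmod (I r' - I r - (r' - r) *\<^sub>R z) \<le> K * (r' - r)"
proof -
  have "cmod (D r - z) \<le> K" by (rule bd) (use \<open>r \<le> r'\<close> in simp)
  then have "K \<ge> 0" using norm_ge_zero order_trans by blast
  have "(D has_integral (I r' - I r)) {r..r'}"
    by (rule fundamental_theorem_of_calculus)
      (use assms(2-4) in \<open>auto intro!: has_vector_derivative_within_subset[OF assms(1)]\<close>)
  then have "((\<lambda>t. D t - z) has_integral (I r' - I r - (r' - r) *\<^sub>R z)) (cbox r r')"
    using has_integral_diff[OF _ has_integral_const_real[of z r r']] \<open>r \<le> r'\<close> by simp
  from has_integral_bound[OF \<open>K \<ge> 0\<close> this] bd show ?thesis using \<open>r \<le> r'\<close> by simp
qed

text \<open>A weak solution of \<open>w\<^sub>t = c w\<^sub>x\<close> that is Lipschitz in \<open>x\<close> is constant along the characteristics.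
  Such a \<open>w\<close> need not be differentiable, but the integral over an interval that moves with the
  characteristics has quadratically small increments.\<close>

lemma transport_along_characteristics:
  fixes w :: "real \<Rightarrow> real \<Rightarrow> complex"
  assumes c: "c > 0"
    and lip: "\<And>t x y. \<lbrakk>t \<in> {0..N}; x \<in> {0..1}; y \<in> {0..1}\<rbrakk> \<Longrightarrow> cmod (w t x - w t y) \<le> L * \<bar>x - y\<bar>"
    and der: "\<And>a b t. \<lbrakk>0 \<le> a; a \<le> b; b \<le> 1; t \<in> {0..N}\<rbrakk> \<Longrightarrow>
      ((\<lambda>t. integral {a..b} (w t)) has_vector_derivative c * (w t b - w t a)) (at t within {0..N})"
    and "0 \<le> s" "s \<le> t" "t \<le> N" "0 \<le> x" "x + c * (t - s) \<le> 1"
  shows "w t x = w s (x + c * (t - s))"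
proof -
  have N: "0 \<le> N" using assms by linarith
  have "cmod (w 0 0 - w 0 1) \<le> L * \<bar>0 - 1\<bar>" by (rule lip) (use N in auto)
  then have L: "L \<ge> 0" using order_trans[OF norm_ge_zero] by fastforce
  have cont: "continuous_on S (w t)" if "t \<in> {0..N}" "S \<subseteq> {0..1}" for t S
  proof -
    have "L-lipschitz_on {0..1} (w t)"
      using lip[OF that(1)] L by (intro lipschitz_onI) (auto simp: dist_norm)
    then show ?thesis using lipschitz_on_continuous_on continuous_on_subset that(2) by blast
  qed
  have int: "w t integrable_on {a..b}" if "t \<in> {0..N}" "0 \<le> a" "b \<le> 1" for t a b
    by (intro integrable_continuous_real cont) (use that in auto)
  \<comment> \<open>The mass of a short interval varies with rate at most \<open>c L\<close> times its length; hence \<open>w\<close> is Lipschitz in time.\<close>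
  have time: "cmod (w r' x - w r x) \<le> c * L * (r' - r)"
    if r: "r \<in> {0..N}" "r' \<in> {0..N}" "r \<le> r'" and x: "x \<in> {0..1}" for r r' x
  proof (rule field_le_epsilon)
    fix e :: real assume "e > 0"
    obtain h where h: "0 < h" "h \<le> 1" "2 * L * h \<le> e"
      using small_step[OF \<open>e > 0\<close> L, of 1] by auto
    define a where "a = min x (1 - h)"
    have a: "0 \<le> a" "a + h \<le> 1" "x \<in> {a..a + h}" using h x by (auto simp: a_def)
    have "cmod (w r' x - w r x) \<le> c * L * (r' - r) + 2 * L * h"
    proof (rule pointwise_le_if_mean_le[where g = "\<lambda>x. w r' x - w r x"])
      show "a < a + h" "x \<in> {a..a + h}" using h a by auto
      show "continuous_on {a..a + h} (\<lambda>x. w r' x - w r x)"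
        by (intro continuous_intros cont) (use r a in auto)
      have "cmod (integral {a..a+h} (w r') - integral {a..a+h} (w r) - (r' - r) *\<^sub>R 0) \<le> (c * (L * h)) * (r' - r)"
      proof (rule vector_derivative_increment[OF der])
        fix t assume t: "t \<in> {r..r'}"
        have "cmod (w t (a + h) - w t a) \<le> L * \<bar>a + h - a\<bar>" using t r a h by (intro lip) auto
        then show "cmod (c * (w t (a + h) - w t a) - 0) \<le> c * (L * h)"
          using c h by (simp add: norm_mult)
      qed (use a h r in auto)
      moreover have "integral {a..a+h} (\<lambda>x. w r' x - w r x) = integral {a..a+h} (w r') - integral {a..a+h} (w r)"
        by (rule Henstock_Kurzweil_Integration.integral_diff) (use int r a in auto)
      ultimately have "cmod (integral {a..a+h} (\<lambda>x. w r' x - w r x)) \<le> (c * (L * h)) * (r' - r)"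
        by simp
      also have "\<dots> = c * L * (r' - r) * (a + h - a)" by (simp add: algebra_simps)
      finally show "cmod (integral {a..a+h} (\<lambda>x. w r' x - w r x)) \<le> c * L * (r' - r) * (a + h - a)" .
      fix y assume y: "y \<in> {a..a + h}"
      have "cmod (w r' x - w r' y) \<le> L * \<bar>x - y\<bar>" "cmod (w r x - w r y) \<le> L * \<bar>x - y\<bar>"
        using r x y a by (auto intro!: lip)
      moreover have "L * \<bar>x - y\<bar> \<le> L * h" using y a L by (intro mult_left_mono) auto
      ultimately show "cmod (w r' x - w r x - (w r' y - w r y)) \<le> 2 * L * h"
        using norm_triangle_ineq4[of "w r' x - w r' y" "w r x - w r y"] by (simp add: algebra_simps)
    qed
    then show "cmod (w r' x - w r x) \<le> c * L * (r' - r) + e" using h by linarith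
  qed
  have strict: "w t x = w s (x + c * (t - s))"
    if st: "0 \<le> s" "s \<le> t" "t \<le> N" "0 \<le> x" "x + c * (t - s) < 1" for s t x
  proof -
    define \<delta> where "\<delta> = 1 - (x + c * (t - s))"
    have const: "integral {x..x+h} (w t) = integral {x + c * (t - s)..x + h + c * (t - s)} (w s)"
      if h: "0 < h" "h \<le> \<delta>" for h
    proof -
      define \<alpha> where "\<alpha> r = x + c * (t - r)" for r
      have \<alpha>: "0 \<le> \<alpha> r" "\<alpha> r + h \<le> 1" if "r \<in> {s..t}" for r
      proof -
        have "0 \<le> c * (t - r)" "c * (t - r) \<le> c * (t - s)" using that c by auto
        then show "0 \<le> \<alpha> r" "\<alpha> r + h \<le> 1" using h st by (auto simp: \<alpha>_def \<delta>_def)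
      qed
      have "integral {\<alpha> t..\<alpha> t + h} (w t) = integral {\<alpha> s..\<alpha> s + h} (w s)"
      proof (rule constant_if_quadratic_increments[where H = "\<lambda>r. integral {\<alpha> r..\<alpha> r + h} (w r)"
            and a = s and b = t and K = "6 * c * c * L"])
        fix r r' assume r: "s \<le> r" "r \<le> r'" "r' \<le> t"
        define d where "d = r' - r"
        define a b a' b' where "a = \<alpha> r" and "b = \<alpha> r + h" and "a' = \<alpha> r'" and "b' = \<alpha> r' + h"
        have rN: "r \<in> {0..N}" "r' \<in> {0..N}" using r st by auto
        have d: "0 \<le> d" "a - a' = c * d" "b - b' = c * d"
          using r by (auto simp: d_def a_def a'_def b_def b'_def \<alpha>_def algebra_simps)
        have cd: "0 \<le> c * d" using c d by simp
        have ab: "0 \<le> a'" "a' \<le> a" "a \<le> b" "b \<le> 1" "a' \<le> b'" "b' \<le> b"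
          using \<alpha>[of r] \<alpha>[of r'] r h d cd by (auto simp: a_def a'_def b_def b'_def)
        \<comment> \<open>the time increment over the fixed window\<close>
        have i1: "cmod (integral {a..b} (w r') - integral {a..b} (w r) - d *\<^sub>R (c * (w r b - w r a)))
            \<le> (2 * (c * c * L) * d) * d"
          unfolding d_def
        proof (rule vector_derivative_increment[OF der])
          fix \<rho> assume \<rho>: "\<rho> \<in> {r..r'}"
          have "cmod (w \<rho> b - w r b) \<le> c * L * (\<rho> - r)" "cmod (w \<rho> a - w r a) \<le> c * L * (\<rho> - r)"
            using \<rho> rN ab by (auto intro!: time)
          moreover have "c * L * (\<rho> - r) \<le> c * L * (r' - r)" using \<rho> c L by (intro mult_left_mono) auto
          ultimately have "cmod ((w \<rho> b - w r b) - (w \<rho> a - w r a)) \<le> 2 * (c * L * (r' - r))"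
            using norm_triangle_ineq4[of "w \<rho> b - w r b" "w \<rho> a - w r a"] by linarith
          then have "c * cmod ((w \<rho> b - w r b) - (w \<rho> a - w r a)) \<le> c * (2 * (c * L * (r' - r)))"
            using c by (intro mult_left_mono) auto
          moreover have "cmod (c * (w \<rho> b - w \<rho> a) - c * (w r b - w r a)) = c * cmod ((w \<rho> b - w r b) - (w \<rho> a - w r a))"
          proof -
            have "c * (w \<rho> b - w \<rho> a) - c * (w r b - w r a) = c * ((w \<rho> b - w r b) - (w \<rho> a - w r a))"
              by (simp add: algebra_simps)
            then show ?thesis using c by (simp add: norm_mult)
          qed
          ultimately show "cmod (c * (w \<rho> b - w \<rho> a) - c * (w r b - w r a)) \<le> 2 * (c * c * L) * (r' - r)"
            by (simp add: algebra_simps)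
        qed (use ab rN r in auto)
        \<comment> \<open>the mass that crosses an endpoint \<open>z\<close> of the window\<close>
        have i2: "cmod (integral {z'..z} (w r') - (z - z') *\<^sub>R w r z) \<le> 2 * (c * c * L) * d * d"
          if z: "0 \<le> z'" "z' \<le> z" "z \<le> 1" "z - z' = c * d" for z z'
        proof -
          have "((\<lambda>y. w r' y - w r z) has_integral (integral {z'..z} (w r') - (z - z') *\<^sub>R w r z)) (cbox z' z)"
            using has_integral_diff[OF integrable_integral[OF int[of r' z' z]] has_integral_const_real[of "w r z" z' z]]
              z rN by simp
          moreover have "0 \<le> 2 * (c * L * d)" using c L d by simp
          moreover have "cmod (w r' y - w r z) \<le> 2 * (c * L * d)" if y: "y \<in> cbox z' z" for y
          proof -
            have "cmod (w r' y - w r' z) \<le> L * \<bar>y - z\<bar>" using y z rN by (intro lip) auto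
            also have "\<dots> \<le> L * (c * d)" using y z L by (intro mult_left_mono) auto
            finally have "cmod (w r' y - w r' z) \<le> L * (c * d)" .
            moreover have "cmod (w r' z - w r z) \<le> c * L * d"
              unfolding d_def using z rN r by (intro time) auto
            ultimately show ?thesis
              using norm_triangle_ineq[of "w r' y - w r' z" "w r' z - w r z"] by (simp add: algebra_simps)
          qed
          ultimately have "cmod (integral {z'..z} (w r') - (z - z') *\<^sub>R w r z)
              \<le> 2 * (c * L * d) * measure lborel (cbox z' z)"
            using has_integral_bound by blast
          then show ?thesis using z by (simp add: algebra_simps)
        qed
        have tri: "cmod (z\<^sub>1 + z\<^sub>2 - z\<^sub>3) \<le> cmod z\<^sub>1 + cmod z\<^sub>2 + cmod z\<^sub>3" for z\<^sub>1 z\<^sub>2 z\<^sub>3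
          using norm_triangle_ineq[of z\<^sub>1 z\<^sub>2] norm_triangle_ineq4[of "z\<^sub>1 + z\<^sub>2" z\<^sub>3] by linarith
        have "integral {a'..a} (w r') + integral {a..b} (w r') = integral {a'..b} (w r')"
          "integral {a'..b'} (w r') + integral {b'..b} (w r') = integral {a'..b} (w r')"
          by (rule Henstock_Kurzweil_Integration.integral_combine; use ab int rN in auto)+
        then have "integral {a'..b'} (w r') - integral {a..b} (w r)
           = (integral {a..b} (w r') - integral {a..b} (w r) - d *\<^sub>R (c * (w r b - w r a)))
             + (integral {a'..a} (w r') - (a - a') *\<^sub>R w r a)
             - (integral {b'..b} (w r') - (b - b') *\<^sub>R w r b)"
          using d(2,3) by (simp add: algebra_simps scaleR_conv_of_real)
        then have "cmod (integral {a'..b'} (w r') - integral {a..b} (w r)) \<le>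
            cmod (integral {a..b} (w r') - integral {a..b} (w r) - d *\<^sub>R (c * (w r b - w r a)))
             + cmod (integral {a'..a} (w r') - (a - a') *\<^sub>R w r a)
             + cmod (integral {b'..b} (w r') - (b - b') *\<^sub>R w r b)"
          by (simp only: tri)
        also have "\<dots> \<le> 2 * (c * c * L) * d * d + 2 * (c * c * L) * d * d + 2 * (c * c * L) * d * d"
          using ab d by (intro add_mono i1 i2) auto
        finally show "norm (integral {\<alpha> r'..\<alpha> r' + h} (w r') - integral {\<alpha> r..\<alpha> r + h} (w r))
            \<le> 6 * c * c * L * (r' - r)\<^sup>2"
          by (simp add: a_def b_def a'_def b'_def d_def power2_eq_square algebra_simps)
      qed (use st in auto)
      then show ?thesis by (simp add: \<alpha>_def add_ac)
    qed
    have "\<delta> > 0" using st by (simp add: \<delta>_def)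
    have "cmod (w t x - w s (x + c * (t - s))) \<le> 0"
    proof (rule field_le_epsilon)
      fix e :: real assume "e > 0"
      obtain h where h: "0 < h" "h \<le> \<delta>" "2 * L * h \<le> e"
        using small_step[OF \<open>e > 0\<close> L \<open>\<delta> > 0\<close>] by blast
      have cts: "0 \<le> c * (t - s)" using c st by simp
      have tN: "t \<in> {0..N}" "s \<in> {0..N}" using st by auto
      have xh: "x + h + c * (t - s) \<le> 1" using h by (simp add: \<delta>_def)
      let ?g = "\<lambda>y. w t y - w s (y + c * (t - s))"
      have shift: "((\<lambda>y. w s (y + c * (t - s))) has_integral
          integral {x + c * (t - s)..x + h + c * (t - s)} (w s)) {x..x+h}"
      proof -
        have "(w s has_integral integral {x + c * (t - s)..x + h + c * (t - s)} (w s))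
            (cbox (x + c * (t - s)) (x + h + c * (t - s)))"
          using integrable_integral[OF int[OF tN(2)]] st xh cts by simp
        from has_integral_affinity[OF this, of 1 "c * (t - s)"] show ?thesis by simp
      qed
      have "cmod (?g x) \<le> 0 + 2 * L * h"
      proof (rule pointwise_le_if_mean_le[where g = ?g and a = x and b = "x + h"])
        show "continuous_on {x..x + h} ?g"
          by (intro continuous_intros cont[OF tN(1)] continuous_on_compose2[OF cont[OF tN(2), of "{0..1}"]])
            (use st cts xh in auto)
        have "integral {x..x+h} ?g = integral {x..x+h} (w t) - integral {x..x+h} (\<lambda>y. w s (y + c * (t - s)))"
          by (rule Henstock_Kurzweil_Integration.integral_diff)
            (use int[OF tN(1)] shift st xh cts in \<open>auto simp: integrable_on_def\<close>)
        then show "cmod (integral {x..x + h} ?g) \<le> 0 * (x + h - x)"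
          using const[OF h(1,2)] integral_unique[OF shift] by simp
        fix y assume y: "y \<in> {x..x+h}"
        have "cmod (w t x - w t y) \<le> L * \<bar>x - y\<bar>"
          using tN y st cts xh by (intro lip) auto
        moreover have "cmod (w s (x + c * (t - s)) - w s (y + c * (t - s))) \<le> L * \<bar>x + c * (t - s) - (y + c * (t - s))\<bar>"
          using tN y st cts xh by (intro lip) auto
        moreover have "L * \<bar>x - y\<bar> \<le> L * h" using y L by (intro mult_left_mono) auto
        ultimately show "cmod (?g x - ?g y) \<le> 2 * L * h"
          using norm_triangle_ineq4[of "w t x - w t y" "w s (x + c * (t - s)) - w s (y + c * (t - s))"]
          by (simp add: algebra_simps)
      qed (use h in auto)
      then show "cmod (w t x - w s (x + c * (t - s))) \<le> 0 + e" using h by simp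
    qed
    then show ?thesis by simp
  qed
  show ?thesis
  proof (cases "x + c * (t - s) < 1 \<or> s = t")
    case True
    then show ?thesis using strict assms by auto
  next
    case False
    then have eq: "x + c * (t - s) = 1" "s < t" using assms by auto
    \<comment> \<open>A characteristic that meets \<open>x = 1\<close> is the limit of shorter ones that stay below \<open>1\<close>.\<close>
    have "cmod (w t x - w s 1) \<le> 0"
    proof (rule field_le_epsilon)
      fix e :: real assume "e > 0"
      have "0 \<le> c * L" "0 < t - s" using c L eq by auto
      then obtain d where d: "0 < d" "d \<le> t - s" "2 * (c * L) * d \<le> e"
        using small_step[OF \<open>e > 0\<close>] by blast
      have y: "x + c * (t - d - s) = 1 - c * d" using eq(1) by (simp add: algebra_simps)
      have cd: "0 < c * d" "c * d \<le> c * (t - s)" using c d by auto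
      have e1: "w (t - d) x = w s (1 - c * d)"
        using strict[of s "t - d" x] assms d cd y by simp
      have cd1: "c * d \<le> 1" using eq(1) \<open>0 \<le> x\<close> cd(2) by linarith
      have "x \<in> {0..1}" using eq(1) \<open>0 \<le> x\<close> cd by auto
      then have "cmod (w t x - w (t - d) x) \<le> c * L * (t - (t - d))"
        using assms d by (intro time) auto
      moreover have "cmod (w s (1 - c * d) - w s 1) \<le> L * \<bar>1 - c * d - 1\<bar>"
        using assms(4-6) cd(1) cd1 by (intro lip) auto
      moreover have "\<bar>1 - c * d - 1\<bar> = c * d" using cd by simp
      moreover have "w t x - w s 1 = (w t x - w (t - d) x) + (w s (1 - c * d) - w s 1)"
        by (simp add: e1)
      moreover have "cmod ((w t x - w (t - d) x) + (w s (1 - c * d) - w s 1)) \<le>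
          cmod (w t x - w (t - d) x) + cmod (w s (1 - c * d) - w s 1)"
        by (rule norm_triangle_ineq)
      ultimately have "cmod (w t x - w s 1) \<le> 2 * (c * L) * d"
        by (simp add: mult_ac)
      then show "cmod (w t x - w s 1) \<le> 0 + e" using d by linarith
    qed
    then show ?thesis by (simp add: eq)
  qed
qed

section \<open>Weak* derivatives and weighted pairings\<close>

lemma has_vector_derivative_iff_quotient:
  fixes f :: "real \<Rightarrow> 'a::real_normed_vector"
  shows "(f has_vector_derivative D) (at x within S) \<longleftrightarrow>
    ((\<lambda>r. (f r - f x) /\<^sub>R (r - x)) \<longlongrightarrow> D) (at x within S)"
proof -
  have "norm ((1 / norm (r - x)) *\<^sub>R (f r - (f x + (r - x) *\<^sub>R D))) = norm ((f r - f x) /\<^sub>R (r - x) - D)"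
    if "r \<noteq> x" for r
  proof -
    have "(f r - f x) /\<^sub>R (r - x) - D = (1 / (r - x)) *\<^sub>R (f r - (f x + (r - x) *\<^sub>R D))"
      using that by (simp add: scaleR_diff_right scaleR_add_right inverse_eq_divide)
    then show ?thesis by (simp only: norm_scaleR) simp
  qed
  then have "((\<lambda>r. norm ((1 / norm (r - x)) *\<^sub>R (f r - (f x + (r - x) *\<^sub>R D)))) \<longlongrightarrow> 0) (at x within S) \<longleftrightarrow>
      ((\<lambda>r. norm ((f r - f x) /\<^sub>R (r - x) - D)) \<longlongrightarrow> 0) (at x within S)"
    by (intro tendsto_cong) (auto simp: eventually_at_filter)
  then show ?thesis
    unfolding has_vector_derivative_def has_derivative_within tendsto_norm_zero_iff
    by (simp add: bounded_linear_scaleR_left Lim_null[of _ D])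
qed

lemma at_within_halfline: "at t within {0..t + 1} = at t within {0..}" for t :: real
proof -
  have "at t within {0..} = at t within ({0..} \<inter> {..<t+1})"
    by (rule at_within_nhd[of t "{..<t+1}"]) auto
  also have "\<dots> = at t within {0..t+1}"
    by (rule at_within_nhd[of t "{..<t+1}"]) auto
  finally show ?thesis by simp
qed

lemma X_space_quotient:
  fixes f g :: "real \<Rightarrow> complex^'m"
  assumes "f \<in> X_space" "g \<in> X_space"
  shows "(\<lambda>s. (f s - g s) /\<^sub>R r) \<in> X_space"
proof -
  obtain K where K: "\<And>j. (\<lambda>s. f s $ j) \<in> borel_measurable I01" "\<And>j. AE s in I01. cmod (f s $ j) \<le> K"
    by (rule X_space_component[OF assms(1)]) blast
  obtain L where L: "\<And>j. (\<lambda>s. g s $ j) \<in> borel_measurable I01" "\<And>j. AE s in I01. cmod (g s $ j) \<le> L"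
    by (rule X_space_component[OF assms(2)]) blast
  show ?thesis
  proof (rule X_spaceI)
    show "(\<lambda>s. ((f s - g s) /\<^sub>R r) $ j) \<in> borel_measurable I01" for j
      using K(1)[of j] L(1)[of j] by simp
    show "AE s in I01. cmod (((f s - g s) /\<^sub>R r) $ j) \<le> \<bar>inverse r\<bar> * (K + L)" for j
      using K(2)[of j] L(2)[of j]
    proof eventually_elim
      case (elim s)
      have "cmod (((f s - g s) /\<^sub>R r) $ j) = \<bar>inverse r\<bar> * cmod (f s $ j - g s $ j)" by simp
      also have "\<dots> \<le> \<bar>inverse r\<bar> * (K + L)"
        using elim norm_triangle_ineq4[of "f s $ j" "g s $ j"] by (intro mult_left_mono) auto
      finally show ?case .
    qed
  qed
qed

lemma pairing_quotient:
  fixes f g :: "real \<Rightarrow> complex^'m"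
  assumes fg: "f \<in> X_space" "g \<in> X_space" and h: "integrable I01 h"
  shows "pairing (\<lambda>s. (f s - g s) /\<^sub>R r) h = (pairing f h - pairing g h) /\<^sub>R r"
proof -
  have i: "integrable I01 (\<lambda>s. f s $ j * h s $ j)" "integrable I01 (\<lambda>s. g s $ j * h s $ j)" for j
    using X_space_mult_integrable[OF _ integrable_vec_component[OF h]] fg by auto
  have comp: "(LINT s|I01. ((f s - g s) /\<^sub>R r) $ j * h s $ j)
      = ((LINT s|I01. f s $ j * h s $ j) - (LINT s|I01. g s $ j * h s $ j)) /\<^sub>R r" for j
  proof -
    have "(LINT s|I01. ((f s - g s) /\<^sub>R r) $ j * h s $ j)
        = (LINT s|I01. (f s $ j * h s $ j - g s $ j * h s $ j) /\<^sub>R r)"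
      by (simp add: algebra_simps)
    then show ?thesis using i[of j] by simp
  qed
  have "pairing (\<lambda>s. (f s - g s) /\<^sub>R r) h =
      (\<Sum>j\<in>UNIV. ((LINT s|I01. f s $ j * h s $ j) - (LINT s|I01. g s $ j * h s $ j)) /\<^sub>R r)"
    by (simp only: pairing_eq_sum[OF X_space_quotient[OF fg] h] comp)
  also have "\<dots> = (pairing f h - pairing g h) /\<^sub>R r"
    by (simp only: pairing_eq_sum[OF fg(1) h] pairing_eq_sum[OF fg(2) h]
      scaleR_sum_right[symmetric] sum_subtractf)
  finally show ?thesis .
qed

lemma has_weak_star_deriv_iff:
  fixes u :: "real \<Rightarrow> real \<Rightarrow> complex^'m"
  assumes u: "\<And>t. t \<ge> 0 \<Longrightarrow> u t \<in> X_space" and t: "t \<ge> 0"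
  shows "has_weak_star_deriv u d t \<longleftrightarrow> d \<in> X_space \<and>
    (\<forall>g. integrable I01 g \<longrightarrow>
      ((\<lambda>r. pairing (u r) g) has_vector_derivative pairing d g) (at t within {0..}))"
proof -
  have ev: "\<forall>\<^sub>F r in at t within {0..}. r \<ge> 0" by (simp add: eventually_at_filter)
  then have X: "\<forall>\<^sub>F r in at t within {0..}. (\<lambda>s. (u r s - u t s) /\<^sub>R (r - t)) \<in> X_space"
    by eventually_elim (use u t X_space_quotient in blast)
  have "((\<lambda>r. pairing (\<lambda>s. (u r s - u t s) /\<^sub>R (r - t)) g) \<longlongrightarrow> pairing d g) (at t within {0..}) \<longleftrightarrow>
      ((\<lambda>r. (pairing (u r) g - pairing (u t) g) /\<^sub>R (r - t)) \<longlongrightarrow> pairing d g) (at t within {0..})"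
    if g: "integrable I01 g" for g
    by (intro tendsto_cong eventually_mono[OF ev] pairing_quotient u t g)
  then show ?thesis
    unfolding has_weak_star_deriv_def limitin_weak_star_iff[OF X] has_vector_derivative_iff_quotient
    by blast
qed

lemma eventually_prod_principal:
  "eventually P (F \<times>\<^sub>F principal K) \<longleftrightarrow> (\<forall>\<^sub>F n in F. \<forall>t\<in>K. P (n, t))"
proof
  assume "eventually P (F \<times>\<^sub>F principal K)"
  then obtain P1 P2 where P: "eventually P1 F" "\<forall>t\<in>K. P2 t" "\<And>n t. P1 n \<Longrightarrow> P2 t \<Longrightarrow> P (n, t)"
    by (auto simp: eventually_prod_filter eventually_principal)
  show "\<forall>\<^sub>F n in F. \<forall>t\<in>K. P (n, t)" using P(1) by eventually_elim (use P in auto)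
next
  assume "\<forall>\<^sub>F n in F. \<forall>t\<in>K. P (n, t)"
  then show "eventually P (F \<times>\<^sub>F principal K)"
    unfolding eventually_prod_filter
    by (intro exI[of _ "\<lambda>n. \<forall>t\<in>K. P (n, t)"] exI[of _ "\<lambda>t. t \<in> K"]) (auto simp: eventually_principal)
qed

text \<open>Weak* convergence of a bounded family may be tested on intervals after multiplication with
  continuous weights without zeros.\<close>

lemma pairing_tendsto_if_weighted_intervals:
  fixes \<phi> :: "'i \<Rightarrow> real \<Rightarrow> complex^'m"
  assumes \<rho>: "\<And>j. continuous_on {0..1} (\<rho> j)" "\<And>j x. \<rho> j x \<noteq> (0::complex)"
    and d: "d \<in> X_space" and X: "\<forall>\<^sub>F i in F. \<phi> i \<in> X_space"
    and bd: "\<forall>\<^sub>F i in F. \<forall>j. AE x in I01. cmod (\<rho> j x * (\<phi> i x $ j - d x $ j)) \<le> K"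
    and int: "\<And>j a b. \<lbrakk>0 \<le> a; a \<le> b; b \<le> 1\<rbrakk> \<Longrightarrow>
      ((\<lambda>i. LINT x|I01. (\<rho> j x * (\<phi> i x $ j - d x $ j)) * indicator {a..b} x) \<longlongrightarrow> 0) F"
    and g: "integrable I01 g"
  shows "((\<lambda>i. pairing (\<phi> i) g) \<longlongrightarrow> pairing d g) F"
proof -
  have \<rho>inv: "integrable I01 (\<lambda>x. inverse (\<rho> j x) * g x $ j)" for j
  proof -
    have c: "continuous_on {0..1} (\<lambda>x. inverse (\<rho> j x))" using \<rho> by (intro continuous_intros) auto
    obtain R where "\<And>x. x \<in> {0..1} \<Longrightarrow> cmod (inverse (\<rho> j x)) \<le> R"
      using continuous_bounded_measurable(2)[OF c] unfolding bounded_iff by blast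
    then show ?thesis
      by (intro integrable_mult_bounded_I01[where K = R] continuous_bounded_measurable(1)[OF c]
        integrable_vec_component[OF g]) auto
  qed
  have lim: "((\<lambda>i. LINT x|I01. (\<rho> j x * (\<phi> i x $ j - d x $ j)) * (inverse (\<rho> j x) * g x $ j)) \<longlongrightarrow> 0) F" for j
  proof (rule tendsto_pairing_if_intervals[OF _ int \<rho>inv])
    show "\<forall>\<^sub>F i in F. (\<lambda>x. \<rho> j x * (\<phi> i x $ j - d x $ j)) \<in> borel_measurable I01 \<and>
        (AE x in I01. cmod (\<rho> j x * (\<phi> i x $ j - d x $ j)) \<le> K)"
      using X bd
    proof eventually_elim
      case (elim i)
      have "(\<lambda>x. \<phi> i x $ j) \<in> borel_measurable I01" "(\<lambda>x. d x $ j) \<in> borel_measurable I01"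
        using elim(1) d by (auto intro!: borel_measurable_vec_component simp: Linf_def)
      then show ?case using elim(2) continuous_bounded_measurable(1)[OF \<rho>(1)[of j]] by auto
    qed
  qed auto
  have "((\<lambda>i. \<Sum>j\<in>UNIV. LINT x|I01. (\<rho> j x * (\<phi> i x $ j - d x $ j)) * (inverse (\<rho> j x) * g x $ j))
      \<longlongrightarrow> (\<Sum>j\<in>(UNIV::'m set). 0)) F"
    by (intro tendsto_sum lim)
  moreover have "\<forall>\<^sub>F i in F. (\<Sum>j\<in>UNIV. LINT x|I01. (\<rho> j x * (\<phi> i x $ j - d x $ j)) * (inverse (\<rho> j x) * g x $ j))
      = pairing (\<phi> i) g - pairing d g"
    using X
  proof eventually_elim
    case (elim i)
    have "(LINT x|I01. (\<rho> j x * (\<phi> i x $ j - d x $ j)) * (inverse (\<rho> j x) * g x $ j))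
        = (LINT x|I01. \<phi> i x $ j * g x $ j) - (LINT x|I01. d x $ j * g x $ j)" for j
    proof -
      have "(\<rho> j x * (\<phi> i x $ j - d x $ j)) * (inverse (\<rho> j x) * g x $ j)
          = \<phi> i x $ j * g x $ j - d x $ j * g x $ j" for x
        using \<rho>(2)[of j x] by (simp add: field_simps)
      then show ?thesis
        using X_space_mult_integrable[OF elim integrable_vec_component[OF g]]
          X_space_mult_integrable[OF d integrable_vec_component[OF g]] by simp
    qed
    then show ?case using pairing_eq_sum[OF elim g] pairing_eq_sum[OF d g] by (simp add: sum_subtractf)
  qed
  ultimately have "((\<lambda>i. pairing (\<phi> i) g - pairing d g) \<longlongrightarrow> 0) F"
    using Lim_transform_eventually by fastforce
  then show ?thesis by (simp add: Lim_null[of _ "pairing d g"])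
qed

lemma LINT_norm_weighted_indicator:
  fixes e :: "real \<Rightarrow> complex"
  assumes e: "continuous_on {0..1} e" "\<And>x. x \<in> {0..1} \<Longrightarrow> cmod (e x) \<le> R"
    and ab: "0 \<le> a" "a \<le> b" "b \<le> 1"
  shows "integrable I01 (\<lambda>x. e x * indicator {a..b} x)"
    "(LINT x|I01. cmod (e x * indicator {a..b} x)) \<le> R * (b - a)"
proof -
  show i: "integrable I01 (\<lambda>x. e x * indicator {a..b} x)"
    by (rule integrable_mult_bounded_I01[where K = R])
      (use e continuous_bounded_measurable(1)[OF e(1)] integrable_indicator_interval in auto)
  have ind: "indicat_real {a..b} \<in> borel_measurable I01"
    by (rule measurable_restrict_space1, rule borel_measurable_indicator) simp
  have ri: "integrable I01 (indicat_real {a..b})"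
    by (rule finite_measure.integrable_const_bound[OF finite_measure_I01 _ ind, where B = 1])
      (auto simp: indicator_def)
  have "(LINT x|I01. cmod (e x * indicator {a..b} x)) \<le> (LINT x|I01. R * indicat_real {a..b} x)"
  proof (rule integral_mono)
    fix x assume "x \<in> space I01"
    then show "cmod (e x * indicator {a..b} x) \<le> R * indicat_real {a..b} x"
      using e(2)[of x] by (simp add: indicator_def)
  qed (use i ri in auto)
  also have "\<dots> = R * (LINT x|I01. indicat_real {a..b} x)" by simp
  also have "(LINT x|I01. indicat_real {a..b} x) = measure I01 ({a..b} \<inter> {0..1})"
    by simp
  also have "\<dots> = b - a"
    using ab by (simp add: measure_restrict_space Int_absorb2)
  finally show "(LINT x|I01. cmod (e x * indicator {a..b} x)) \<le> R * (b - a)" .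
qed

section \<open>The explicit solution\<close>

text \<open>The flow problem with boundary matrix \<open>B\<close>, together with bounded functions \<open>p\<^sub>j = q\<^sub>j / c\<^sub>j\<close> (almost
  everywhere) and their antiderivatives \<open>Q\<^sub>j\<close>, the exponents of the gauge transformation.\<close>

locale flow_problem =
  fixes c :: "'m::finite \<Rightarrow> real" and q :: "'m \<Rightarrow> real \<Rightarrow> complex" and B :: "complex^'m^'m"
    and Q p :: "'m \<Rightarrow> real \<Rightarrow> complex"
  assumes c_pos: "c j > 0"
    and Q_primitive: "is_primitive 0 1 (Q j) (p j)" and Q_0: "Q j 0 = 0"
    and q_eq: "AE x in I01. q j x = c j * p j x"
begin

sublocale delay_system "\<lambda>j. 1 / c j" "\<lambda>j k. exp (Q j 1) * B $ j $ k"
  by unfold_locales (simp add: c_pos)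

text \<open>The history of the delay system: the gauge transform of \<open>f\<close>, with \<open>x = c\<^sub>j y\<close>.\<close>

definition history :: "(real \<Rightarrow> complex^'m) \<Rightarrow> 'm \<Rightarrow> real \<Rightarrow> complex" where
  "history f j y = exp (Q j (c j * y)) * cont_rep f (c j * y) $ j"

text \<open>The solution with initial value \<open>f\<close>.\<close>

definition flow_solution :: "(real \<Rightarrow> complex^'m) \<Rightarrow> real \<Rightarrow> real \<Rightarrow> complex^'m" where
  "flow_solution f t x = (\<chi> j. exp (- Q j x) * delay_ext (history f) j (t + x / c j))"

lemma exp_Q_primitive: "is_primitive 0 1 (\<lambda>x. exp (Q j x)) (\<lambda>x. p j x * exp (Q j x))"
  by (rule primitive_exp[OF Q_primitive])

lemma exp_minus_Q_primitive: "is_primitive 0 1 (\<lambda>x. exp (- Q j x)) (\<lambda>x. - p j x * exp (- Q j x))"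
  using primitive_exp[OF primitive_cmult[OF Q_primitive, of "-1" j]] by simp

lemma exp_Q_continuous: "continuous_on {0..1} (\<lambda>x. exp (Q j x))"
  by (rule primitive_continuous[OF exp_Q_primitive])

lemma exp_Q_bound: obtains R where "R \<ge> 0" "\<And>j x. x \<in> {0..1} \<Longrightarrow> cmod (exp (Q j x)) \<le> R"
    "\<And>j x. x \<in> {0..1} \<Longrightarrow> cmod (exp (- Q j x)) \<le> R"
proof -
  have "\<exists>R. \<forall>x\<in>{0..1}. cmod (exp (Q j x)) \<le> R \<and> cmod (exp (- Q j x)) \<le> R" for j
  proof -
    obtain R1 where 1: "\<forall>x\<in>{0..1}. cmod (exp (Q j x)) \<le> R1"
      using continuous_bounded_measurable(2)[OF exp_Q_continuous] unfolding bounded_iff by blast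
    obtain R2 where 2: "\<forall>x\<in>{0..1}. cmod (exp (- Q j x)) \<le> R2"
      using continuous_bounded_measurable(2)[OF primitive_continuous[OF exp_minus_Q_primitive]] unfolding bounded_iff by blast
    show ?thesis using 1 2 by (intro exI[of _ "max R1 R2"]) (auto simp: le_max_iff_disj)
  qed
  then obtain R where R: "\<And>j x. x \<in> {0..1} \<Longrightarrow> cmod (exp (Q j x)) \<le> R j \<and> cmod (exp (- Q j x)) \<le> R j"
    by metis
  have R0: "0 \<le> R j" for j
    using R[of 0 j] order_trans[OF norm_ge_zero[of "exp (Q j 0)"]] by simp
  have le: "R j \<le> (\<Sum>j\<in>UNIV. R j)" for j by (rule member_le_sum) (use R0 in auto)
  show thesis
  proof
    show "0 \<le> (\<Sum>j\<in>UNIV. R j)" by (simp add: sum_nonneg R0)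
    show "cmod (exp (Q j x)) \<le> (\<Sum>j\<in>UNIV. R j)" "cmod (exp (- Q j x)) \<le> (\<Sum>j\<in>UNIV. R j)"
      if "x \<in> {0..1}" for j x
      using R[OF that, of j] le[of j] by linarith+
  qed
qed

text \<open>The gauge transformation removes the potential: \<open>c\<^sub>j (exp Q\<^sub>j f\<^sub>j)' = exp Q\<^sub>j (A f)\<^sub>j\<close>.\<close>

lemma W1inf_gauge:
  assumes "f \<in> W1inf"
  obtains k :: "'m \<Rightarrow> real \<Rightarrow> complex"
    where "\<And>j. is_primitive 0 1 (\<lambda>x. exp (Q j x) * cont_rep f x $ j) (k j)"
    "\<And>j. AE x in I01. c j * k j x = exp (Q j x) * flow_operator c q f x $ j"
    "ae_eq (cont_rep f) f"
proof -
  obtain g where g: "\<And>j. is_primitive 0 1 (\<lambda>x. cont_rep f x $ j) (g j)"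
    "\<And>j. AE s in I01. weak_deriv f s $ j = g j s" "ae_eq (cont_rep f) f"
    by (rule W1inf_cont_rep[OF assms]) blast
  show thesis
  proof
    show "is_primitive 0 1 (\<lambda>x. exp (Q j x) * cont_rep f x $ j)
        (\<lambda>x. p j x * exp (Q j x) * cont_rep f x $ j + exp (Q j x) * g j x)" for j
      by (rule primitive_mult[OF exp_Q_primitive g(1)])
    show "AE x in I01. c j * (p j x * exp (Q j x) * cont_rep f x $ j + exp (Q j x) * g j x)
        = exp (Q j x) * flow_operator c q f x $ j" for j
      using g(2)[of j] g(3)[unfolded ae_eq_def] q_eq[of j]
      by eventually_elim (simp add: flow_operator_def algebra_simps)
  qed (rule g(3))
qed

lemma history_primitive:
  assumes "f \<in> W1inf"
  obtains \<omega> where "\<And>j. is_primitive 0 (1 / c j) (history f j) (\<omega> j)"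
proof -
  obtain k where k: "\<And>j. is_primitive 0 1 (\<lambda>x. exp (Q j x) * cont_rep f x $ j) (k j)"
    by (rule W1inf_gauge[OF assms]) blast
  have "is_primitive 0 (1 / c j) (history f j) (\<lambda>y. k j (0 + y / (1 / c j)) / complex_of_real (1 / c j))" for j
    by (rule primitive_cong[OF primitive_affine[OF k, of "1 / c j" 0 0 "1 / c j" j]])
      (use c_pos[of j] in \<open>auto simp: history_def mult.commute\<close>)
  then show thesis by (rule that)
qed

lemma history_compat:
  assumes "f \<in> flow_domain B"
  shows "history f j (1 / c j) = (\<Sum>k\<in>UNIV. exp (Q j 1) * B $ j $ k * history f k 0)"
proof -
  have "cont_rep f 1 $ j = (\<Sum>k\<in>UNIV. B $ j $ k * cont_rep f 0 $ k)"
    using assms by (simp add: flow_domain_def matrix_vector_mult_def)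
  then show ?thesis
    using c_pos[of j] by (simp add: history_def Q_0 sum_distrib_left mult.assoc)
qed

lemma ext_primitive:
  assumes "f \<in> flow_domain B"
  obtains \<omega> where "\<And>N j. is_primitive 0 N (delay_ext (history f) j) (\<omega> j)"
proof -
  obtain \<omega> where \<omega>: "\<And>j. is_primitive 0 (1 / c j) (history f j) (\<omega> j)"
    by (rule history_primitive[of f]) (use assms in \<open>auto simp: flow_domain_def\<close>)
  have "is_primitive 0 N (delay_ext (history f) j) (delay_ext \<omega> j)" for N j
    by (rule primitive_delay_ext[OF \<omega> history_compat[OF assms]])
  then show thesis by (rule that)
qed

lemma ext_step:
  assumes "f \<in> flow_domain B" "t \<ge> 0"
  shows "delay_ext (history f) j (t + 1 / c j) = (\<Sum>k\<in>UNIV. exp (Q j 1) * B $ j $ k * delay_ext (history f) k t)"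
proof (cases "t = 0")
  case True
  then show ?thesis
    using history_compat[OF assms(1), of j] c_pos by (simp add: delay_ext_initial less_imp_le)
next
  case False
  then show ?thesis using assms(2) by (subst delay_ext_step) auto
qed

lemma flow_solution_gauge: "exp (Q j x) * flow_solution f t x $ j = delay_ext (history f) j (t + x / c j)"
  by (simp add: flow_solution_def exp_minus)

section \<open>Solutions are explicit\<close>

text \<open>For a solution \<open>u\<close>, the gauge transform \<open>w\<close> of \<open>u t\<close> satisfies the hypotheses of the transport lemma; hence
  its values at \<open>x = 0\<close> solve the delay system, and they determine \<open>u\<close>.\<close>

lemma solution_eq_flow_solution:
  assumes f: "f \<in> flow_domain B" and u: "is_solution (flow_domain B) (flow_operator c q) f u"
    and "t \<ge> 0"
  shows "ae_eq (u t) (flow_solution f t)"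
proof -
  obtain v where uD: "\<And>t. t \<ge> 0 \<Longrightarrow> u t \<in> flow_domain B" and u0: "ae_eq (u 0) f" and Bu: "B_loc u"
    and v: "\<And>t. t \<ge> 0 \<Longrightarrow> has_weak_star_deriv u (v t) t" and Bv: "B_loc v"
    and vA: "\<And>t. t \<ge> 0 \<Longrightarrow> ae_eq (v t) (flow_operator c q (u t))"
    using u unfolding is_solution_def by blast
  have uX: "u t \<in> X_space" and vX: "v t \<in> X_space" if "t \<ge> 0" for t
    using Bu Bv that unfolding B_loc_def by auto
  have uW: "u t \<in> W1inf" if "t \<ge> 0" for t using uD[OF that] by (simp add: flow_domain_def)
  define w where "w j t x = exp (Q j x) * cont_rep (u t) x $ j" for j t x
  define G where "G j a b x = exp (Q j x) * indicator {a..b} x" for j x and a b :: real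
  obtain R where R: "R \<ge> 0" "\<And>j x. x \<in> {0..1} \<Longrightarrow> cmod (exp (Q j x)) \<le> R"
    by (rule exp_Q_bound) blast
  have G: "integrable I01 (G j a b)" "(LINT x|I01. cmod (G j a b x)) \<le> R * (b - a)"
    if "0 \<le> a" "a \<le> b" "b \<le> 1" for j a b
    unfolding G_def using LINT_norm_weighted_indicator[OF exp_Q_continuous R(2) that] by auto
  \<comment> \<open>\<open>G\<close> is the test function that detects the mass of \<open>w\<close> on \<open>[a,b]\<close>: paired with \<open>u t\<close> it gives this mass, and paired
    with \<open>v t = A (u t)\<close> the flux through the end points.\<close>
  have flux: "c j * (w j t b - w j t a) = pairing (v t) (\<lambda>s. axis j (G j a b s))"
    and mass: "integral {a..b} (w j t) = pairing (u t) (\<lambda>s. axis j (G j a b s))"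
    if t: "t \<ge> 0" and ab: "0 \<le> a" "a \<le> b" "b \<le> 1" for t a b j
  proof -
    obtain k :: "'m \<Rightarrow> real \<Rightarrow> complex" where k: "\<And>j. is_primitive 0 1 (w j t) (k j)"
      "\<And>j. AE x in I01. c j * k j x = exp (Q j x) * flow_operator c q (u t) x $ j"
      "ae_eq (cont_rep (u t)) (u t)"
      unfolding w_def by (rule W1inf_gauge[OF uW[OF t]]) blast
    have ki: "integrable I01 (k j)" "integrable I01 (w j t)" using primitive_integrable[OF k(1)] by auto
    have "w j t b - w j t a = integral {a..b} (k j)"
      using k(1)[of j] ab by (auto simp: is_primitive_def intro!: integral_unique[symmetric])
    also have "\<dots> = (LINT x|I01. k j x * indicator {a..b} x)"
      using LINT_indicator_eq_integral[OF ki(1), of a b] ab by simp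
    finally have "c j * (w j t b - w j t a) = (LINT x|I01. c j * (k j x * indicator {a..b} x))"
      by simp
    also have "\<dots> = (LINT x|I01. v t x $ j * G j a b x)"
    proof (rule integral_cong_AE)
      show "(\<lambda>x. c j * (k j x * indicator {a..b} x)) \<in> borel_measurable I01"
        using ki(1) integrable_indicator_interval[of a b] by auto
      show "(\<lambda>x. v t x $ j * G j a b x) \<in> borel_measurable I01"
        using X_space_mult_integrable[OF vX[OF t] G(1)[OF ab]] by auto
      show "AE x in I01. c j * (k j x * indicator {a..b} x) = v t x $ j * G j a b x"
        using k(2)[of j] vA[OF t, unfolded ae_eq_def]
      proof eventually_elim
        case (elim x)
        have "c j * (k j x * indicator {a..b} x) = (c j * k j x) * indicator {a..b} x"
          by (simp add: mult_ac)
        also have "\<dots> = v t x $ j * G j a b x" unfolding elim by (simp add: G_def mult_ac)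
        finally show ?case .
      qed
    qed
    finally show "c j * (w j t b - w j t a) = pairing (v t) (\<lambda>s. axis j (G j a b s))"
      by (simp add: pairing_axis)
    have "integral {a..b} (w j t) = (LINT x|I01. w j t x * indicator {a..b} x)"
      using LINT_indicator_eq_integral[OF ki(2), of a b] ab by simp
    also have "\<dots> = (LINT x|I01. u t x $ j * G j a b x)"
    proof (rule integral_cong_AE)
      show "(\<lambda>x. w j t x * indicator {a..b} x) \<in> borel_measurable I01"
        using ki(2) integrable_indicator_interval[of a b] by auto
      show "(\<lambda>x. u t x $ j * G j a b x) \<in> borel_measurable I01"
        using X_space_mult_integrable[OF uX[OF t] G(1)[OF ab]] by auto
      show "AE x in I01. w j t x * indicator {a..b} x = u t x $ j * G j a b x"
        using k(3)[unfolded ae_eq_def] by eventually_elim (simp add: G_def w_def mult_ac)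
    qed
    finally show "integral {a..b} (w j t) = pairing (u t) (\<lambda>s. axis j (G j a b s))"
      by (simp add: pairing_axis)
  qed
  have char: "w j t x = w j s (x + c j * (t - s))"
    if st: "0 \<le> s" "s \<le> t" "0 \<le> x" "x + c j * (t - s) \<le> 1" for j s t x
  proof -
    have "compact {0..t}" "{0..t} \<subseteq> {0..}" by auto
    then obtain V where V: "\<And>r. r \<in> {0..t} \<Longrightarrow> X_norm (v r) \<le> ereal V"
      using Bv unfolding B_loc_def by meson
    have "AE x in I01. cmod (v t x $ j) \<le> V" by (rule X_norm_component[OF V]) (use st in auto)
    have V0: "0 \<le> V"
    proof (rule ccontr)
      assume "\<not> 0 \<le> V"
      then have neg: "\<not> cmod z \<le> V" for z using order_trans[OF norm_ge_zero[of z]] by blast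
      have "AE x in I01. False"
        using \<open>AE x in I01. cmod (v t x $ j) \<le> V\<close> by eventually_elim (use neg in blast)
      then have "emeasure I01 (space I01) = 0" using ae_filter_eq_bot_iff[of I01] by (simp add: trivial_limit_def)
      then show False by (simp add: emeasure_restrict_space)
    qed
    have lip': "cmod (w j r b - w j r a) \<le> (V * R / c j) * (b - a)"
      if r: "r \<in> {0..t}" and ab: "0 \<le> a" "a \<le> b" "b \<le> 1" for r a b
    proof -
      have r0: "r \<ge> 0" using r by simp
      have "c j * cmod (w j r b - w j r a) = cmod (c j * (w j r b - w j r a))"
        using c_pos[of j] by (simp add: norm_mult)
      also have "\<dots> = cmod (LINT x|I01. v r x $ j * G j a b x)"
        by (simp add: flux[OF r0 ab] pairing_axis)
      also have "\<dots> \<le> V * (LINT x|I01. cmod (G j a b x))"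
        by (rule norm_integral_mult_bounded_I01[OF _ X_norm_component[OF V[OF r]] G(1)[OF ab]])
          (use vX[OF r0] in \<open>auto intro!: borel_measurable_vec_component simp: Linf_def\<close>)
      also have "\<dots> \<le> V * (R * (b - a))" using G(2)[OF ab] V0 by (rule mult_left_mono)
      finally show ?thesis using c_pos[of j] by (simp add: field_simps)
    qed
    show ?thesis
    proof (rule transport_along_characteristics[OF c_pos, where N = t and L = "V * R / c j"])
      fix r x y :: real assume h: "r \<in> {0..t}" "x \<in> {0..1}" "y \<in> {0..1}"
      show "cmod (w j r x - w j r y) \<le> V * R / c j * \<bar>x - y\<bar>"
        using lip'[of r x y] lip'[of r y x] h by (cases "x \<le> y") (auto simp: norm_minus_commute)
    next
      fix a b r :: real assume ab: "0 \<le> a" "a \<le> b" "b \<le> 1" and r: "r \<in> {0..t}"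
      have r0: "r \<ge> 0" using r by simp
      have "((\<lambda>r. pairing (u r) (\<lambda>s. axis j (G j a b s))) has_vector_derivative
          pairing (v r) (\<lambda>s. axis j (G j a b s))) (at r within {0..})"
        by (rule iffD1[OF has_weak_star_deriv_iff[OF uX r0] v[OF r0], THEN conjunct2, rule_format])
          (auto intro: integrable_axis G(1)[OF ab])
      then have "((\<lambda>r. pairing (u r) (\<lambda>s. axis j (G j a b s))) has_vector_derivative
          c j * (w j r b - w j r a)) (at r within {0..t})"
        unfolding flux[OF r0 ab] by (rule has_vector_derivative_within_subset) auto
      then show "((\<lambda>r. integral {a..b} (w j r)) has_vector_derivative c j * (w j r b - w j r a)) (at r within {0..t})"
        by (rule has_vector_derivative_transform[OF r, rotated]) (simp add: mass[OF _ ab])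
    qed (use st in auto)
  qed
  have rep0: "cont_rep (u 0) x = cont_rep f x" if "x \<in> {0..1}" for x
  proof -
    have fW: "f \<in> W1inf" using f by (simp add: flow_domain_def)
    note cts = W1inf_cont_rep_continuous
    have "ae_eq (cont_rep (u 0)) (cont_rep f)"
      using cts(2)[OF uW[OF order_refl]] cts(2)[OF fW] u0 unfolding ae_eq_def
      by eventually_elim simp
    then show ?thesis using cts(1)[OF uW[of 0]] cts(1)[OF fW] that by (intro continuous_ae_eq_imp_eq) auto
  qed
  have ext: "w j y 0 = delay_ext (history f) j y" if "y \<ge> 0" for j y
  proof (rule delay_ext_unique[where W = "\<lambda>j y. w j y 0", OF _ _ that])
    fix j y assume y: "0 \<le> y" "y \<le> 1 / c j"
    have cy: "0 \<le> c j * y" "c j * y \<le> 1" using y c_pos[of j] by (auto simp: field_simps)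
    then have "w j y 0 = w j 0 (0 + c j * (y - 0))" using y by (intro char) auto
    then show "w j y 0 = history f j y" using rep0[of "c j * y"] cy by (simp add: w_def history_def)
  next
    fix j y assume y: "1 / c j < y"
    define s where "s = y - 1 / c j"
    have s: "s \<ge> 0" using y by (simp add: s_def)
    have "c j * (y - s) = 1" using c_pos[of j] by (simp add: s_def)
    then have "w j y 0 = w j s 1"
      using char[of s y 0 j] s c_pos[of j] by (simp add: s_def)
    also have "\<dots> = exp (Q j 1) * (\<Sum>k\<in>UNIV. B $ j $ k * cont_rep (u s) 0 $ k)"
      using uD[OF s] by (simp add: w_def flow_domain_def matrix_vector_mult_def)
    also have "\<dots> = (\<Sum>k\<in>UNIV. exp (Q j 1) * B $ j $ k * w k s 0)"
      by (simp add: w_def Q_0 sum_distrib_left mult.assoc)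
    finally show "w j y 0 = (\<Sum>k\<in>UNIV. exp (Q j 1) * B $ j $ k * w k (y - 1 / c j) 0)"
      by (simp add: s_def)
  qed
  have "cont_rep (u t) x = flow_solution f t x" if x: "x \<in> {0..1}" for x
  proof -
    have "exp (Q j x) * cont_rep (u t) x $ j = exp (Q j x) * flow_solution f t x $ j" for j
    proof -
      have "c j * (x / c j) = x" using c_pos[of j] by simp
      then have "w j (t + x / c j) 0 = w j t x"
        using char[of t "t + x / c j" 0 j] x \<open>t \<ge> 0\<close> c_pos[of j] by simp
      then show ?thesis
        using ext[of "t + x / c j" j] x \<open>t \<ge> 0\<close> c_pos[of j] by (simp add: flow_solution_gauge w_def)
    qed
    then show ?thesis by (simp add: vec_eq_iff)
  qed
  then have "AE x in I01. cont_rep (u t) x = flow_solution f t x" by (intro AE_I2) simp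
  moreover have "AE x in I01. cont_rep (u t) x = u t x"
    by (rule W1inf_gauge[OF uW[OF \<open>t \<ge> 0\<close>]]) (simp add: ae_eq_def)
  ultimately show ?thesis unfolding ae_eq_def by eventually_elim simp
qed

section \<open>Existence\<close>

lemma translate_bound:
  assumes "\<And>y. y \<in> {0..N + 1 / c j} \<Longrightarrow> cmod (W y) \<le> K" "t \<in> {0..N}" "x \<in> {0..1}"
  shows "cmod (W (t + x / c j)) \<le> K"
proof (rule assms(1))
  have "0 \<le> x / c j" "x / c j \<le> 1 / c j" using assms(3) c_pos[of j] by (auto simp: divide_right_mono)
  then show "t + x / c j \<in> {0..N + 1 / c j}" using assms(2) by auto
qed

text \<open>If \<open>P\<close> is an antiderivative of \<open>W\<close>, the integral over \<open>[a,b]\<close> of \<open>W (t + x / c j)\<close> is expressed by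
  \<open>P\<close>.\<close>

lemma translate_interval_integral:
  fixes P W :: "real \<Rightarrow> complex"
  assumes P: "\<And>N. is_primitive 0 N P W" and t: "t \<ge> 0" and ab: "0 \<le> a" "a \<le> b" "b \<le> 1"
  shows "(LINT x|I01. W (t + x / c j) * indicator {a..b} x) = c j * (P (t + b / c j) - P (t + a / c j))"
    "(\<lambda>x. W (t + x / c j)) \<in> borel_measurable I01"
proof -
  have "is_primitive 0 1 (\<lambda>x. c j * P (t + x / c j)) (\<lambda>x. c j * (W (t + x / c j) / c j))"
    by (intro primitive_cmult primitive_affine[OF P[of "t + 1 / c j"]]) (use c_pos[of j] t in auto)
  then have pr: "is_primitive 0 1 (\<lambda>x. c j * P (t + x / c j)) (\<lambda>x. W (t + x / c j))"
    by (rule primitive_cong) (use c_pos[of j] in auto)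
  then show "(\<lambda>x. W (t + x / c j)) \<in> borel_measurable I01" by (simp add: is_primitive_def)
  have "((\<lambda>x. W (t + x / c j)) has_integral (c j * P (t + b / c j) - c j * P (t + a / c j))) {a..b}"
    using pr ab by (auto simp: is_primitive_def)
  then show "(LINT x|I01. W (t + x / c j) * indicator {a..b} x) = c j * (P (t + b / c j) - P (t + a / c j))"
    using LINT_indicator_eq_integral[OF primitive_integrable(1)[OF pr], of a b] ab
    by (simp add: integral_unique right_diff_distrib)
qed

lemma exp_minus_exp_mult: "exp (Q j x) * (exp (- Q j x) * z) = z"
  by (simp add: exp_minus)

lemma flow_solution_is_solution:
  assumes f: "f \<in> flow_domain B"
  shows "is_solution (flow_domain B) (flow_operator c q) f (flow_solution f)"
proof -
  define W where "W = delay_ext (history f)"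
  obtain \<omega> where \<omega>: "\<And>N j. is_primitive 0 N (W j) (\<omega> j)"
    unfolding W_def by (rule ext_primitive[OF f]) blast
  define v :: "real \<Rightarrow> real \<Rightarrow> complex^'m" where "v t x = (\<chi> j. exp (- Q j x) * \<omega> j (t + x / c j))" for t x
  have sol_comp: "flow_solution f t x $ j = exp (- Q j x) * W j (t + x / c j)" for t x j
    by (simp add: flow_solution_def W_def)
  have v_comp: "v t x $ j = exp (- Q j x) * \<omega> j (t + x / c j)" for t x j
    by (simp add: v_def)
  obtain R where R: "R \<ge> 0" "\<And>j x. x \<in> {0..1} \<Longrightarrow> cmod (exp (- Q j x)) \<le> R"
    by (rule exp_Q_bound) blast
  have W_cont: "continuous_on {0..N} (W j)" for j N by (rule primitive_continuous[OF \<omega>])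
  have W_bd: "\<exists>K. \<forall>j. \<forall>y\<in>{0..N + 1 / c j}. cmod (W j y) \<le> K \<and> cmod (\<omega> j y) \<le> K" for N
  proof -
    have "\<exists>K. \<forall>y\<in>{0..N + 1 / c j}. cmod (W j y) \<le> K \<and> cmod (\<omega> j y) \<le> K" for j
    proof -
      obtain K1 where 1: "\<forall>y\<in>{0..N + 1 / c j}. cmod (W j y) \<le> K1"
        using continuous_bounded_measurable(2)[OF W_cont] unfolding bounded_iff by blast
      obtain K2 where 2: "\<forall>y\<in>{0..N + 1 / c j}. cmod (\<omega> j y) \<le> K2"
        using \<omega>[of "N + 1 / c j" j] unfolding is_primitive_def bounded_iff by blast
      show ?thesis using 1 2 by (intro exI[of _ "max K1 K2"]) (auto simp: le_max_iff_disj)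
    qed
    then obtain K where K: "\<And>j y. y \<in> {0..N + 1 / c j} \<Longrightarrow> cmod (W j y) \<le> K j \<and> cmod (\<omega> j y) \<le> K j"
      by metis
    have "K j \<le> Max (range K)" for j by simp
    then show ?thesis using K by (meson order_trans)
  qed
  have sol_primitive: "is_primitive 0 1 (\<lambda>x. flow_solution f t x $ j)
      (\<lambda>x. - p j x * exp (- Q j x) * W j (t + x / c j) + exp (- Q j x) * (\<omega> j (t + x / c j) / c j))"
    if "t \<ge> 0" for t j
    unfolding sol_comp
    by (rule primitive_mult[OF exp_minus_Q_primitive primitive_affine[OF \<omega>, where t = t]])
      (use that c_pos[of j] in auto)
  have solW: "flow_solution f t \<in> W1inf" if "t \<ge> 0" for t
    by (rule primitive_imp_W1inf(1)[OF sol_primitive[OF that] refl])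
  have sol_rep: "cont_rep (flow_solution f t) x $ j = flow_solution f t x $ j" if "t \<ge> 0" "x \<in> {0..1}" for t x j
    by (rule primitive_imp_W1inf(2)[OF sol_primitive[OF that(1)] refl that(2)])
  have sol_wd: "AE x in I01. weak_deriv (flow_solution f t) x $ j =
      - p j x * exp (- Q j x) * W j (t + x / c j) + exp (- Q j x) * (\<omega> j (t + x / c j) / c j)"
    if "t \<ge> 0" for t j
    by (rule primitive_imp_W1inf(3)[OF sol_primitive[OF that] refl])
  have solD: "flow_solution f t \<in> flow_domain B" if t: "t \<ge> 0" for t
  proof -
    have "flow_solution f t 1 $ j = (B *v flow_solution f t 0) $ j" for j
    proof -
      have "flow_solution f t 1 $ j = exp (- Q j 1) * (\<Sum>k\<in>UNIV. exp (Q j 1) * B $ j $ k * W k t)"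
        unfolding sol_comp W_def by (simp add: ext_step[OF f t])
      also have "\<dots> = (\<Sum>k\<in>UNIV. B $ j $ k * W k t)"
        by (simp add: sum_distrib_left exp_minus mult.assoc[symmetric])
      also have "\<dots> = (B *v flow_solution f t 0) $ j"
        by (simp add: matrix_vector_mult_def sol_comp Q_0)
      finally show ?thesis .
    qed
    then have "flow_solution f t 1 = B *v flow_solution f t 0" by (simp add: vec_eq_iff)
    moreover have "cont_rep (flow_solution f t) x = flow_solution f t x" if "x \<in> {0..1}" for x
      using sol_rep[OF t that] by (simp add: vec_eq_iff)
    ultimately show ?thesis using solW[OF t] by (simp add: flow_domain_def)
  qed
  have sol_0: "ae_eq (flow_solution f 0) f"
  proof -
    have ae: "ae_eq (cont_rep f) f"
      using f by (intro W1inf_cont_rep_continuous) (auto simp: flow_domain_def)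
    have "flow_solution f 0 x = cont_rep f x" if "x \<in> {0..1}" for x
    proof -
      have "flow_solution f 0 x $ j = cont_rep f x $ j" for j
      proof -
        have "x / c j \<le> 1 / c j" using that c_pos[of j] by (auto simp: divide_right_mono)
        then have "delay_ext (history f) j (x / c j) = exp (Q j x) * cont_rep f x $ j"
          using c_pos[of j] by (simp add: delay_ext_initial history_def)
        then show ?thesis by (simp add: sol_comp W_def exp_minus)
      qed
      then show ?thesis by (simp add: vec_eq_iff)
    qed
    then have "AE x in I01. flow_solution f 0 x = cont_rep f x" by (intro AE_I2) simp
    then show ?thesis using ae unfolding ae_eq_def by eventually_elim simp
  qed
  have v_meas: "(\<lambda>x. v t x $ j) \<in> borel_measurable I01" and sol_meas: "(\<lambda>x. flow_solution f t x $ j) \<in> borel_measurable I01"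
    if "t \<ge> 0" for t j
  proof -
    have "(\<lambda>x. exp (- Q j x)) \<in> borel_measurable I01"
      by (rule continuous_bounded_measurable(1)[OF primitive_continuous[OF exp_minus_Q_primitive]])
    then show "(\<lambda>x. v t x $ j) \<in> borel_measurable I01"
      unfolding v_comp using translate_interval_integral(2)[OF \<omega>[of _ j] that, of 0 1, where j = j] by auto
    show "(\<lambda>x. flow_solution f t x $ j) \<in> borel_measurable I01"
      by (rule continuous_bounded_measurable(1)[OF primitive_continuous[OF sol_primitive[OF that]]])
  qed
  have sol_bd: "\<exists>K. \<forall>t\<in>{0..N}. \<forall>x\<in>{0..1}. \<forall>j. cmod (flow_solution f t x $ j) \<le> K"
    and v_bd: "\<exists>K. \<forall>t\<in>{0..N}. \<forall>x\<in>{0..1}. \<forall>j. cmod (v t x $ j) \<le> K" for N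
  proof -
    obtain K where K: "\<And>j y. y \<in> {0..N + 1 / c j} \<Longrightarrow> cmod (W j y) \<le> K"
      "\<And>j y. y \<in> {0..N + 1 / c j} \<Longrightarrow> cmod (\<omega> j y) \<le> K"
      using W_bd[of N] by blast
    have "cmod (flow_solution f t x $ j) \<le> R * K \<and> cmod (v t x $ j) \<le> R * K" if "t \<in> {0..N}" "x \<in> {0..1}" for t x j
      unfolding sol_comp v_comp norm_mult
      using translate_bound[where W = "W j" and j = j, OF K(1) that]
        translate_bound[where W = "\<omega> j" and j = j, OF K(2) that] R that
      by (auto intro!: mult_mono)
    then show "\<exists>K. \<forall>t\<in>{0..N}. \<forall>x\<in>{0..1}. \<forall>j. cmod (flow_solution f t x $ j) \<le> K"
      "\<exists>K. \<forall>t\<in>{0..N}. \<forall>x\<in>{0..1}. \<forall>j. cmod (v t x $ j) \<le> K"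
      by (intro exI[of _ "R * K"] ballI allI; blast)+
  qed
  have B_loc: "B_loc z"
    if meas: "\<And>t j. t \<ge> 0 \<Longrightarrow> (\<lambda>x. z t x $ j) \<in> borel_measurable I01"
      and bd: "\<And>N. \<exists>K. \<forall>t\<in>{0..N}. \<forall>x\<in>{0..1}. \<forall>j. cmod (z t x $ j) \<le> K"
    for z :: "real \<Rightarrow> real \<Rightarrow> complex^'m"
    unfolding B_loc_def
  proof (intro conjI allI impI)
    fix t :: real assume t: "0 \<le> t"
    obtain K where "\<forall>t\<in>{0..t}. \<forall>x\<in>{0..1}. \<forall>j. cmod (z t x $ j) \<le> K" using bd by blast
    then show "z t \<in> X_space" using t by (intro X_spaceI[where K = "\<lambda>_. K"] meas AE_I2) auto
  next
    fix S :: "real set" assume S: "compact S \<and> S \<subseteq> {0..}"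
    then obtain N where N: "\<forall>t\<in>S. \<bar>t\<bar> \<le> N"
      using compact_imp_bounded[of S] unfolding bounded_iff real_norm_def by blast
    obtain K where K: "\<forall>t\<in>{0..N}. \<forall>x\<in>{0..1}. \<forall>j. cmod (z t x $ j) \<le> K" using bd by blast
    have "X_norm (z t) \<le> ereal (\<Sum>j\<in>(UNIV::'m set). K)" if "t \<in> S" for t
    proof -
      have t: "t \<in> {0..N}" using that S N by fastforce
      show ?thesis
        by (intro X_norm_le meas AE_I2) (use t K in auto)
    qed
    then show "\<exists>M::real. \<forall>t\<in>S. X_norm (z t) \<le> ereal M" by blast
  qed
  have Bsol: "B_loc (flow_solution f)" by (rule B_loc[OF sol_meas sol_bd])
  have Bv: "B_loc v" by (rule B_loc[OF v_meas v_bd])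
  have solX: "flow_solution f t \<in> X_space" and vX: "v t \<in> X_space" if "t \<ge> 0" for t
    using Bsol Bv that unfolding B_loc_def by blast+
  have vA: "ae_eq (v t) (flow_operator c q (flow_solution f t))" if t: "t \<ge> 0" for t
  proof -
    have "AE x in I01. \<forall>j. weak_deriv (flow_solution f t) x $ j =
      - p j x * exp (- Q j x) * W j (t + x / c j) + exp (- Q j x) * (\<omega> j (t + x / c j) / c j) \<and> q j x = c j * p j x"
      using sol_wd[OF t] q_eq by (simp add: AE_all_countable)
    then show ?thesis
      unfolding ae_eq_def
    proof eventually_elim
      case (elim x)
      have "flow_operator c q (flow_solution f t) x $ j = v t x $ j" for j
      proof -
        have e: "weak_deriv (flow_solution f t) x $ j =
            - p j x * exp (- Q j x) * W j (t + x / c j) + exp (- Q j x) * (\<omega> j (t + x / c j) / c j)"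
          "q j x = c j * p j x" using elim by blast+
        show ?thesis
          unfolding flow_operator_def vec_lambda_beta e v_comp sol_comp
          using c_pos[of j] by (simp add: field_simps)
      qed
      then show ?case by (simp add: vec_eq_iff)
    qed
  qed
  have ev: "\<forall>\<^sub>F r in at t within {0..}. r \<in> {0..t + 1}" if "t \<ge> 0" for t :: real
  proof -
    have "\<forall>\<^sub>F r in at t within {0..}. r < t + 1"
      by (rule order_tendstoD(2)[OF tendsto_ident_at]) simp
    moreover have "\<forall>\<^sub>F r in at t within {0..}. r \<ge> 0" by (simp add: eventually_at_filter)
    ultimately show ?thesis by eventually_elim simp
  qed
  have W_lim: "((\<lambda>r. W j (r + z)) \<longlongrightarrow> W j (t + z)) (at t within {0..})" if tz: "t \<ge> 0" "z \<ge> 0" for j t z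
  proof -
    have "continuous_on {0..t + 1} (\<lambda>r. W j (r + z))"
      by (rule continuous_on_compose2[OF W_cont[of "t + 1 + z" j]]) (use tz in \<open>auto intro!: continuous_intros\<close>)
    then have "((\<lambda>r. W j (r + z)) \<longlongrightarrow> W j (t + z)) (at t within {0..t+1})"
      using tz by (simp add: continuous_on_def)
    then show ?thesis by (simp add: at_within_halfline)
  qed
  have v_cont: "continuous_map (top_of_set {0..}) weak_star v"
  proof (rule continuous_map_weak_starI)
    fix g :: "real \<Rightarrow> complex^'m" and t :: real assume g: "integrable I01 g" and "t \<in> {0..}"
    then have t: "t \<ge> 0" by simp
    obtain K where K: "\<And>j y. y \<in> {0..t + 1 + 1 / c j} \<Longrightarrow> cmod (\<omega> j y) \<le> K"
      using W_bd[of "t + 1"] by blast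
    show "((\<lambda>r. pairing (v r) g) \<longlongrightarrow> pairing (v t) g) (at t within {0..})"
    proof (rule pairing_tendsto_if_weighted_intervals[OF exp_Q_continuous _ vX[OF t] _ _ _ g, where K = "K + K"])
      show "exp (Q j x) \<noteq> 0" for j x by simp
      show "\<forall>\<^sub>F r in at t within {0..}. v r \<in> X_space"
        using ev[OF t] by eventually_elim (simp add: vX)
      have gauge: "exp (Q j x) * (v r x $ j - v t x $ j) = \<omega> j (r + x / c j) - \<omega> j (t + x / c j)" for r x j
        by (simp add: v_comp right_diff_distrib exp_minus_exp_mult)
      show "\<forall>\<^sub>F r in at t within {0..}. \<forall>j. AE x in I01. cmod (exp (Q j x) * (v r x $ j - v t x $ j)) \<le> K + K"
        using ev[OF t] unfolding gauge
      proof eventually_elim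
        case (elim r)
        show ?case
        proof (intro allI AE_I2)
          fix j x assume "x \<in> space I01"
          then have "cmod (\<omega> j (r + x / c j)) \<le> K" "cmod (\<omega> j (t + x / c j)) \<le> K"
            using translate_bound[where W = "\<omega> j" and j = j and N = "t + 1", OF K, of r x] translate_bound[where W = "\<omega> j" and j = j and N = "t + 1", OF K, of t x] elim t by auto
          then show "cmod (\<omega> j (r + x / c j) - \<omega> j (t + x / c j)) \<le> K + K"
            using norm_triangle_ineq4[of "\<omega> j (r + x / c j)" "\<omega> j (t + x / c j)"] by linarith
        qed
      qed
      fix j and a b :: real assume ab: "0 \<le> a" "a \<le> b" "b \<le> 1"
      have ac: "0 \<le> a / c j" "0 \<le> b / c j" using ab c_pos[of j] by auto
      have "((\<lambda>r. c j * (W j (r + b / c j) - W j (r + a / c j)) - c j * (W j (t + b / c j) - W j (t + a / c j)))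
          \<longlongrightarrow> c j * (W j (t + b / c j) - W j (t + a / c j)) - c j * (W j (t + b / c j) - W j (t + a / c j)))
          (at t within {0..})"
        by (intro tendsto_intros W_lim t ac)
      moreover have "\<forall>\<^sub>F r in at t within {0..}.
          c j * (W j (r + b / c j) - W j (r + a / c j)) - c j * (W j (t + b / c j) - W j (t + a / c j)) =
          (LINT x|I01. exp (Q j x) * (v r x $ j - v t x $ j) * indicator {a..b} x)"
        using ev[OF t]
      proof eventually_elim
        case (elim r)
        then have r: "r \<ge> 0" by simp
        have i: "integrable I01 (\<lambda>x. \<omega> j (r + x / c j) * indicator {a..b} x)" if r: "r \<ge> 0" for r
        proof -
          obtain K where K: "\<And>j y. y \<in> {0..r + 1 / c j} \<Longrightarrow> cmod (\<omega> j y) \<le> K"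
            using W_bd[of r] by blast
          show ?thesis
            by (rule integrable_mult_bounded_I01[where K = K, OF translate_interval_integral(2)[OF \<omega> r ab] _ integrable_indicator_interval])
              (use translate_bound[where W = "\<omega> j" and j = j and N = r, OF K, of r] r in auto)
        qed
        show ?case
          unfolding gauge left_diff_distrib
          using translate_interval_integral(1)[OF \<omega>[of _ j] r ab, where j = j]
            translate_interval_integral(1)[OF \<omega>[of _ j] t ab, where j = j]
            i[OF r] i[OF t] by simp
      qed
      ultimately show "((\<lambda>r. LINT x|I01. exp (Q j x) * (v r x $ j - v t x $ j) * indicator {a..b} x) \<longlongrightarrow> 0) (at t within {0..})"
        using Lim_transform_eventually by fastforce
    qed
  qed (use vX in auto)
  have v_deriv: "has_weak_star_deriv (flow_solution f) (v t) t" if t: "t \<ge> 0" for t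
  proof -
    have evX: "\<forall>\<^sub>F r in at t within {0..}. (\<lambda>s. (flow_solution f r s - flow_solution f t s) /\<^sub>R (r - t)) \<in> X_space"
      using ev[OF t] by eventually_elim (rule X_space_quotient, use solX t in auto)
    obtain K where K: "\<And>j y. y \<in> {0..t + 1 + 1 / c j} \<Longrightarrow> cmod (\<omega> j y) \<le> K"
      using W_bd[of "t + 1"] by blast
    define P where "P j y = integral {0..y} (W j)" for j y
    have P: "is_primitive 0 N (P j) (W j)" for j N
      unfolding P_def by (rule primitive_integral_continuous[OF W_cont])
    have P_deriv: "((\<lambda>r. P j (r + z)) has_vector_derivative W j (t + z)) (at t within {0..})" if z: "z \<ge> 0" for j z
    proof -
      have "(P j has_vector_derivative W j (t + z)) (at (t + z) within {0..t + z + 1})"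
        unfolding P_def by (rule integral_has_vector_derivative[OF W_cont]) (use t z in auto)
      then have im: "(P j has_vector_derivative W j (t + z)) (at (t + z) within (\<lambda>r. r + z) ` {0..t+1})"
        by (rule has_vector_derivative_within_subset) (use z in auto)
      have "((\<lambda>r. r + z) has_vector_derivative 1) (at t within {0..t+1})"
        by (auto intro!: derivative_eq_intros)
      from vector_diff_chain_within[OF this im]
      have "((P j \<circ> (\<lambda>r. r + z)) has_vector_derivative 1 *\<^sub>R W j (t + z)) (at t within {0..t+1})" .
      then show ?thesis by (simp add: o_def at_within_halfline)
    qed
    have "((\<lambda>r. pairing (\<lambda>s. (flow_solution f r s - flow_solution f t s) /\<^sub>R (r - t)) g) \<longlongrightarrow> pairing (v t) g) (at t within {0..})"
      if g: "integrable I01 g" for g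
    proof (rule pairing_tendsto_if_weighted_intervals[OF exp_Q_continuous _ vX[OF t] evX _ _ g, where K = "K + K"])
      show "exp (Q j x) \<noteq> 0" for j x by simp
      have gauge: "exp (Q j x) * (((flow_solution f r x - flow_solution f t x) /\<^sub>R (r - t)) $ j - v t x $ j) =
          (W j (r + x / c j) - W j (t + x / c j)) /\<^sub>R (r - t) - \<omega> j (t + x / c j)" for r x j
      proof -
        have "exp (Q j x) * (((flow_solution f r x - flow_solution f t x) /\<^sub>R (r - t)) $ j - v t x $ j)
            = (exp (Q j x) * flow_solution f r x $ j - exp (Q j x) * flow_solution f t x $ j) /\<^sub>R (r - t) - exp (Q j x) * v t x $ j"
          by (simp add: algebra_simps)
        then show ?thesis by (simp add: flow_solution_gauge W_def[symmetric] v_comp exp_minus_exp_mult)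
      qed
      show "\<forall>\<^sub>F r in at t within {0..}. \<forall>j. AE x in I01.
          cmod (exp (Q j x) * (((flow_solution f r x - flow_solution f t x) /\<^sub>R (r - t)) $ j - v t x $ j)) \<le> K + K"
        using ev[OF t] unfolding gauge
      proof eventually_elim
        case (elim r)
        show ?case
        proof (intro allI AE_I2)
          fix j x assume "x \<in> space I01"
          then have x: "x \<in> {0..1}" by simp
          have xc: "0 \<le> x / c j" "x / c j \<le> 1 / c j" using x c_pos[of j] by (auto simp: divide_right_mono)
          have "K \<ge> 0" using K[of 0 j] t c_pos[of j] order_trans[OF norm_ge_zero[of "\<omega> j 0"]] by simp
          have "cmod (W j (r + x / c j) - W j (t + x / c j)) \<le> K * \<bar>(r + x / c j) - (t + x / c j)\<bar>"
            by (rule primitive_lipschitz[OF \<omega> K]) (use xc elim t in auto)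
          then have "cmod ((W j (r + x / c j) - W j (t + x / c j)) /\<^sub>R (r - t)) \<le> K"
          proof (cases "r = t")
            case False
            have "cmod ((W j (r + x / c j) - W j (t + x / c j)) /\<^sub>R (r - t))
                = cmod (W j (r + x / c j) - W j (t + x / c j)) / \<bar>r - t\<bar>"
              by (simp only: norm_scaleR abs_inverse) (simp add: divide_inverse mult.commute)
            then show ?thesis using \<open>cmod (W j (r + x / c j) - W j (t + x / c j)) \<le> _\<close> False
              by (simp add: pos_divide_le_eq)
          qed (use \<open>K \<ge> 0\<close> in simp)
          moreover have "cmod (\<omega> j (t + x / c j)) \<le> K"
            using translate_bound[where W = "\<omega> j" and j = j and N = "t + 1", OF K, of t x] x t by auto
          ultimately show "cmod ((W j (r + x / c j) - W j (t + x / c j)) /\<^sub>R (r - t) - \<omega> j (t + x / c j)) \<le> K + K"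
            using norm_triangle_ineq4[of "(W j (r + x / c j) - W j (t + x / c j)) /\<^sub>R (r - t)" "\<omega> j (t + x / c j)"]
            by linarith
        qed
      qed
      fix j and a b :: real assume ab: "0 \<le> a" "a \<le> b" "b \<le> 1"
      have ac: "0 \<le> a / c j" "0 \<le> b / c j" using ab c_pos[of j] by auto
      define I where "I r = c j * (P j (r + b / c j) - P j (r + a / c j))" for r
      define D where "D = c j * (W j (t + b / c j) - W j (t + a / c j))"
      have "(I has_vector_derivative D) (at t within {0..})"
        unfolding I_def[abs_def] D_def
        by (intro has_vector_derivative_mult_right has_vector_derivative_diff P_deriv ac)
      then have "((\<lambda>r. (I r - I t) /\<^sub>R (r - t) - D) \<longlongrightarrow> 0) (at t within {0..})"
        unfolding has_vector_derivative_iff_quotient by (simp add: Lim_null[of _ D])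
      moreover have "\<forall>\<^sub>F r in at t within {0..}. (I r - I t) /\<^sub>R (r - t) - D =
          (LINT x|I01. exp (Q j x) * (((flow_solution f r x - flow_solution f t x) /\<^sub>R (r - t)) $ j - v t x $ j) * indicator {a..b} x)"
        using ev[OF t]
      proof eventually_elim
        case (elim r)
        then have r: "r \<ge> 0" by simp
        obtain K where K: "\<And>j y. y \<in> {0..t + 1 + 1 / c j} \<Longrightarrow> cmod (W j y) \<le> K"
            "\<And>j y. y \<in> {0..t + 1 + 1 / c j} \<Longrightarrow> cmod (\<omega> j y) \<le> K"
          using W_bd[of "t + 1"] by blast
        have iW: "integrable I01 (\<lambda>x. W j (s + x / c j) * indicator {a..b} x)" if s: "s \<in> {0..t+1}" for s
          by (rule integrable_mult_bounded_I01[where K = K, OF translate_interval_integral(2)[OF P _ ab] _ integrable_indicator_interval])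
            (use translate_bound[where W = "W j" and j = j and N = "t + 1", OF K(1) s] s in auto)
        have i\<omega>: "integrable I01 (\<lambda>x. \<omega> j (t + x / c j) * indicator {a..b} x)"
          by (rule integrable_mult_bounded_I01[where K = K, OF translate_interval_integral(2)[OF \<omega> t ab] _ integrable_indicator_interval])
            (use translate_bound[where W = "\<omega> j" and j = j and N = "t + 1", OF K(2), of t] t in auto)
        have "(LINT x|I01. exp (Q j x) * (((flow_solution f r x - flow_solution f t x) /\<^sub>R (r - t)) $ j - v t x $ j) * indicator {a..b} x)
          = (LINT x|I01. (W j (r + x / c j) * indicator {a..b} x - W j (t + x / c j) * indicator {a..b} x) /\<^sub>R (r - t)
              - \<omega> j (t + x / c j) * indicator {a..b} x)"
          unfolding gauge by (simp add: algebra_simps)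
        also have "\<dots> = ((LINT x|I01. W j (r + x / c j) * indicator {a..b} x)
            - (LINT x|I01. W j (t + x / c j) * indicator {a..b} x)) /\<^sub>R (r - t)
            - (LINT x|I01. \<omega> j (t + x / c j) * indicator {a..b} x)"
          using iW[OF elim] iW[of t] i\<omega> t by simp
        also have "\<dots> = (I r - I t) /\<^sub>R (r - t) - D"
          unfolding translate_interval_integral(1)[OF P r ab] translate_interval_integral(1)[OF P t ab]
            translate_interval_integral(1)[OF \<omega> t ab] I_def D_def ..
        finally show ?case by simp
      qed
      ultimately show "((\<lambda>r. LINT x|I01. exp (Q j x) * (((flow_solution f r x - flow_solution f t x) /\<^sub>R (r - t)) $ j - v t x $ j) *
          indicator {a..b} x) \<longlongrightarrow> 0) (at t within {0..})"
        by (rule Lim_transform_eventually)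
    qed
    then show ?thesis
      unfolding has_weak_star_deriv_def limitin_weak_star_iff[OF evX] using vX[OF t] by blast
  qed
  show ?thesis
    unfolding is_solution_def using solD sol_0 Bsol v_deriv v_cont Bv vA by blast
qed

section \<open>Continuous dependence and well-posedness\<close>

lemma continuous_dependence:
  fixes f :: "nat \<Rightarrow> real \<Rightarrow> complex^'m"
  assumes f: "\<And>n. f n \<in> flow_domain B" and bd: "\<And>n. X_norm (f n) \<le> ereal K"
    and lim: "limitin weak_star f (\<lambda>s. 0) sequentially"
    and u: "\<And>n. is_solution (flow_domain B) (flow_operator c q) (f n) (u n)"
    and "t0 \<ge> 0" and U: "openin weak_star U" "(\<lambda>s. 0) \<in> U"
  shows "\<forall>\<^sub>F n in sequentially. \<forall>t\<in>{0..t0}. u n t \<in> U"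
proof -
  define W where "W n = delay_ext (history (f n))" for n
  obtain R where R: "R \<ge> 0" "\<And>j x. x \<in> {0..1} \<Longrightarrow> cmod (exp (Q j x)) \<le> R"
    by (rule exp_Q_bound) blast
  have fX: "f n \<in> X_space" and fW: "f n \<in> W1inf" for n using f by (auto simp: flow_domain_def W1inf_def)
  have W_cont: "continuous_on {0..N} (W n j)" for n N j
  proof -
    obtain \<omega> where "\<And>N j. is_primitive 0 N (W n j) (\<omega> j)" unfolding W_def by (rule ext_primitive[OF f]) blast
    then show ?thesis by (rule primitive_continuous)
  qed
  define P where "P n j y = integral {0..y} (W n j)" for n j y
  have P: "is_primitive 0 N (P n j) (W n j)" for n j N
    unfolding P_def by (rule primitive_integral_continuous[OF W_cont])
  have rep: "continuous_on {0..1} (\<lambda>x. cont_rep (f n) x $ j)" "ae_eq (cont_rep (f n)) (f n)" for n j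
    using W1inf_cont_rep_continuous[OF fW] by (auto intro: continuous_on_component)
  have rep_bd: "cmod (cont_rep (f n) x $ j) \<le> K" if "x \<in> {0..1}" for n x j
  proof -
    have "(\<lambda>x. max 0 (cmod (cont_rep (f n) x $ j) - K)) x = (\<lambda>_. 0) x"
    proof (rule continuous_ae_eq_imp_eq[OF _ _ _ that])
      show "continuous_on {0..1} (\<lambda>x. max 0 (cmod (cont_rep (f n) x $ j) - K))"
        by (intro continuous_intros rep)
      show "ae_eq (\<lambda>x. max 0 (cmod (cont_rep (f n) x $ j) - K)) (\<lambda>_. 0)"
        using X_norm_component[OF bd[of n], of j] rep(2)[of n] unfolding ae_eq_def by eventually_elim simp
    qed auto
    then show ?thesis by (simp add: max_def split: if_splits)
  qed
  have history_bd: "cmod (history (f n) j y) \<le> R * K" if "0 \<le> y" "y \<le> 1 / c j" for n j y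
  proof -
    have "c j * y \<in> {0..1}" using that c_pos[of j] by (auto simp: field_simps)
    then show ?thesis unfolding history_def norm_mult using R rep_bd by (intro mult_mono) auto
  qed
  have W_growth: "cmod (W n j y) \<le> R * K * exp (growth_rate * y)" if "0 \<le> y" for n j y
    unfolding W_def by (rule delay_ext_bound[OF history_bd that])
  have "cmod (history (f 0) undefined 0) \<le> R * K"
    using c_pos[of undefined] by (intro history_bd) auto
  then have RK: "R * K \<ge> 0" by (rule order_trans[OF norm_ge_zero])
  define N where "N = t0 + Max (range (\<lambda>j. 1 / c j))"
  have N: "t0 + 1 / c j \<le> N" for j by (simp add: N_def)
  have "0 < 1 / c undefined" using c_pos[of undefined] by simp
  then have N0: "N \<ge> 0" using N[of undefined] \<open>t0 \<ge> 0\<close> by linarith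
  define L where "L = R * K * exp (growth_rate * N)"
  have W_bd: "cmod (W n j y) \<le> L" if "y \<in> {0..N}" for n j y
  proof -
    have "cmod (W n j y) \<le> R * K * exp (growth_rate * y)" using that by (intro W_growth) auto
    also have "\<dots> \<le> L" unfolding L_def using that growth_rate_nonneg RK
      by (intro mult_left_mono) (auto intro: mult_left_mono)
    finally show ?thesis .
  qed
  have P_lim: "((\<lambda>n. P n j y) \<longlongrightarrow> 0) sequentially" if "y \<ge> 0" for j y
    unfolding P_def W_def
  proof (rule delay_ext_integral_tendsto[OF _ _ that])
    show "continuous_on {0..N} (delay_ext (history (f n)) j)" for n N j
      using W_cont unfolding W_def .
    fix j y assume y: "0 \<le> y" "y \<le> 1 / c j"
    have cy: "0 \<le> c j * y" "c j * y \<le> 1" using y c_pos[of j] by (auto simp: field_simps)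
    define G where "G x = exp (Q j x) * indicator {0..c j * y} x" for x
    have G: "integrable I01 G" unfolding G_def
      by (rule LINT_norm_weighted_indicator(1)[OF exp_Q_continuous R(2)]) (use cy in auto)
    have eq: "integral {0..y} (history (f n) j) = pairing (f n) (\<lambda>s. axis j (G s)) / c j" for n
    proof -
      define h where "h x = exp (Q j x) * cont_rep (f n) x $ j" for x
      have h: "continuous_on {0..1} h" unfolding h_def by (intro continuous_on_mult exp_Q_continuous rep)
      have "is_primitive 0 1 (\<lambda>x. integral {0..x} h) h" by (rule primitive_integral_continuous[OF h])
      then have "is_primitive 0 (1 / c j) (\<lambda>y. integral {0..(0 + y / (1 / c j))} h) (\<lambda>y. h (0 + y / (1 / c j)) / complex_of_real (1 / c j))"
        by (rule primitive_affine) (use c_pos[of j] in auto)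
      then have "is_primitive 0 (1 / c j) (\<lambda>y. 1 / c j * integral {0..(0 + y / (1 / c j))} h)
          (\<lambda>y. 1 / c j * (h (0 + y / (1 / c j)) / complex_of_real (1 / c j)))"
        by (rule primitive_cmult)
      then have "is_primitive 0 (1 / c j) (\<lambda>y. integral {0..c j * y} h / c j) (history (f n) j)"
        by (rule primitive_cong) (use c_pos[of j] in \<open>auto simp: history_def h_def mult.commute\<close>)
      then have "(history (f n) j has_integral (integral {0..c j * y} h / c j - integral {0..c j * 0} h / c j)) {0..y}"
        using y unfolding is_primitive_def by blast
      then have "integral {0..y} (history (f n) j) = integral {0..c j * y} h / c j"
        by (simp add: integral_unique)
      also have "integral {0..c j * y} h = (LINT x|I01. h x * indicator {0..c j * y} x)"
        using LINT_indicator_eq_integral[OF integrable_I01_continuous[OF h], of 0 "c j * y"] cy by simp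
      also have "\<dots> = (LINT x|I01. f n x $ j * G x)"
      proof (rule integral_cong_AE)
        show "(\<lambda>x. h x * indicator {0..c j * y} x) \<in> borel_measurable I01"
          using integrable_I01_continuous[OF h] integrable_indicator_interval[of 0 "c j * y"] by auto
        show "(\<lambda>x. f n x $ j * G x) \<in> borel_measurable I01"
          using X_space_mult_integrable[OF fX G] by auto
        show "AE x in I01. h x * indicator {0..c j * y} x = f n x $ j * G x"
          using rep(2)[unfolded ae_eq_def, of n] by eventually_elim (simp add: h_def G_def mult_ac)
      qed
      finally show ?thesis by (simp add: pairing_axis)
    qed
    have "((\<lambda>n. pairing (f n) (\<lambda>s. axis j (G s))) \<longlongrightarrow> pairing (\<lambda>s. 0) (\<lambda>s. axis j (G s))) sequentially"
      using iffD1[OF limitin_weak_star_iff[OF always_eventually] lim] fX integrable_axis[OF G] by blast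
    then show "((\<lambda>n. integral {0..y} (history (f n) j)) \<longlongrightarrow> 0) sequentially"
      unfolding eq pairing_zero by (rule tendsto_divide_zero)
  qed
  have P_unif: "\<forall>\<^sub>F n in sequentially. \<forall>y\<in>{0..N}. cmod (P n j y) < e" if "e > 0" for j e
    by (rule equilipschitz_tendsto_uniform[where Q = "\<lambda>n. P n j" and L = L, OF _ _ that N0])
      (auto intro!: primitive_lipschitz[OF P W_bd] P_lim)
  \<comment> \<open>Uniform convergence for \<open>t \<in> [0,t0]\<close> is convergence along the product filter \<open>?F\<close>.\<close>
  let ?F = "sequentially \<times>\<^sub>F principal {0..t0}"
  have usol: "AE x in I01. u n t x = flow_solution (f n) t x" if "t \<ge> 0" for n t
    using solution_eq_flow_solution[OF f u that] unfolding ae_eq_def .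
  have uX: "u n t \<in> X_space" if "t \<ge> 0" for n t
    using u[of n] that unfolding is_solution_def B_loc_def by blast
  have gauge: "AE x in I01. exp (Q j x) * u n t x $ j = W n j (t + x / c j)" if "t \<ge> 0" for n t j
    using usol[OF that, of n] by eventually_elim (simp add: flow_solution_gauge W_def)
  have "\<forall>\<^sub>F i in ?F. u (fst i) (snd i) \<in> U"
  proof (rule weak_star_eventually_mem[OF U])
    show X: "\<forall>\<^sub>F i in ?F. u (fst i) (snd i) \<in> X_space"
      unfolding eventually_prod_principal by (simp add: uX)
    have z: "(\<lambda>s. 0) \<in> X_space" by (rule X_spaceI[where K = "\<lambda>_. 0"]) auto
    fix g :: "real \<Rightarrow> complex^'m" assume g: "integrable I01 g"
    show "((\<lambda>i. pairing (u (fst i) (snd i)) g) \<longlongrightarrow> pairing (\<lambda>s. 0) g) ?F"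
    proof (rule pairing_tendsto_if_weighted_intervals[OF exp_Q_continuous _ z X _ _ g, where K = L])
      show "exp (Q j x) \<noteq> 0" for j x by simp
      show "\<forall>\<^sub>F i in ?F. \<forall>j. AE x in I01. cmod (exp (Q j x) * (u (fst i) (snd i) x $ j - 0 $ j)) \<le> L"
        unfolding eventually_prod_principal
      proof (rule always_eventually, intro allI ballI)
        fix n t j assume t: "t \<in> {0..t0}"
        have "AE x in I01. x \<in> {0..1}" by (rule AE_I2) simp
        moreover have "AE x in I01. exp (Q j x) * u n t x $ j = W n j (t + x / c j)" using gauge t by simp
        ultimately show "AE x in I01. cmod (exp (Q j x) * (u (fst (n, t)) (snd (n, t)) x $ j - 0 $ j)) \<le> L"
        proof eventually_elim
          case (elim x)
          have "cmod (W n j (t + x / c j)) \<le> L"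
            by (rule translate_bound[OF _ t elim(1)], rule W_bd) (use N[of j] in auto)
          then show ?case using elim by simp
        qed
      qed
      fix j and a b :: real assume ab: "0 \<le> a" "a \<le> b" "b \<le> 1"
      show "((\<lambda>i. LINT x|I01. exp (Q j x) * (u (fst i) (snd i) x $ j - 0 $ j) * indicator {a..b} x) \<longlongrightarrow> 0) ?F"
      proof (rule tendstoI)
        fix e :: real assume "e > 0"
        then have "e / (2 * c j) > 0" using c_pos[of j] by simp
        from P_unif[OF this, of j]
        show "\<forall>\<^sub>F i in ?F. dist (LINT x|I01. exp (Q j x) * (u (fst i) (snd i) x $ j - 0 $ j) * indicator {a..b} x) 0 < e"
          unfolding eventually_prod_principal
        proof eventually_elim
          case (elim n)
          show ?case
          proof
            fix t assume t: "t \<in> {0..t0}"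
            then have t0: "t \<ge> 0" by simp
            have "(LINT x|I01. exp (Q j x) * (u n t x $ j - 0 $ j) * indicator {a..b} x)
                = (LINT x|I01. W n j (t + x / c j) * indicator {a..b} x)"
            proof (rule integral_cong_AE)
              have m: "(\<lambda>x. u n t x $ j) \<in> borel_measurable I01"
                using uX[OF t0, of n] by (intro borel_measurable_vec_component) (simp add: Linf_def)
              have mi: "(\<lambda>x. indicator {a..b} x :: complex) \<in> borel_measurable I01"
                using integrable_indicator_interval[of a b] by auto
              show "(\<lambda>x. exp (Q j x) * (u n t x $ j - 0 $ j) * indicator {a..b} x) \<in> borel_measurable I01"
                using m mi continuous_bounded_measurable(1)[OF exp_Q_continuous[of j]] by simp
              show "(\<lambda>x. W n j (t + x / c j) * indicator {a..b} x) \<in> borel_measurable I01"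
                using mi translate_interval_integral(2)[OF P[of _ n j] t0 ab, where j = j] by simp
              show "AE x in I01. exp (Q j x) * (u n t x $ j - 0 $ j) * indicator {a..b} x = W n j (t + x / c j) * indicator {a..b} x"
                using gauge[OF t0, of j n] by eventually_elim simp
            qed
            also have "\<dots> = c j * (P n j (t + b / c j) - P n j (t + a / c j))"
              by (rule translate_interval_integral(1)[OF P t0 ab])
            finally have eq: "(LINT x|I01. exp (Q j x) * (u n t x $ j - 0 $ j) * indicator {a..b} x)
                = c j * (P n j (t + b / c j) - P n j (t + a / c j))" .
            have mem: "t + z / c j \<in> {0..N}" if "0 \<le> z" "z \<le> 1" for z
            proof -
              have "0 \<le> z / c j" "z / c j \<le> 1 / c j" using that c_pos[of j] by (auto simp: divide_right_mono)
              then show ?thesis using t N[of j] by auto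
            qed
            have "cmod (P n j (t + b / c j)) < e / (2 * c j)" "cmod (P n j (t + a / c j)) < e / (2 * c j)"
              using elim mem ab by auto
            then have "cmod (P n j (t + b / c j) - P n j (t + a / c j)) < e / c j"
              using norm_triangle_ineq4[of "P n j (t + b / c j)" "P n j (t + a / c j)"] by (simp add: field_simps)
            then have "c j * cmod (P n j (t + b / c j) - P n j (t + a / c j)) < e"
              using c_pos[of j] by (simp add: field_simps)
            then show "dist (LINT x|I01. exp (Q j x) * (u (fst (n, t)) (snd (n, t)) x $ j - 0 $ j) * indicator {a..b} x) 0 < e"
              using c_pos[of j] eq by (simp add: norm_mult)
          qed
        qed
      qed
    qed
  qed
  then show ?thesis by (simp add: eventually_prod_principal)
qed

lemma well_posed_flow: "well_posed (flow_domain B) (flow_operator c q)"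
  unfolding well_posed_def
proof (intro conjI)
  show "\<forall>f\<in>flow_domain B. \<exists>u. is_solution (flow_domain B) (flow_operator c q) f u"
    using flow_solution_is_solution by blast
  show "\<forall>f\<in>flow_domain B. \<forall>u v. is_solution (flow_domain B) (flow_operator c q) f u \<and>
      is_solution (flow_domain B) (flow_operator c q) f v \<longrightarrow> (\<forall>t\<ge>0. ae_eq (u t) (v t))"
  proof (intro ballI allI impI)
    fix f u v and t :: real
    assume f: "f \<in> flow_domain B" and t: "0 \<le> t" and
      uv: "is_solution (flow_domain B) (flow_operator c q) f u \<and> is_solution (flow_domain B) (flow_operator c q) f v"
    have "ae_eq (u t) (flow_solution f t)" "ae_eq (v t) (flow_solution f t)"
      using solution_eq_flow_solution[OF f _ t] uv by auto
    then show "ae_eq (u t) (v t)" unfolding ae_eq_def by eventually_elim simp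
  qed
qed (use continuous_dependence in blast)

end

lemma gauge_exists:
  fixes c :: "'m \<Rightarrow> real" and q :: "'m \<Rightarrow> real \<Rightarrow> complex"
  assumes c: "\<And>j. c j > 0" and q: "\<And>j. q j \<in> Linf cmod"
  obtains Q p :: "'m \<Rightarrow> real \<Rightarrow> complex" where "\<And>j. is_primitive 0 1 (Q j) (p j)" "\<And>j. Q j 0 = 0" "\<And>j. AE x in I01. q j x = c j * p j x"
proof -
  have "\<exists>p::real \<Rightarrow> complex. p \<in> borel_measurable I01 \<and> bounded (p ` {0..1}) \<and> (AE x in I01. q j x = c j * p x)" for j
  proof -
    obtain K where K: "AE x in I01. cmod (q j x) \<le> K" by (rule Linf_AE_bound[OF q]) blast
    have "q j \<in> borel_measurable I01" using q[of j] by (simp add: Linf_def)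
    then have "(\<lambda>x. q j x / c j) \<in> borel_measurable I01"
      by (rule borel_measurable_divide[OF _ borel_measurable_const])
    moreover have "AE x in I01. cmod (q j x / c j) \<le> K / c j"
      using K by eventually_elim (use c[of j] in \<open>simp add: norm_divide divide_right_mono\<close>)
    ultimately obtain p where p: "p \<in> borel_measurable I01" "bounded (p ` {0..1})" "AE x in I01. q j x / c j = p x"
      by (rule clip_bounded)
    have "AE x in I01. q j x = c j * p x"
      using p(3) by eventually_elim (use c[of j] in \<open>auto simp: field_simps\<close>)
    with p(1,2) show ?thesis by (intro exI[of _ p] conjI)
  qed
  then have "\<forall>j. \<exists>p::real \<Rightarrow> complex. p \<in> borel_measurable I01 \<and> bounded (p ` {0..1}) \<and> (AE x in I01. q j x = c j * p x)"
    by (rule allI)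
  then obtain p :: "'m \<Rightarrow> real \<Rightarrow> complex" where pp: "\<forall>j. p j \<in> borel_measurable I01 \<and> bounded (p j ` {0..1}) \<and>
      (AE x in I01. q j x = c j * p j x)" by (rule choice[THEN exE])
  note p = pp[THEN spec, THEN conjunct1] pp[THEN spec, THEN conjunct2, THEN conjunct1]
    pp[THEN spec, THEN conjunct2, THEN conjunct2]
  show thesis
    by (rule that[OF primitive_of_density[OF p(1,2)] _ p(3)]) simp
qed

theorem corollary3:
  fixes G :: "('v, 'm::finite) pre_digraph"
    and w :: "'m \<Rightarrow> 'm \<Rightarrow> real"
    and c :: "'m \<Rightarrow> real"
    and q :: "'m \<Rightarrow> real \<Rightarrow> complex"
  assumes "simple_weighted_digraph G w"
    and "\<And>j. c j > 0"
    and "\<And>j. q j \<in> Linf cmod"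
  shows "well_posed (flow_domain (conj_matrix c (line_graph_matrix G w))) (flow_operator c q)"
proof -
  obtain Q p :: "'m \<Rightarrow> real \<Rightarrow> complex" where "\<And>j. is_primitive 0 1 (Q j) (p j)" "\<And>j. Q j 0 = 0" "\<And>j. AE x in I01. q j x = c j * p j x"
    by (rule gauge_exists[of c q, OF assms(2,3)]) blast
  then interpret flow_problem c q "conj_matrix c (line_graph_matrix G w)" Q p
    using assms(2) by unfold_locales
  show ?thesis by (rule well_posed_flow)
qed

end
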